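(* Let $1<p<\infty$, $p\neq2$. Then $\ell_p$ has a continuum of renormings (i.e. a family, of cardinality $\mathfrak{c}$, of equivalent norms) none of whose isometry groups is contained in any maximal bounded subgroup of the isomorphism group $\mathrm{GL}(\ell_p)$. Moreover, these isometry groups are pairwise non-conjugate in $\mathrm{GL}(\ell_p)$.
   Context: $\ell_p$ is real or complex. The isometry group of an equivalent norm is the group of its surjective linear isometries. $\mathrm{GL}(X)$ is the group of all isomorphisms of $X$ onto $X$; a subgroup $G$ is bounded if $\sup_{g\in G}\|g\|<\infty$, and a maximal bounded subgroup is a bounded subgroup not properly contained in any other bounded subgroup. Subgroups $G_1,G_2$ of $\mathrm{GL}(X)$ are conjugate if $G_1=T^{-1}G_2T$ for some $T\in\mathrm{GL}(X)$. *)

theory Defs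
  imports "HOL-Analysis.Analysis" "HOL-Algebra.Bij" "HOL-Library.Equipollence"
begin

text \<open>
  Since the exponent varies, the space is a carrier set of sequences; the scalar type is
  instantiated to \<^typ>\<open>real\<close> or \<^typ>\<open>complex\<close>. As in \<^const>\<open>BijGroup\<close>, operators (and norms) on
  the carrier are \<^const>\<open>extensional\<close>, so equality of functions is equality on the carrier.
\<close>

definition ell :: "real \<Rightarrow> (nat \<Rightarrow> 'a::real_normed_field) set" where
  "ell p = {x. summable (\<lambda>n. norm (x n) powr p)}"

definition ell_norm :: "real \<Rightarrow> (nat \<Rightarrow> 'a::real_normed_field) \<Rightarrow> real" where
  "ell_norm p x = (\<Sum>n. norm (x n) powr p) powr (1 / p)"

definition linear_map_ell ::
    "real \<Rightarrow> ((nat \<Rightarrow> 'a::real_normed_field) \<Rightarrow> (nat \<Rightarrow> 'a)) \<Rightarrow> bool" where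
  "linear_map_ell p T \<longleftrightarrow> T \<in> ell p \<rightarrow> ell p \<and>
     (\<forall>x\<in>ell p. \<forall>y\<in>ell p. T (\<lambda>n. x n + y n) = (\<lambda>n. T x n + T y n)) \<and>
     (\<forall>c. \<forall>x\<in>ell p. T (\<lambda>n. c * x n) = (\<lambda>n. c * T x n))"

definition bounded_linear_map_ell ::
    "real \<Rightarrow> ((nat \<Rightarrow> 'a::real_normed_field) \<Rightarrow> (nat \<Rightarrow> 'a)) \<Rightarrow> bool" where
  "bounded_linear_map_ell p T \<longleftrightarrow> linear_map_ell p T \<and>
     (\<exists>C. \<forall>x\<in>ell p. ell_norm p (T x) \<le> C * ell_norm p x)"

definition op_norm_ell ::
    "real \<Rightarrow> ((nat \<Rightarrow> 'a::real_normed_field) \<Rightarrow> (nat \<Rightarrow> 'a)) \<Rightarrow> real" where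
  "op_norm_ell p T = Sup {ell_norm p (T x) | x. x \<in> ell p \<and> ell_norm p x \<le> 1}"

definition GL_ell ::
    "real \<Rightarrow> ((nat \<Rightarrow> 'a::real_normed_field) \<Rightarrow> (nat \<Rightarrow> 'a)) monoid" where
  "GL_ell p = (BijGroup (ell p))
     \<lparr>carrier := {T \<in> Bij (ell p). bounded_linear_map_ell p T \<and>
                   bounded_linear_map_ell p (inv_into (ell p) T)}\<rparr>"

definition bounded_subgroup_ell ::
    "real \<Rightarrow> ((nat \<Rightarrow> 'a::real_normed_field) \<Rightarrow> (nat \<Rightarrow> 'a)) set \<Rightarrow> bool" where
  "bounded_subgroup_ell p G \<longleftrightarrow> subgroup G (GL_ell p) \<and> bdd_above (op_norm_ell p ` G)"

definition maximal_bounded_subgroup_ell ::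
    "real \<Rightarrow> ((nat \<Rightarrow> 'a::real_normed_field) \<Rightarrow> (nat \<Rightarrow> 'a)) set \<Rightarrow> bool" where
  "maximal_bounded_subgroup_ell p G \<longleftrightarrow> bounded_subgroup_ell p G \<and>
     (\<nexists>H. bounded_subgroup_ell p H \<and> G \<subset> H)"

definition conjugate_ell ::
    "real \<Rightarrow> ((nat \<Rightarrow> 'a::real_normed_field) \<Rightarrow> (nat \<Rightarrow> 'a)) set \<Rightarrow>
     ((nat \<Rightarrow> 'a) \<Rightarrow> (nat \<Rightarrow> 'a)) set \<Rightarrow> bool" where
  "conjugate_ell p G\<^sub>1 G\<^sub>2 \<longleftrightarrow> (\<exists>T\<in>carrier (GL_ell p).
     G\<^sub>1 = (\<lambda>g. inv\<^bsub>GL_ell p\<^esub> T \<otimes>\<^bsub>GL_ell p\<^esub> g \<otimes>\<^bsub>GL_ell p\<^esub> T) ` G\<^sub>2)"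

definition equivalent_norm_ell ::
    "real \<Rightarrow> ((nat \<Rightarrow> 'a::real_normed_field) \<Rightarrow> real) \<Rightarrow> bool" where
  "equivalent_norm_ell p N \<longleftrightarrow> N \<in> extensional (ell p) \<and>
     (\<forall>x\<in>ell p. 0 \<le> N x \<and> (N x = 0 \<longleftrightarrow> x = (\<lambda>n. 0))) \<and>
     (\<forall>c. \<forall>x\<in>ell p. N (\<lambda>n. c * x n) = norm c * N x) \<and>
     (\<forall>x\<in>ell p. \<forall>y\<in>ell p. N (\<lambda>n. x n + y n) \<le> N x + N y) \<and>
     (\<exists>a>0. \<exists>b>0. \<forall>x\<in>ell p. a * ell_norm p x \<le> N x \<and> N x \<le> b * ell_norm p x)"

definition isometry_group_ell ::
    "real \<Rightarrow> ((nat \<Rightarrow> 'a::real_normed_field) \<Rightarrow> real) \<Rightarrow>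
     ((nat \<Rightarrow> 'a) \<Rightarrow> (nat \<Rightarrow> 'a)) set" where
  "isometry_group_ell p N = {T \<in> extensional (ell p). linear_map_ell p T \<and>
     T ` ell p = ell p \<and> (\<forall>x\<in>ell p. N (T x) = N x)}"

end

theory Submission
  imports Defs "HOL-Library.Function_Algebras"
begin

text \<open>
  By Khinchine's inequality, Hilbert spaces of all finite dimensions are uniformly complemented in
  finite-dimensional \<open>l\<^sub>p\<close> spaces, and Pelczynski's decomposition turns this into an isomorphism of \<open>l\<^sub>p\<close>
  with the \<open>l\<^sub>p\<close>-sum of Hilbert spaces of dimensions \<open>2 ^ e k\<close>, for any injective \<open>e\<close>.

  Let a bounded group contain the isometries of this sum; it acts by isometries of an equivalent norm
  \<open>\<nu>\<close>. Conjugates of the reflections in block vectors are again \<open>\<nu>\<close>-isometric reflections, and products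
  of these rotate any two blocks met by one reflection vector into each other. So the blocks fall into
  clusters on which \<open>\<nu>\<close> is a Hilbert norm; clusters are finite because \<open>p \<noteq> 2\<close>, and every isometry
  permutes them. The dimensions of different clusters are sums of different powers of two, so every
  isometry preserves every cluster. Replacing \<open>\<nu>\<close> by a norm that is Hilbertian on the sum of two
  clusters strictly enlarges the isometry group, so no such group is maximal. Finally, the clusters are
  the minimal invariant subspaces of the group, whence the conjugacy class determines the range of \<open>e\<close>.
\<close>

section \<open>Minkowski's inequality and scalar conjugation\<close>

text \<open>Of a bounded group only one thing is known: it contains the isometries of the sum, so
  its invariant norm may tie blocks together in many ways. All that is used of these isometries are
  the unitaries of single blocks and the scalars of modulus one on sets of blocks. They suffice
  because an isometric reflection is determined by its vector and also by its functional: otherwise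
  a product of two reflections would have unbounded powers. A symmetry of the vector is therefore a
  symmetry of the functional, which forces the functional to be an inner product on each block.

  Merging needs clusters that are preserved and not merely permuted: an isometry exchanging one of
  the two with a third cluster would in general violate the merged norm. This is why the dimensions
  must tell finite sets of blocks apart. Finiteness of clusters also guarantees that there are two
  of them to merge. Real and complex scalars are treated at once, with \<open>cj\<close> the
  identity or the conjugation.\<close>

lemma powr_add_le:
  fixes a b p :: real
  assumes "0 \<le> a" "0 \<le> b" "0 \<le> p"
  shows "(a + b) powr p \<le> 2 powr p * (a powr p + b powr p)"
proof -
  have "(a + b) powr p \<le> (2 * max a b) powr p"
    using assms by (intro powr_mono2) auto
  also have "\<dots> = 2 powr p * max a b powr p"
    using assms by (simp add: powr_mult)
  also have "max a b powr p \<le> a powr p + b powr p"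
    by (auto simp: max_def)
  finally show ?thesis by (simp add: mult_left_mono)
qed

lemma powr_convex_comb:
  fixes s t p a b :: real
  assumes "0 \<le> s" "0 \<le> t" "1 \<le> p" "0 \<le> a" "0 \<le> b" "a + b = 1"
  shows "(a * s + b * t) powr p \<le> a * s powr p + b * t powr p"
proof (cases "s = 0 \<or> t = 0")
  case False
  then have "s > 0" "t > 0" using assms by auto
  then have "((1 - b) *\<^sub>R s + b *\<^sub>R t) powr p \<le> (1 - b) * s powr p + b * t powr p"
    using convex_onD[OF powr_convex[OF assms(3)], of b s t] assms by simp
  moreover have "1 - b = a" using assms by simp
  ultimately show ?thesis by simp
next
  case True
  \<comment> \<open>With a zero endpoint the claim shrinks to this inequality for the remaining
    weight.\<close>
  have le: "c powr p \<le> c" if "0 \<le> c" "c \<le> 1" for c :: real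
    using that assms powr_mono'[of 1 p c] by (cases "c = 0") auto
  have "a \<le> 1" "b \<le> 1" using assms by auto
  then show ?thesis
    using True assms le[of a] le[of b]
    by (auto simp: powr_mult intro!: mult_right_mono)
qed

lemma summable_powr_add:
  fixes a b :: "nat \<Rightarrow> real"
  assumes "0 \<le> p" "\<And>k. 0 \<le> a k" "\<And>k. 0 \<le> b k"
    and "summable (\<lambda>k. a k powr p)" "summable (\<lambda>k. b k powr p)"
  shows "summable (\<lambda>k. (a k + b k) powr p)"
proof (rule summable_comparison_test')
  show "summable (\<lambda>k. 2 powr p * (a k powr p + b k powr p))"
    using assms by (intro summable_mult summable_add)
  show "norm ((a k + b k) powr p) \<le> 2 powr p * (a k powr p + b k powr p)" if "k \<ge> 0" for k
    using powr_add_le assms by simp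
qed

text \<open>Minkowski by convexity alone: after division by the two norms \<open>A\<close> and
  \<open>B\<close>, the sum is \<open>A + B\<close> times a convex combination with weights
  \<open>A / (A + B)\<close> and \<open>B / (A + B)\<close>, to which
  \<open>powr_convex_comb\<close> applies termwise.\<close>

lemma suminf_powr_add:
  fixes a b :: "nat \<Rightarrow> real"
  assumes "1 \<le> p" "\<And>k. 0 \<le> a k" "\<And>k. 0 \<le> b k"
    and sa: "summable (\<lambda>k. a k powr p)" and sb: "summable (\<lambda>k. b k powr p)"
  shows "(\<Sum>k. (a k + b k) powr p) powr (1/p)
         \<le> (\<Sum>k. a k powr p) powr (1/p) + (\<Sum>k. b k powr p) powr (1/p)"
proof -
  define A where "A = (\<Sum>k. a k powr p) powr (1/p)"
  define B where "B = (\<Sum>k. b k powr p) powr (1/p)"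
  have zero: "u = (\<lambda>k. 0)" if "summable (\<lambda>k. u k powr p)" "\<And>k. 0 \<le> u k" "(\<Sum>k. u k powr p) = 0"
    for u :: "nat \<Rightarrow> real"
    using that suminf_eq_zero_iff[of "\<lambda>k. u k powr p"] by auto
  have nn: "0 \<le> (\<Sum>k. a k powr p)" "0 \<le> (\<Sum>k. b k powr p)"
    using sa sb by (auto intro!: suminf_nonneg)
  show ?thesis
  proof (cases "A = 0 \<or> B = 0")
    case True
    then show ?thesis
    proof
      assume "A = 0"
      then have "a = (\<lambda>k. 0)" using zero[OF sa assms(2)] by (simp add: A_def)
      then show ?thesis by simp
    next
      assume "B = 0"
      then have "b = (\<lambda>k. 0)" using zero[OF sb assms(3)] by (simp add: B_def)
      then show ?thesis by simp
    qed
  next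
    case False
    then have pos: "A > 0" "B > 0" by (auto simp: A_def B_def)
    have Ap: "A powr p = (\<Sum>k. a k powr p)" and Bp: "B powr p = (\<Sum>k. b k powr p)"
      using nn assms by (auto simp: A_def B_def powr_powr)
    define s t where "s = A / (A + B)" and "t = B / (A + B)"
    have st: "0 \<le> s" "0 \<le> t" "s + t = 1"
      using pos by (auto simp: s_def t_def simp flip: add_divide_distrib)
    have le: "(a k + b k) powr p
        \<le> (A + B) powr p * (s / A powr p * a k powr p + t / B powr p * b k powr p)" for k
    proof -
      have "a k + b k = (A + B) * (s * (a k / A) + t * (b k / B))"
        using pos by (simp add: s_def t_def divide_simps)
      then have "(a k + b k) powr p = (A + B) powr p * (s * (a k / A) + t * (b k / B)) powr p"
        using pos st assms(2,3)[of k] by (simp add: powr_mult)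
      also have "\<dots> \<le> (A + B) powr p * (s * (a k / A) powr p + t * (b k / B) powr p)"
        using pos st assms by (intro mult_left_mono powr_convex_comb) auto
      finally show ?thesis using pos assms by (simp add: powr_divide)
    qed
    have vscale: "summable (\<lambda>k. (A + B) powr p * (s / A powr p * a k powr p + t / B powr p * b k powr p))"
      using sa sb by (intro summable_mult summable_add)
    have "(\<Sum>k. (a k + b k) powr p)
        \<le> (\<Sum>k. (A + B) powr p * (s / A powr p * a k powr p + t / B powr p * b k powr p))"
      using le vscale summable_powr_add[OF _ assms(2,3) sa sb] assms(1) by (intro suminf_le) auto
    also have "\<dots> = (A + B) powr p * (s / A powr p * A powr p + t / B powr p * B powr p)"
    proof (rule sums_unique[symmetric])
      have "(\<lambda>k. a k powr p) sums A powr p" "(\<lambda>k. b k powr p) sums B powr p"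
        using sa sb by (simp_all add: Ap Bp summable_sums)
      then show "(\<lambda>k. (A + B) powr p * (s / A powr p * a k powr p + t / B powr p * b k powr p))
          sums ((A + B) powr p * (s / A powr p * A powr p + t / B powr p * B powr p))"
        by (intro sums_mult sums_add)
    qed
    also have "\<dots> = (A + B) powr p"
      using pos st by simp
    finally have "(\<Sum>k. (a k + b k) powr p) powr (1/p) \<le> ((A + B) powr p) powr (1/p)"
      using assms summable_powr_add[OF _ assms(2,3) sa sb]
      by (intro powr_mono2) (auto intro!: suminf_nonneg)
    then show ?thesis using pos assms by (simp add: powr_powr A_def B_def)
  qed
qed

text \<open>Shared by the real and the complex case, with \<open>cj\<close> the identity or
  \<open>cnj\<close>. \<open>mult_cj\<close> makes \<open>block_inner\<close> positive definite, and
  the sort \<open>real_inner\<close> supplies the equality case of the triangle inequality for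
  scalars.\<close>

locale conj_field =
  fixes cj :: "'a::{real_normed_field,real_inner} \<Rightarrow> 'a"
  assumes cj_add: "cj (x + y) = cj x + cj y"
    and cj_mult: "cj (x * y) = cj x * cj y"
    and cj_cj [simp]: "cj (cj x) = x"
    and mult_cj: "x * cj x = of_real ((norm x)\<^sup>2)"
begin

lemma cj_0 [simp]: "cj 0 = 0"
  using cj_add[of 0 0] by simp

lemma cj_minus: "cj (- x) = - cj x"
  using cj_add[of x "- x"] by (simp add: eq_neg_iff_add_eq_0 add.commute)

lemma cj_diff: "cj (x - y) = cj x - cj y"
  using cj_add[of x "- y"] by (simp add: cj_minus)

lemma cj_sum: "cj (sum f A) = (\<Sum>i\<in>A. cj (f i))"
  by (induction A rule: infinite_finite_induct) (auto simp: cj_add)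

lemma cj_of_real [simp]: "cj (of_real r) = of_real r"
proof (cases "r = 0")
  case False
  then show ?thesis using mult_cj[of "of_real r"] by (simp add: power2_eq_square)
qed simp

lemma cj_1 [simp]: "cj 1 = 1"
  using cj_of_real[of 1] by simp

lemma cj_numeral [simp]: "cj (numeral k) = numeral k"
  using cj_of_real[of "numeral k"] by simp

lemma norm_cj [simp]: "norm (cj x) = norm x"
proof (cases "x = 0")
  case False
  have "norm x * norm (cj x) = norm x * norm x"
    using arg_cong[OF mult_cj[of x], of norm] by (simp add: norm_mult power2_eq_square)
  then show ?thesis using False by simp
qed simp

lemma cj_eq_0 [simp]: "cj x = 0 \<longleftrightarrow> x = 0"
  by (metis cj_0 cj_cj)

lemma cj_inverse: "cj (inverse x) = inverse (cj x)"
proof (cases "x = 0")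
  case False
  then have "cj x * cj (inverse x) = 1"
    using cj_mult[of x "inverse x"] cj_of_real[of 1] by simp
  then show ?thesis by (metis inverse_unique)
qed simp

lemma cj_divide: "cj (x / y) = cj x / cj y"
  by (simp add: divide_inverse cj_mult cj_inverse)

end

lemma conj_field_real: "conj_field (\<lambda>x::real. x)"
  by unfold_locales (auto simp: power2_eq_square)

lemma conj_field_complex: "conj_field cnj"
  by unfold_locales (auto simp flip: complex_norm_square)

section \<open>Sums of Hilbert space blocks\<close>

definition vscale :: "'a::real_normed_field \<Rightarrow> (nat \<Rightarrow> nat \<Rightarrow> 'a) \<Rightarrow> nat \<Rightarrow> nat \<Rightarrow> 'a"
  where "vscale c z = (\<lambda>k i. c * z k i)"

definition part :: "nat set \<Rightarrow> (nat \<Rightarrow> nat \<Rightarrow> 'a::real_normed_field) \<Rightarrow> nat \<Rightarrow> nat \<Rightarrow> 'a"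
  where "part A z = (\<lambda>k i. if k \<in> A then z k i else 0)"

definition block_scale :: "nat set \<Rightarrow> 'a::real_normed_field \<Rightarrow> (nat \<Rightarrow> nat \<Rightarrow> 'a) \<Rightarrow> nat \<Rightarrow> nat \<Rightarrow> 'a"
  where "block_scale A c z = (\<lambda>k i. if k \<in> A then c * z k i else z k i)"

lemma vscale_apply [simp]: "vscale c z k i = c * z k i"
  by (simp add: vscale_def)

lemma part_apply: "part A z k i = (if k \<in> A then z k i else 0)"
  by (simp add: part_def)

lemma block_scale_apply: "block_scale A c z k i = (if k \<in> A then c * z k i else z k i)"
  by (simp add: block_scale_def)

lemma vscale_add: "vscale c (x + y) = vscale c x + vscale c y"
  by (intro ext) (simp add: algebra_simps)

lemma vscale_diff: "vscale c (x - y) = vscale c x - vscale c y"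
  by (intro ext) (simp add: algebra_simps)

lemma vscale_left_add: "vscale (c + d) x = vscale c x + vscale d x"
  by (intro ext) (simp add: algebra_simps)

lemma vscale_vscale [simp]: "vscale c (vscale d x) = vscale (c * d) x"
  by (intro ext) (simp add: algebra_simps)

lemma vscale_1 [simp]: "vscale 1 x = x"
  by (intro ext) simp

lemma vscale_0 [simp]: "vscale 0 x = 0"
  by (intro ext) simp

lemma vscale_zero [simp]: "vscale c 0 = 0"
  by (intro ext) simp

lemma vscale_minus1: "vscale (- 1) x = - x"
  by (intro ext) simp

lemma vscale_eq_0 [simp]: "vscale c x = 0 \<longleftrightarrow> c = 0 \<or> x = 0"
  by (auto simp: fun_eq_iff)

lemma part_add: "part A (x + y) = part A x + part A y"
  by (intro ext) (simp add: part_apply)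

lemma part_diff: "part A (x - y) = part A x - part A y"
  by (intro ext) (simp add: part_apply)

lemma part_vscale: "part A (vscale c x) = vscale c (part A x)"
  by (intro ext) (simp add: part_apply)

lemma part_part [simp]: "part A (part B x) = part (A \<inter> B) x"
  by (intro ext) (simp add: part_apply)

lemma part_zero [simp]: "part A 0 = 0"
  by (intro ext) (simp add: part_apply)

lemma part_empty [simp]: "part {} x = 0"
  by (intro ext) (simp add: part_apply)

lemma part_Compl: "part (- A) x = x - part A x"
  by (intro ext) (simp add: part_apply)

lemma block_scale_eq: "block_scale A c x = x + vscale (c - 1) (part A x)"
  by (intro ext) (simp add: block_scale_apply part_apply algebra_simps)

lemma part_eq_0_iff: "part A x = 0 \<longleftrightarrow> (\<forall>k\<in>A. part {k} x = 0)"
  by (auto simp: fun_eq_iff part_apply)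

lemma part_Un: "A \<inter> B = {} \<Longrightarrow> part (A \<union> B) x = part A x + part B x"
  by (intro ext) (auto simp: part_apply)

lemma part_subset_id: "part A x = x \<Longrightarrow> A \<subseteq> B \<Longrightarrow> part B x = x"
  by (metis part_part inf.absorb_iff2)

locale blocks = conj_field cj for cj :: "'a::{real_normed_field,real_inner} \<Rightarrow> 'a" +
  fixes p :: real and n :: "nat \<Rightarrow> nat"
  assumes p_gt_1: "1 < p"
begin

definition block_norm :: "nat \<Rightarrow> (nat \<Rightarrow> nat \<Rightarrow> 'a) \<Rightarrow> real"
  where "block_norm k z = L2_set (\<lambda>i. norm (z k i)) {..<n k}"

definition block_inner :: "nat \<Rightarrow> (nat \<Rightarrow> nat \<Rightarrow> 'a) \<Rightarrow> (nat \<Rightarrow> nat \<Rightarrow> 'a) \<Rightarrow> 'a"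
  where "block_inner k x y = (\<Sum>i<n k. x k i * cj (y k i))"

text \<open>Entries beyond the dimension of a block are forced to be zero, so that equality of
  functions is equality of vectors and the pointwise operations can be used unrestricted.\<close>

definition Z :: "(nat \<Rightarrow> nat \<Rightarrow> 'a) set"
  where "Z = {z. (\<forall>k i. n k \<le> i \<longrightarrow> z k i = 0) \<and> summable (\<lambda>k. block_norm k z powr p)}"

definition lp_norm :: "(nat \<Rightarrow> nat \<Rightarrow> 'a) \<Rightarrow> real"
  where "lp_norm z = (\<Sum>k. block_norm k z powr p) powr (1 / p)"

text \<open>A rank-one perturbation of the identity, unitary on block \<open>k\<close> once
  \<open>c + cj c = c * cj c * block_inner k w w\<close>. The choice
  \<open>c = 2 / block_inner k w w\<close> gives the reflection in \<open>w\<close>.\<close>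

definition householder :: "nat \<Rightarrow> (nat \<Rightarrow> nat \<Rightarrow> 'a) \<Rightarrow> 'a \<Rightarrow> (nat \<Rightarrow> nat \<Rightarrow> 'a) \<Rightarrow> nat \<Rightarrow> nat \<Rightarrow> 'a"
  where "householder k w c z = z - vscale (c * block_inner k z w) (part {k} w)"

definition linZ :: "((nat \<Rightarrow> nat \<Rightarrow> 'a) \<Rightarrow> (nat \<Rightarrow> nat \<Rightarrow> 'a)) \<Rightarrow> bool"
  where "linZ T \<longleftrightarrow> (\<forall>x\<in>Z. T x \<in> Z) \<and> (\<forall>x\<in>Z. \<forall>y\<in>Z. T (x + y) = T x + T y) \<and>
    (\<forall>c. \<forall>x\<in>Z. T (vscale c x) = vscale c (T x))"

text \<open>Only the behaviour on \<open>Z\<close> is prescribed, in contrast to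
  \<open>isometry_group_ell\<close>; this spares restrictions when operators are composed.\<close>

definition isoZ :: "((nat \<Rightarrow> nat \<Rightarrow> 'a) \<Rightarrow> real) \<Rightarrow> ((nat \<Rightarrow> nat \<Rightarrow> 'a) \<Rightarrow> (nat \<Rightarrow> nat \<Rightarrow> 'a)) set"
  where "isoZ nu = {T. linZ T \<and> T ` Z = Z \<and> (\<forall>x\<in>Z. nu (T x) = nu x)}"

lemma block_inner_add_left: "block_inner k (x + y) z = block_inner k x z + block_inner k y z"
  by (simp add: block_inner_def sum.distrib algebra_simps)

lemma block_inner_diff_left: "block_inner k (x - y) z = block_inner k x z - block_inner k y z"
  by (simp add: block_inner_def sum_subtractf algebra_simps)

lemma block_inner_sm_left: "block_inner k (vscale c x) z = c * block_inner k x z"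
  by (simp add: block_inner_def sum_distrib_left algebra_simps)

lemma block_inner_add_right: "block_inner k z (x + y) = block_inner k z x + block_inner k z y"
  by (simp add: block_inner_def sum.distrib algebra_simps cj_add)

lemma block_inner_diff_right: "block_inner k z (x - y) = block_inner k z x - block_inner k z y"
  by (simp add: block_inner_def sum_subtractf algebra_simps cj_diff)

lemma block_inner_sm_right: "block_inner k z (vscale c x) = cj c * block_inner k z x"
  by (simp add: block_inner_def sum_distrib_left algebra_simps cj_mult)

lemmas block_inner_simps = block_inner_add_left block_inner_diff_left block_inner_sm_left block_inner_add_right block_inner_diff_right block_inner_sm_right

lemma block_inner_zero [simp]: "block_inner k 0 z = 0" "block_inner k z 0 = 0"
  by (simp_all add: block_inner_def)

lemma cj_inner: "cj (block_inner k x y) = block_inner k y x"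
  by (simp add: block_inner_def cj_sum cj_mult mult.commute)

lemma block_inner_part_left: "block_inner k (part A x) y = (if k \<in> A then block_inner k x y else 0)"
  by (simp add: block_inner_def part_apply)

lemma block_inner_part_right: "block_inner k x (part A y) = (if k \<in> A then block_inner k x y else 0)"
  by (simp add: block_inner_def part_apply)

lemma block_norm_nonneg [simp]: "0 \<le> block_norm k z"
  by (simp add: block_norm_def)

lemma block_inner_self: "block_inner k x x = of_real ((block_norm k x)\<^sup>2)"
  by (simp add: block_inner_def block_norm_def L2_set_def sum_nonneg mult_cj)

lemma block_norm_eqI: "block_inner k x x = block_inner k y y \<Longrightarrow> block_norm k x = block_norm k y"
  by (simp add: block_inner_self del: of_real_power)

lemma block_norm_add: "block_norm k (x + y) \<le> block_norm k x + block_norm k y"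
proof -
  have "block_norm k (x + y) \<le> L2_set (\<lambda>i. norm (x k i) + norm (y k i)) {..<n k}"
    unfolding block_norm_def by (intro L2_set_mono) (auto intro: norm_triangle_ineq)
  also have "\<dots> \<le> block_norm k x + block_norm k y"
    unfolding block_norm_def by (rule L2_set_triangle_ineq)
  finally show ?thesis .
qed

lemma block_norm_vscale: "block_norm k (vscale c x) = norm c * block_norm k x"
  by (simp add: block_norm_def norm_mult L2_set_right_distrib)

lemma block_norm_0 [simp]: "block_norm k 0 = 0"
  by (simp add: block_norm_def L2_set_0')

lemma block_norm_part: "block_norm k (part A x) = (if k \<in> A then block_norm k x else 0)"
  by (simp add: block_norm_def part_apply L2_set_0')

lemma ZD: "z \<in> Z \<Longrightarrow> n k \<le> i \<Longrightarrow> z k i = 0"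
  by (simp add: Z_def)

lemma Z_summable: "z \<in> Z \<Longrightarrow> summable (\<lambda>k. block_norm k z powr p)"
  by (simp add: Z_def)

lemma block_norm_eq_0_iff:
  assumes "z \<in> Z"
  shows "block_norm k z = 0 \<longleftrightarrow> part {k} z = 0"
proof -
  have "block_norm k z = 0 \<longleftrightarrow> (\<forall>i<n k. z k i = 0)"
    by (auto simp: block_norm_def L2_set_eq_0_iff)
  also have "\<dots> \<longleftrightarrow> (\<forall>i. z k i = 0)"
    using ZD[OF assms] leI by blast
  finally show ?thesis by (auto simp: fun_eq_iff part_apply)
qed

lemma Z_0 [simp]: "0 \<in> Z"
  by (simp add: Z_def)

lemma Z_add: "x \<in> Z \<Longrightarrow> y \<in> Z \<Longrightarrow> x + y \<in> Z"
proof -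
  assume xy: "x \<in> Z" "y \<in> Z"
  have "summable (\<lambda>k. (block_norm k x + block_norm k y) powr p)"
    using xy p_gt_1 by (intro summable_powr_add) (auto simp: Z_def)
  then have "summable (\<lambda>k. block_norm k (x + y) powr p)"
    using p_gt_1 by (elim summable_comparison_test'[where N = 0]) (auto intro!: powr_mono2 block_norm_add)
  then show ?thesis using xy by (auto simp: Z_def)
qed

lemma Z_vscale: "x \<in> Z \<Longrightarrow> vscale c x \<in> Z"
  by (auto simp: Z_def block_norm_vscale powr_mult intro!: summable_mult)

lemma Z_diff: "x \<in> Z \<Longrightarrow> y \<in> Z \<Longrightarrow> x - y \<in> Z"
  using Z_add[of x "vscale (- 1) y"] Z_vscale[of y "- 1"] by (simp add: vscale_minus1)

lemma Z_mono: 
  assumes "x \<in> Z" "\<And>k. block_norm k y \<le> block_norm k x" "\<And>k i. n k \<le> i \<Longrightarrow> y k i = 0"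
  shows "y \<in> Z"
proof -
  have "summable (\<lambda>k. block_norm k y powr p)"
    using Z_summable[OF assms(1)] assms(2) p_gt_1
    by (elim summable_comparison_test'[where N = 0]) (auto intro!: powr_mono2)
  then show ?thesis using assms by (auto simp: Z_def)
qed

lemma Z_part: "x \<in> Z \<Longrightarrow> part A x \<in> Z"
  by (rule Z_mono) (auto simp: block_norm_part part_apply ZD)

lemma Z_finite:
  assumes "finite A" "\<And>k i. k \<notin> A \<or> n k \<le> i \<Longrightarrow> z k i = 0"
  shows "z \<in> Z"
proof -
  have "part {k} z = 0" if "k \<notin> A" for k using assms that by (auto simp: fun_eq_iff part_apply)
  have "summable (\<lambda>k. block_norm k z powr p)"
  proof (rule summable_finite[OF assms(1)])
    fix k assume "k \<notin> A"
    then show "block_norm k z powr p = 0" using assms by (simp add: block_norm_def L2_set_0')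
  qed
  then show ?thesis using assms by (auto simp: Z_def)
qed

lemma lp_norm_nonneg [simp]: "0 \<le> lp_norm z"
  by (simp add: lp_norm_def)

lemma lp_norm_cong: "(\<And>k. block_norm k x = block_norm k y) \<Longrightarrow> lp_norm x = lp_norm y"
  by (simp add: lp_norm_def)

lemma lp_norm_mono: 
  assumes "y \<in> Z" "\<And>k. block_norm k x \<le> block_norm k y"
  shows "lp_norm x \<le> lp_norm y"
proof -
  have "summable (\<lambda>k. block_norm k x powr p)"
    using Z_summable[OF assms(1)] assms(2) p_gt_1
    by (elim summable_comparison_test'[where N = 0]) (auto intro!: powr_mono2)
  then show ?thesis
    unfolding lp_norm_def using Z_summable[OF assms(1)] assms p_gt_1
    by (intro powr_mono2 suminf_le) (auto intro!: suminf_nonneg)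
qed

lemma lp_norm_part: "y \<in> Z \<Longrightarrow> lp_norm (part A y) \<le> lp_norm y"
  by (rule lp_norm_mono) (auto simp: block_norm_part)

lemma lp_norm_vscale: "x \<in> Z \<Longrightarrow> lp_norm (vscale c x) = norm c * lp_norm x"
  using p_gt_1 Z_summable[of x]
  by (simp add: lp_norm_def block_norm_vscale powr_mult suminf_mult powr_powr suminf_nonneg)

lemma lp_norm_triangle:
  assumes "x \<in> Z" "y \<in> Z"
  shows "lp_norm (x + y) \<le> lp_norm x + lp_norm y"
proof -
  have "summable (\<lambda>k. (block_norm k x + block_norm k y) powr p)"
    using assms p_gt_1 by (intro summable_powr_add) (auto simp: Z_def)
  then have "lp_norm (x + y) \<le> (\<Sum>k. (block_norm k x + block_norm k y) powr p) powr (1 / p)"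
    unfolding lp_norm_def using Z_summable[OF Z_add[OF assms]] p_gt_1
    by (intro powr_mono2 suminf_le) (auto intro!: suminf_nonneg powr_mono2 block_norm_add)
  also have "\<dots> \<le> lp_norm x + lp_norm y"
    unfolding lp_norm_def using assms p_gt_1 by (intro suminf_powr_add) (auto simp: Z_def)
  finally show ?thesis .
qed

lemma lp_norm_eq_0_iff: 
  assumes "x \<in> Z"
  shows "lp_norm x = 0 \<longleftrightarrow> x = 0"
proof
  assume "lp_norm x = 0"
  then have "block_norm k x = 0" for k
    using suminf_eq_zero_iff[OF Z_summable[OF assms]] by (simp add: lp_norm_def)
  then show "x = 0" 
    using block_norm_eq_0_iff[OF assms] by (metis (no_types, lifting) part_apply ext singletonI zero_fun_apply)
qed (simp add: lp_norm_def)

lemma lp_norm_finite: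
  assumes "finite A" "part A z = z"
  shows "lp_norm z = (\<Sum>k\<in>A. block_norm k z powr p) powr (1 / p)"
proof -
  have "block_norm k z = 0" if "k \<notin> A" for k using assms that by (metis block_norm_part)
  then have "(\<Sum>k. block_norm k z powr p) = (\<Sum>k\<in>A. block_norm k z powr p)"
    using assms p_gt_1 by (intro suminf_finite) auto
  then show ?thesis by (simp add: lp_norm_def)
qed

lemma linZD:
  assumes "linZ T"
  shows "x \<in> Z \<Longrightarrow> T x \<in> Z" "x \<in> Z \<Longrightarrow> y \<in> Z \<Longrightarrow> T (x + y) = T x + T y"
    "x \<in> Z \<Longrightarrow> T (vscale c x) = vscale c (T x)"
    "x \<in> Z \<Longrightarrow> y \<in> Z \<Longrightarrow> T (x - y) = T x - T y" "T 0 = 0"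
proof -
  show *: "x \<in> Z \<Longrightarrow> T x \<in> Z" "x \<in> Z \<Longrightarrow> y \<in> Z \<Longrightarrow> T (x + y) = T x + T y"
    "x \<in> Z \<Longrightarrow> T (vscale c x) = vscale c (T x)" for x y c
    using assms by (auto simp: linZ_def)
  show "T 0 = 0" using *(3)[of 0 0] by simp
  show "T (x - y) = T x - T y" if "x \<in> Z" "y \<in> Z"
    using *(2)[OF that(1) Z_vscale[OF that(2), of "-1"]] *(3)[OF that(2), of "-1"]
    by (simp add: vscale_minus1)
qed

lemma isoZD:
  assumes "T \<in> isoZ nu"
  shows "linZ T" "x \<in> Z \<Longrightarrow> nu (T x) = nu x" "T ` Z = Z"
  using assms by (auto simp: isoZ_def)

lemma isoZ_involI:
  assumes "linZ T" "\<And>y. y \<in> Z \<Longrightarrow> T' y \<in> Z" "\<And>y. y \<in> Z \<Longrightarrow> T (T' y) = y"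
    "\<And>y. y \<in> Z \<Longrightarrow> nu (T y) = nu y"
  shows "T \<in> isoZ nu"
proof -
  have "y \<in> T ` Z" if "y \<in> Z" for y
    using assms(2,3)[OF that] by (metis imageI)
  then show ?thesis using assms linZD(1)[OF assms(1)] by (auto simp: isoZ_def)
qed

lemma isoZ_comp: "S \<in> isoZ nu \<Longrightarrow> T \<in> isoZ nu \<Longrightarrow> (\<lambda>x. S (T x)) \<in> isoZ nu"
proof -
  assume a: "S \<in> isoZ nu" "T \<in> isoZ nu"
  then have "(\<lambda>x. S (T x)) ` Z = Z" by (simp add: isoZ_def flip: image_image)
  then show ?thesis using a by (auto simp: isoZ_def linZ_def)
qed

lemma linZ_block_scale: "linZ (block_scale A c)"
  by (auto simp: linZ_def block_scale_eq part_add part_vscale vscale_add Z_add Z_vscale Z_part algebra_simps)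

lemma block_scale_block_scale: "block_scale A c (block_scale A d x) = block_scale A (c * d) x"
  by (intro ext) (simp add: block_scale_apply)

lemma block_scale_1 [simp]: "block_scale A 1 x = x"
  by (intro ext) (simp add: block_scale_apply)

lemma block_norm_block_scale: "norm c = 1 \<Longrightarrow> block_norm k (block_scale A c x) = block_norm k x"
  unfolding block_norm_def by (rule L2_set_cong) (auto simp: block_scale_apply norm_mult)

lemma block_scale_iso:
  assumes "norm c = 1"
  shows "block_scale A c \<in> isoZ lp_norm"
proof (rule isoZ_involI[where T' = "block_scale A (inverse c)"])
  have "c \<noteq> 0" using assms by auto
  then show "block_scale A c (block_scale A (inverse c) y) = y" for y by (simp add: block_scale_block_scale)
qed (auto simp: linZ_block_scale linZD block_norm_block_scale assms intro!: lp_norm_cong)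

lemma linZ_householder: "w \<in> Z \<Longrightarrow> linZ (householder k w c)"
  unfolding linZ_def householder_def
  by (auto simp: block_inner_simps Z_diff Z_vscale Z_part algebra_simps vscale_add vscale_left_add vscale_diff)

lemma block_inner_householder:
  assumes "c + cj c = c * cj c * block_inner k w w"
  shows "block_inner k (householder k w c x) (householder k w c y) = block_inner k x y"
proof -
  have "block_inner k (householder k w c x) (householder k w c y) = block_inner k x y
     - block_inner k x w * block_inner k w y * (c + cj c - c * cj c * block_inner k w w)"
    by (simp add: householder_def block_inner_simps block_inner_part_left block_inner_part_right cj_mult cj_inner algebra_simps)
  then show ?thesis using assms by simp
qed

lemma householder_off: "j \<noteq> k \<Longrightarrow> householder k w c x j i = x j i"
  by (simp add: householder_def part_apply)

lemma block_norm_off: "(\<And>i. x j i = y j i) \<Longrightarrow> block_norm j x = block_norm j y"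
  by (simp add: block_norm_def)

lemma householder_iso:
  assumes "w \<in> Z" and c: "c + cj c = c * cj c * block_inner k w w"
  shows "householder k w c \<in> isoZ lp_norm"
proof (rule isoZ_involI[where T' = "householder k w (cj c)"])
  fix y assume y: "y \<in> Z"
  show "householder k w (cj c) y \<in> Z" using linZD(1)[OF linZ_householder] assms y by blast
  have "householder k w c (householder k w (cj c) y)
      = y - vscale (block_inner k y w * (c + cj c - c * cj c * block_inner k w w)) (part {k} w)"
    by (intro ext) (simp add: householder_def block_inner_simps block_inner_part_left algebra_simps)
  then show "householder k w c (householder k w (cj c) y) = y" using c by simp
  show "lp_norm (householder k w c y) = lp_norm y"
  proof (rule lp_norm_cong)
    fix j show "block_norm j (householder k w c y) = block_norm j y"
      using block_inner_householder[OF c, of y y] by (cases "j = k") (auto intro: block_norm_eqI block_norm_off simp: householder_off)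
  qed
qed (use linZ_householder assms in auto)

text \<open>The map is a Householder reflection up to its scalar \<open>1 / \<langle>a, a - b\<rangle>\<close>, which over the complex numbers
  need not be real.\<close>

lemma ex_block_unitary:
  assumes "a \<in> Z" "b \<in> Z" "part {k} a = a" "part {k} b = b" "block_norm k a = block_norm k b"
  shows "\<exists>T\<in>isoZ lp_norm. T a = b \<and> (\<forall>z j i. j \<noteq> k \<longrightarrow> T z j i = z j i) \<and>
    (\<forall>x y. block_inner k (T x) (T y) = block_inner k x y)"
proof (cases "a = b")
  case True
  have "(\<lambda>x. x) \<in> isoZ lp_norm" by (auto simp: isoZ_def linZ_def)
  then show ?thesis using True by (intro bexI[of _ "\<lambda>x. x"]) simp_all
next
  case False
  define w where "w = a - b"
  have w: "w \<in> Z" "part {k} w = w" "w \<noteq> 0" using assms False by (auto simp: w_def Z_diff part_diff)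
  then have "block_norm k w \<noteq> 0" using block_norm_eq_0_iff by auto
  then have ww: "block_inner k w w \<noteq> 0" by (simp add: block_inner_self)
  have ab: "block_inner k a a = block_inner k b b" using assms by (simp add: block_inner_self)
  have sumw: "block_inner k a w + cj (block_inner k a w) = block_inner k w w"
    using ab by (simp add: w_def block_inner_simps cj_diff cj_inner)
  then have aw: "block_inner k a w \<noteq> 0" using ww by auto
  \<comment> \<open>This scalar gives \<open>householder k w c a = a - w = b\<close>. Equality of
    the norms enters through \<open>sumw\<close>, which turns the unitarity condition into the
    identity \<open>frac\<close>.\<close>
  define c where "c = 1 / block_inner k a w"
  have frac: "1 / s + 1 / t = (1 / s) * (1 / t) * (s + t)" if "s \<noteq> 0" "t \<noteq> 0" for s t :: 'a
    using that by (simp add: field_simps)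
  have "cj c = 1 / cj (block_inner k a w)"
    using cj_of_real[of 1] by (simp add: c_def cj_divide)
  then have c: "c + cj c = c * cj c * block_inner k w w"
    using frac[of "block_inner k a w" "cj (block_inner k a w)"] aw unfolding sumw c_def by simp
  have "householder k w c a = b" using aw w by (simp add: householder_def c_def) (simp add: w_def)
  then show ?thesis using householder_iso[OF w(1) c] block_inner_householder[OF c] householder_off by blast
qed

end

section \<open>Reflections among the isometries\<close>

text \<open>\<open>nu\<close> stands for the norm that a bounded overgroup leaves invariant:
  equivalent to \<open>lp_norm\<close> and preserved by all isometries of
  \<open>lp_norm\<close>.\<close>

locale sym_norm = blocks +
  fixes nu :: "(nat \<Rightarrow> nat \<Rightarrow> 'a) \<Rightarrow> real" and lo hi :: real
  assumes nu_vscale: "x \<in> Z \<Longrightarrow> nu (vscale c x) = norm c * nu x"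
    and nu_add: "x \<in> Z \<Longrightarrow> y \<in> Z \<Longrightarrow> nu (x + y) \<le> nu x + nu y"
    and lo_pos: "0 < lo"
    and nu_lo: "x \<in> Z \<Longrightarrow> lo * lp_norm x \<le> nu x"
    and nu_hi: "x \<in> Z \<Longrightarrow> nu x \<le> hi * lp_norm x"
    and isoZ_lp_norm_subset: "isoZ lp_norm \<subseteq> isoZ nu"
    and n_ge_2: "2 \<le> n k"
    and p_ne_2: "p \<noteq> 2"
begin

lemma nu_diff: "x \<in> Z \<Longrightarrow> y \<in> Z \<Longrightarrow> nu (x - y) \<le> nu x + nu y"
  using nu_add[of x "vscale (- 1) y"] nu_vscale[of y "- 1"] Z_vscale[of y "- 1"] by (simp add: vscale_minus1)

lemma nu_pos: "x \<in> Z \<Longrightarrow> x \<noteq> 0 \<Longrightarrow> 0 < nu x"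
  using nu_lo[of x] lo_pos lp_norm_eq_0_iff[of x] lp_norm_nonneg[of x]
  by (smt (verit, best) mult_pos_pos)

lemma nu_0 [simp]: "nu 0 = 0"
  using nu_vscale[of 0 0] by simp

lemma nu_nonneg: "x \<in> Z \<Longrightarrow> 0 \<le> nu x"
  using nu_pos[of x] by (cases "x = 0") auto

lemma isoZ_inv:
  assumes T: "T \<in> isoZ nu"
  obtains T' where "T' \<in> isoZ nu" "\<And>x. x \<in> Z \<Longrightarrow> T' (T x) = x" "\<And>x. x \<in> Z \<Longrightarrow> T (T' x) = x"
proof
  note lin = linZD[OF isoZD(1)[OF T]]
  have inj: "inj_on T Z"
  proof (rule inj_onI)
    fix x y assume xy: "x \<in> Z" "y \<in> Z" "T x = T y"
    then have "nu (x - y) = 0"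
      using isoZD(2)[OF T, of "x - y"] lin by (simp add: Z_diff)
    then show "x = y" using nu_pos[of "x - y"] xy by (auto simp: Z_diff)
  qed
  let ?T' = "inv_into Z T"
  show 1: "?T' (T x) = x" if "x \<in> Z" for x using inj that by simp
  show 2: "T (?T' x) = x" if "x \<in> Z" for x using that isoZD(3)[OF T] by (simp add: f_inv_into_f)
  have 3: "?T' x \<in> Z" if "x \<in> Z" for x using that isoZD(3)[OF T] by (simp add: inv_into_into)
  show "?T' \<in> isoZ nu"
  proof (rule isoZ_involI[where T' = T])
    have "?T' (x + y) = ?T' x + ?T' y" if "x \<in> Z" "y \<in> Z" for x y
      using 1[of "?T' x + ?T' y"] that 2 3 lin by (simp add: Z_add)
    moreover have "?T' (vscale c x) = vscale c (?T' x)" if "x \<in> Z" for x c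
      using 1[of "vscale c (?T' x)"] that 2 3 lin by (simp add: Z_vscale)
    ultimately show "linZ ?T'" using 3 by (simp add: linZ_def)
    show "nu (?T' y) = nu y" if "y \<in> Z" for y
      using isoZD(2)[OF T 3[OF that]] 2[OF that] by simp
  qed (use 1 lin in auto)
qed

definition linear_functional :: "((nat \<Rightarrow> nat \<Rightarrow> 'a) \<Rightarrow> 'a) \<Rightarrow> bool"
  where "linear_functional f \<longleftrightarrow> (\<forall>x\<in>Z. \<forall>y\<in>Z. f (x + y) = f x + f y) \<and> (\<forall>c. \<forall>x\<in>Z. f (vscale c x) = c * f x)"

lemma linear_functionalD:
  assumes "linear_functional f"
  shows "x \<in> Z \<Longrightarrow> y \<in> Z \<Longrightarrow> f (x + y) = f x + f y" "x \<in> Z \<Longrightarrow> f (vscale c x) = c * f x"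
    "x \<in> Z \<Longrightarrow> y \<in> Z \<Longrightarrow> f (x - y) = f x - f y" "f 0 = 0"
proof -
  show *: "x \<in> Z \<Longrightarrow> y \<in> Z \<Longrightarrow> f (x + y) = f x + f y" "x \<in> Z \<Longrightarrow> f (vscale c x) = c * f x" for x y c
    using assms by (auto simp: linear_functional_def)
  show "f 0 = 0" using *(2)[of 0 0] by simp
  show "f (x - y) = f x - f y" if "x \<in> Z" "y \<in> Z"
    using *(1)[OF that(1) Z_vscale[OF that(2), of "-1"]] *(2)[OF that(2), of "-1"]
    by (simp add: vscale_minus1)
qed

text \<open>The pair encodes the reflection \<open>y - 2 f(y) x\<close>, which negates
  \<open>x\<close> and fixes the kernel of \<open>f\<close>. Vector and functional are kept apart
  because each will be shown to determine the other.\<close>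

definition refl_pair :: "(nat \<Rightarrow> nat \<Rightarrow> 'a) \<Rightarrow> ((nat \<Rightarrow> nat \<Rightarrow> 'a) \<Rightarrow> 'a) \<Rightarrow> bool"
  where "refl_pair x f \<longleftrightarrow> x \<in> Z \<and> linear_functional f \<and> f x = 1 \<and> (\<forall>y\<in>Z. nu (y - vscale (2 * f y) x) = nu y)"

lemma refl_pairD:
  assumes "refl_pair x f"
  shows "x \<in> Z" "linear_functional f" "f x = 1" "y \<in> Z \<Longrightarrow> nu (y - vscale (2 * f y) x) = nu y" "x \<noteq> 0"
proof -
  show *: "x \<in> Z" "linear_functional f" "f x = 1" "y \<in> Z \<Longrightarrow> nu (y - vscale (2 * f y) x) = nu y"
    using assms by (auto simp: refl_pair_def)
  show "x \<noteq> 0" using *(3) linear_functionalD(4)[OF *(2)] by auto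
qed

lemma refl_pair_cong: "refl_pair x f \<Longrightarrow> x = x' \<Longrightarrow> (\<And>y. y \<in> Z \<Longrightarrow> f y = f' y) \<Longrightarrow> refl_pair x' f'"
  by (auto simp: refl_pair_def linear_functional_def Z_add Z_vscale)

text \<open>Conjugating the reflection by \<open>T\<close>: this is how new reflections arise from
  known ones.\<close>

lemma refl_pair_conj:
  assumes "refl_pair x f" "T \<in> isoZ nu" "T' \<in> isoZ nu" "\<And>x. x \<in> Z \<Longrightarrow> T' (T x) = x"
    "\<And>x. x \<in> Z \<Longrightarrow> T (T' x) = x"
  shows "refl_pair (T x) (\<lambda>y. f (T' y))"
proof -
  note T = linZD[OF isoZD(1)[OF assms(2)]] note T' = linZD[OF isoZD(1)[OF assms(3)]]
  note f = linear_functionalD[OF refl_pairD(2)[OF assms(1)]] note x = refl_pairD[OF assms(1)]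
  have "nu (y - vscale (2 * f (T' y)) (T x)) = nu y" if "y \<in> Z" for y
  proof -
    have "y - vscale (2 * f (T' y)) (T x) = T (T' y - vscale (2 * f (T' y)) x)"
      using that x assms T T' by (simp add: Z_vscale)
    then show ?thesis
      using isoZD(2)[OF assms(2), of "T' y - vscale (2 * f (T' y)) x"] x(4)[of "T' y"] that
        isoZD(2)[OF assms(3), of y] x T' by (simp add: Z_diff Z_vscale)
  qed
  then show ?thesis using x assms T T' f by (auto simp: refl_pair_def linear_functional_def)
qed

lemma refl_pair_scale: "refl_pair x f \<Longrightarrow> c \<noteq> 0 \<Longrightarrow> refl_pair (vscale c x) (\<lambda>y. f y / c)"
  by (auto simp: refl_pair_def linear_functional_def Z_vscale divide_simps)

lemma refl_pair_reflection:
  assumes "refl_pair x f"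
  defines "R \<equiv> \<lambda>y. y - vscale (2 * f y) x"
  shows "R \<in> isoZ nu" "y \<in> Z \<Longrightarrow> R (R y) = y"
proof -
  note f = linear_functionalD[OF refl_pairD(2)[OF assms(1)]] note x = refl_pairD[OF assms(1)]
  show RR: "R (R y) = y" if "y \<in> Z" for y
  proof -
    have "f (R y) = - f y" using that f x by (simp add: R_def Z_vscale)
    then have "R (R y) = R y - vscale (- 2 * f y) x" by (simp add: R_def)
    also have "\<dots> = y" by (intro ext) (simp add: R_def)
    finally show ?thesis .
  qed
  have lin: "linZ R"
    using x(1) f by (auto simp: linZ_def R_def Z_diff Z_vscale vscale_diff vscale_left_add algebra_simps)
  show "R \<in> isoZ nu"
    by (rule isoZ_involI[OF lin, where T' = R]) (use RR lin linZD x in \<open>auto simp: R_def\<close>)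
qed

text \<open>Powers of a product of two reflections that share their vector or their functional move
  a point along such a ray.\<close>

lemma nu_bounded_ray:
  assumes "y \<in> Z" "d \<in> Z" "\<And>m::nat. nu (y + vscale (of_nat m) d) = nu y"
  shows "d = 0"
proof (rule ccontr)
  assume "d \<noteq> 0"
  then have pos: "0 < nu d" using nu_pos assms by auto
  obtain m :: nat where m: "2 * nu y < of_nat m * nu d"
    using reals_Archimedean3[OF pos] by blast
  have "of_nat m * nu d = nu (vscale (of_nat m) d)" using nu_vscale[OF assms(2), of "of_nat m"] by simp
  also have "\<dots> = nu ((y + vscale (of_nat m) d) - y)" by simp
  also have "\<dots> \<le> 2 * nu y"
    using nu_diff[of "y + vscale (of_nat m) d" y] assms by (simp add: Z_add Z_vscale)
  finally show False using m by simp
qed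

text \<open>The product of the two reflections translates \<open>y\<close> by
  \<open>d = 2 (g y - f y) x\<close>, and since \<open>f\<close> and \<open>g\<close> agree on
  \<open>d\<close>, its powers translate by the multiples of \<open>d\<close>. As they are
  isometries, \<open>d = 0\<close>.\<close>

lemma refl_pair_unique_functional:
  assumes "refl_pair x f" "refl_pair x g" "y \<in> Z"
  shows "f y = g y"
proof -
  note f = linear_functionalD[OF refl_pairD(2)[OF assms(1)]] note x = refl_pairD[OF assms(1)]
  note g = linear_functionalD[OF refl_pairD(2)[OF assms(2)]] note x' = refl_pairD[OF assms(2)]
  define d where "d = vscale (2 * g y - 2 * f y) x"
  have d: "d \<in> Z" "f d = 2 * g y - 2 * f y" "g d = 2 * g y - 2 * f y"
    using x x' f g by (simp_all add: d_def Z_vscale)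
  have "nu (y + vscale (of_nat m) d) = nu y" for m :: nat
  proof (induction m)
    case (Suc m)
    define w where "w = y + vscale (of_nat m) d"
    have w: "w \<in> Z" using assms d by (simp add: w_def Z_add Z_vscale)
    define v where "v = w - vscale (2 * g w) x"
    have v: "v \<in> Z" using w x by (simp add: v_def Z_diff Z_vscale)
    have gw: "g w = g y + of_nat m * (2 * g y - 2 * f y)"
      using assms d g by (simp add: w_def Z_vscale)
    have fw: "f w = f y + of_nat m * (2 * g y - 2 * f y)"
      using assms d f by (simp add: w_def Z_vscale)
    have fv: "f v = f w - 2 * g w" using w x f by (simp add: v_def Z_vscale)
    have "v - vscale (2 * f v) x = w - vscale (2 * f w - 2 * g w) x"
      unfolding fv by (intro ext) (simp add: v_def algebra_simps)
    also have "\<dots> = y + vscale (of_nat (Suc m)) d"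
      unfolding fw gw by (intro ext) (simp add: w_def d_def algebra_simps)
    finally have eq: "v - vscale (2 * f v) x = y + vscale (of_nat (Suc m)) d" .
    have "nu (y + vscale (of_nat (Suc m)) d) = nu v" using x(4)[OF v] unfolding eq .
    also have "\<dots> = nu w" using x'(4)[OF w] by (simp add: v_def)
    finally show ?case using Suc.IH unfolding w_def by (rule trans)
  qed simp
  then have "d = 0" using nu_bounded_ray assms d by blast
  then show ?thesis using x(5) by (simp add: d_def)
qed

text \<open>Dual to the uniqueness of the functional: the powers of the product of the two
  reflections translate \<open>x\<close> by the multiples of \<open>2 (x - x')\<close>, which lies
  in the kernel of \<open>f\<close>.\<close>

lemma refl_pair_unique_vector:
  assumes "refl_pair x f" "refl_pair x' f"
  shows "x = x'"
proof -
  note f = linear_functionalD[OF refl_pairD(2)[OF assms(1)]] note x = refl_pairD[OF assms(1)] note x' = refl_pairD[OF assms(2)]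
  define d where "d = vscale 2 (x - x')"
  have d: "d \<in> Z" "f d = 0" using x x' f by (simp_all add: d_def Z_vscale Z_diff)
  have "nu (x + vscale (of_nat m) d) = nu x" for m :: nat
  proof (induction m)
    case (Suc m)
    define w where "w = x + vscale (of_nat m) d"
    have w: "w \<in> Z" "f w = 1" using x d f by (simp_all add: w_def Z_add Z_vscale)
    define v where "v = w - vscale (2 * f w) x'"
    have v: "v \<in> Z" "f v = -1" using w x' f by (simp_all add: v_def Z_diff Z_vscale)
    have eq: "v - vscale (2 * f v) x = x + vscale (of_nat (Suc m)) d"
      unfolding v(2) by (intro ext) (simp add: v_def w(2), simp add: w_def d_def algebra_simps)
    have "nu (x + vscale (of_nat (Suc m)) d) = nu v" using x(4)[OF v(1)] unfolding eq .
    also have "\<dots> = nu w" using x'(4)[OF w(1)] by (simp add: v_def)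
    finally show ?case using Suc.IH unfolding w_def by (rule trans)
  qed simp
  then have "d = 0" using nu_bounded_ray x d by blast
  then show ?thesis by (simp add: d_def)
qed

text \<open>\<open>2 f(T x) x\<close> is the difference of \<open>T x\<close> and its reflection,
  two vectors of norm \<open>nu x\<close>.\<close>

lemma refl_pair_functional_le_1:
  assumes "refl_pair x f" "T \<in> isoZ nu"
  shows "norm (f (T x)) \<le> 1"
proof -
  note x = refl_pairD[OF assms(1)]
  have Tx: "T x \<in> Z" "nu (T x) = nu x" using assms x isoZD linZD by blast+
  have "2 * norm (f (T x)) * nu x = nu (vscale (2 * f (T x)) x)"
    using nu_vscale[OF x(1)] by (simp add: norm_mult)
  also have "\<dots> = nu (T x - (T x - vscale (2 * f (T x)) x))" by simp
  also have "\<dots> \<le> nu (T x) + nu (T x - vscale (2 * f (T x)) x)"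
    using Tx x by (intro nu_diff) (auto simp: Z_diff Z_vscale)
  also have "\<dots> = 2 * nu x" using x(4)[OF Tx(1)] Tx by simp
  finally show ?thesis using nu_pos[OF x(1) x(5)] by simp
qed

lemma block_scale_isoZ: "norm c = 1 \<Longrightarrow> block_scale A c \<in> isoZ nu"
  using block_scale_iso isoZ_lp_norm_subset by blast

text \<open>Let \<open>a\<close> and \<open>b\<close> be the values of \<open>f\<close> on the parts
  of \<open>x\<close> inside and outside \<open>A\<close>, so \<open>a + b = 1\<close>. A scalar of
  modulus one on \<open>A\<close> can align their phases, whence
  \<open>norm a + norm b \<le> 1\<close> by \<open>refl_pair_functional_le_1\<close>. Equality in
  the triangle inequality then makes \<open>a\<close> real and nonnegative.\<close>

lemma refl_pair_part_real:
  assumes "refl_pair x f"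
  shows "f (part A x) = of_real (norm (f (part A x)))" "norm (f (part A x)) \<le> 1"
proof -
  note f = linear_functionalD[OF refl_pairD(2)[OF assms(1)]] note x = refl_pairD[OF assms(1)]
  define a b where "a = f (part A x)" and "b = 1 - a"
  obtain c where c: "norm c = 1" "norm (c * a + b) = norm a + norm b"
  proof (cases "a = 0 \<or> b = 0")
    case True
    then show ?thesis using that[of 1] by auto
  next
    case False
    define c where "c = (b / of_real (norm b)) / (a / of_real (norm a))"
    have "norm c = 1" using False by (simp add: c_def norm_divide norm_mult)
    moreover have "c * a + b = b * of_real (norm a / norm b + 1)"
      using False by (simp add: c_def divide_simps distrib_left)
    then have "norm (c * a + b) = norm b * (norm a / norm b + 1)"
      by (simp add: norm_mult del: of_real_add of_real_divide)
    then have "norm (c * a + b) = norm a + norm b" using False by (simp add: field_simps)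
    ultimately show ?thesis using that by blast
  qed
  have "f (block_scale A c x) = c * a + b"
    using x f by (simp add: block_scale_eq Z_part Z_vscale a_def b_def algebra_simps)
  then have le: "norm a + norm b \<le> 1"
    using refl_pair_functional_le_1[OF assms block_scale_isoZ[OF c(1), of A]] c by simp
  then show "norm (f (part A x)) \<le> 1" using norm_ge_zero[of b] unfolding a_def by linarith
  have "norm (a + b) = norm a + norm b"
    using le norm_triangle_ineq[of a b] by (simp add: b_def)
  then have "norm a *\<^sub>R b = norm b *\<^sub>R a" by (simp add: norm_triangle_eq)
  then have "norm a *\<^sub>R 1 = (norm a + norm b) *\<^sub>R a"
    by (simp add: b_def algebra_simps)
  moreover have "norm a + norm b = 1" using \<open>norm (a + b) = _\<close> by (simp add: b_def)
  ultimately show "f (part A x) = of_real (norm (f (part A x)))"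
    by (simp add: a_def of_real_def)
qed

text \<open>The sign change on \<open>A\<close> fixes \<open>x\<close>, so by uniqueness it fixes
  \<open>f\<close> as well.\<close>

lemma refl_pair_off_support:
  assumes "refl_pair x f" "part A x = 0" "z \<in> Z"
  shows "f (part A z) = 0"
proof -
  note f = linear_functionalD[OF refl_pairD(2)[OF assms(1)]] note x = refl_pairD[OF assms(1)]
  have "block_scale A (- 1) x = x" using assms by (simp add: block_scale_eq)
  then have "refl_pair x (\<lambda>y. f (block_scale A (- 1) y))"
    using refl_pair_conj[OF assms(1) block_scale_isoZ[of "- 1" A] block_scale_isoZ[of "- 1" A]] by (simp add: block_scale_block_scale)
  then have "f (block_scale A (- 1) z) = f z" using refl_pair_unique_functional assms by blast
  then show ?thesis using f assms by (simp add: block_scale_eq Z_part Z_vscale)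
qed

text \<open>On block \<open>k\<close>, \<open>f\<close> is proportional to the inner product with
  \<open>x\<close>. The unitary \<open>T\<close> fixes the part of \<open>x\<close> in the block and
  negates its orthogonal complement there; it fixes \<open>x\<close>, hence \<open>f\<close>. The
  form without division includes the case that \<open>x\<close> has no part in the block.\<close>

lemma refl_pair_part_inner:
  assumes "refl_pair x f" "z \<in> Z"
  shows "block_inner k x x * f (part {k} z) = block_inner k z x * f (part {k} x)"
proof (cases "part {k} x = 0")
  case True
  then show ?thesis using refl_pair_off_support[OF assms(1) True assms(2)] linear_functionalD(4)[OF refl_pairD(2)[OF assms(1)]] by simp
next
  case False
  note f = linear_functionalD[OF refl_pairD(2)[OF assms(1)]] note x = refl_pairD[OF assms(1)]
  have xx: "block_inner k x x \<noteq> 0" using block_norm_eq_0_iff[OF x(1)] False by (simp add: block_inner_self)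
  define c where "c = 2 / block_inner k x x"
  have "cj c = c" using cj_of_real[of 2] by (simp add: c_def cj_divide cj_inner)
  then have c: "c + cj c = c * cj c * block_inner k x x" using xx by (simp add: c_def)
  define T where "T = (\<lambda>z. block_scale {k} (- 1) (householder k x c z))"
  have "householder k x c \<in> isoZ nu" using householder_iso[OF x(1) c] isoZ_lp_norm_subset by auto
  then have T_iso: "T \<in> isoZ nu"
    using isoZ_comp[OF block_scale_isoZ[of "- 1" "{k}"]] by (simp add: T_def)
  have Tz: "T z = z - vscale 2 (part {k} z) + vscale (c * block_inner k z x) (part {k} x)" for z
    unfolding T_def block_scale_eq householder_def by (intro ext) (simp add: part_apply)
  have TT: "T (T z) = z" for z
  proof -
    have "c * block_inner k z x * block_inner k x x = 2 * block_inner k z x" using xx by (simp add: c_def)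
    then have "block_inner k (T z) x = block_inner k z x" by (simp add: Tz block_inner_simps block_inner_part_left)
    then have "T (T z) = T z - vscale 2 (part {k} (T z)) + vscale (c * block_inner k z x) (part {k} x)"
      using Tz[of "T z"] by simp
    also have "\<dots> = z" unfolding Tz by (intro ext) (simp add: part_apply algebra_simps)
    finally show ?thesis .
  qed
  have Tx: "T x = x" unfolding Tz using xx by (intro ext) (simp add: part_apply c_def)
  have "refl_pair x (\<lambda>y. f (T y))" using refl_pair_conj[OF assms(1) T_iso T_iso TT TT] Tx by simp
  then have "f (T (part {k} z)) = f (part {k} z)"
    using refl_pair_unique_functional assms by (meson Z_part)
  moreover have "f (T (part {k} z)) = - f (part {k} z) + c * block_inner k z x * f (part {k} x)"
    unfolding Tz using f assms x by (simp add: Z_part Z_vscale Z_diff block_inner_part_left)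
  ultimately have "2 * f (part {k} z) = c * block_inner k z x * f (part {k} x)" by simp
  then show ?thesis using xx by (simp add: c_def field_simps)
qed

text \<open>Otherwise \<open>f\<close> vanishes on the whole block by
  \<open>refl_pair_part_inner\<close>. Negating the block then preserves \<open>f\<close> but moves
  \<open>x\<close>, against the uniqueness of the vector.\<close>

lemma refl_pair_part_nonzero:
  assumes "refl_pair x f" "part {k} x \<noteq> 0"
  shows "f (part {k} x) \<noteq> 0"
proof
  note f = linear_functionalD[OF refl_pairD(2)[OF assms(1)]] note x = refl_pairD[OF assms(1)]
  assume 0: "f (part {k} x) = 0"
  have xx: "block_inner k x x \<noteq> 0" using block_norm_eq_0_iff[OF x(1)] assms by (simp add: block_inner_self)
  have fz: "f (block_scale {k} (- 1) z) = f z" if "z \<in> Z" for z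
    using refl_pair_part_inner[OF assms(1) that, of k] that 0 xx f by (simp add: block_scale_eq Z_part Z_vscale)
  have "refl_pair (block_scale {k} (- 1) x) (\<lambda>y. f (block_scale {k} (- 1) y))"
    using refl_pair_conj[OF assms(1) block_scale_isoZ[of "- 1" "{k}"] block_scale_isoZ[of "- 1" "{k}"]] by (simp add: block_scale_block_scale)
  then have "refl_pair (block_scale {k} (- 1) x) f" by (rule refl_pair_cong) (auto simp: fz)
  then have "block_scale {k} (- 1) x = x" using refl_pair_unique_vector assms by blast
  then have "vscale (- 2) (part {k} x) = 0" by (simp add: block_scale_eq)
  then show False using assms by simp
qed

text \<open>The values of \<open>f\<close> on the parts of \<open>x\<close> are shares of a total
  mass of one: they are nonnegative, and nonzero on every block that \<open>x\<close> meets. A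
  second such block needs a share of its own.\<close>

lemma refl_pair_part_01:
  assumes "refl_pair x f" "part {k} x \<noteq> 0" "x \<noteq> part {k} x"
  obtains a where "f (part {k} x) = of_real a" "0 < a" "a < 1"
proof -
  note f = linear_functionalD[OF refl_pairD(2)[OF assms(1)]] note x = refl_pairD[OF assms(1)]
  have "part (- {k}) x \<noteq> 0" using assms by (simp add: part_Compl)
  then obtain j where j: "j \<noteq> k" "part {j} x \<noteq> 0" using part_eq_0_iff[of "- {k}" x] by auto
  have pos: "0 < norm (f (part {k} x))" "0 < norm (f (part {j} x))"
    using refl_pair_part_nonzero[OF assms(1)] assms j by auto
  have "f (part ({k} \<union> {j}) x) = f (part {k} x) + f (part {j} x)"
    using j x f by (subst part_Un) (auto simp: Z_part)
  also have "\<dots> = of_real (norm (f (part {k} x)) + norm (f (part {j} x)))"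
    using refl_pair_part_real(1)[OF assms(1)] by (metis of_real_add)
  finally have "norm (f (part {k} x)) + norm (f (part {j} x)) \<le> 1"
    using refl_pair_part_real(2)[OF assms(1), of "{k} \<union> {j}"] by (simp del: of_real_add)
  then show ?thesis using that refl_pair_part_real(1)[OF assms(1), of "{k}"] pos by (metis add.commute less_add_same_cancel2 order_less_le_trans)
qed

end

context blocks
begin

lemma block_norm_diff_sq:
  assumes "block_inner i x y = of_real r"
  shows "(block_norm i (x - vscale (of_real t) y))\<^sup>2 = (block_norm i x)\<^sup>2 - 2 * t * r + t\<^sup>2 * (block_norm i y)\<^sup>2"
proof -
  have yx: "block_inner i y x = of_real r" using assms cj_inner[of i x y] by simp
  have "of_real ((block_norm i (x - vscale (of_real t) y))\<^sup>2)
      = (of_real ((block_norm i x)\<^sup>2 - 2 * t * r + t\<^sup>2 * (block_norm i y)\<^sup>2) :: 'a)"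
    unfolding block_inner_self[symmetric] block_inner_simps assms yx
    by (simp add: block_inner_self algebra_simps power2_eq_square)
  then show ?thesis by (simp only: of_real_eq_iff)
qed

text \<open>Two coordinates suffice to be orthogonal to \<open>u\<close>; this is what blocks of
  dimension at least two are for.\<close>

lemma ex_block_orthogonal:
  assumes "2 \<le> n i" "0 \<le> r"
  obtains w where "w \<in> Z" "part {i} w = w" "block_inner i w u = 0" "block_norm i w = r"
proof -
  define a b where "a = u i 0" and "b = u i 1"
  obtain s t where st: "s * cj a + t * cj b = 0" "s \<noteq> 0 \<or> t \<noteq> 0"
  proof (cases "a = 0 \<and> b = 0")
    case True
    then show ?thesis using that[of 1 0] by simp
  next
    case False
    then show ?thesis using that[of "cj b" "- cj a"] by (auto simp: mult.commute)
  qed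
  define w :: "nat \<Rightarrow> nat \<Rightarrow> 'a" where "w = (\<lambda>k j. if k = i \<and> j = 0 then s else if k = i \<and> j = 1 then t else 0)"
  have w: "w \<in> Z" using assms by (intro Z_finite[of "{i}"]) (auto simp: w_def)
  have bw: "part {i} w = w" by (intro ext) (auto simp: w_def part_apply)
  have two: "{..<n i} = {0, 1} \<union> {2..<n i}" using assms by auto
  have "(\<Sum>j\<in>{2..<n i}. w i j * cj (u i j)) = 0" by (intro sum.neutral) (auto simp: w_def)
  then have "block_inner i w u = (\<Sum>j\<in>{0, 1}. w i j * cj (u i j))"
    unfolding block_inner_def two by (subst sum.union_disjoint) auto
  also have "\<dots> = 0" using st by (simp add: w_def a_def b_def)
  finally have orth: "block_inner i w u = 0" .
  have "w \<noteq> 0" using st by (auto simp: w_def fun_eq_iff)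
  then have pos: "block_norm i w \<noteq> 0" using block_norm_eq_0_iff[OF w] bw by simp
  show ?thesis
    by (rule that[of "vscale (of_real (r / block_norm i w)) w"])
      (use w bw orth pos assms in \<open>auto simp: Z_vscale part_vscale block_inner_simps block_norm_vscale norm_divide\<close>)
qed

end

context sym_norm
begin

lemma refl_pair_block:
  assumes "u \<in> Z" "part {i} u = u" "u \<noteq> 0"
  shows "refl_pair u (\<lambda>z. block_inner i z u / block_inner i u u)"
proof -
  have uu: "block_inner i u u \<noteq> 0" using block_norm_eq_0_iff[OF assms(1)] assms by (simp add: block_inner_self)
  define c where "c = 2 / block_inner i u u"
  have "cj c = c" using cj_of_real[of 2] by (simp add: c_def cj_divide cj_inner)
  then have "c + cj c = c * cj c * block_inner i u u" using uu by (simp add: c_def)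
  then have "householder i u c \<in> isoZ nu" using householder_iso assms isoZ_lp_norm_subset by blast
  then have "nu (z - vscale (2 * (block_inner i z u / block_inner i u u)) u) = nu z" if "z \<in> Z" for z
    using isoZD(2)[of "householder i u c" nu z] that assms by (simp add: householder_def c_def)
  then show ?thesis using uu assms
    by (auto simp: refl_pair_def linear_functional_def block_inner_simps add_divide_distrib)
qed

text \<open>Conjugation by a unitary of block \<open>k\<close> that carries \<open>a\<close> to
  \<open>b\<close>. It fixes the rest \<open>y\<close> and respects the inner product of the block,
  so the functional keeps its form.\<close>

lemma refl_pair_move:
  assumes "refl_pair x f" "a \<in> Z" "b \<in> Z" "part {k} a = a" "part {k} b = b" "block_norm k a = block_norm k b"
    "y \<in> Z" "part {k} y = 0" "x = a + y"
    and f: "\<And>z. z \<in> Z \<Longrightarrow> f z = s * block_inner k z a + g (part (- {k}) z)"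
  shows "refl_pair (b + y) (\<lambda>z. s * block_inner k z b + g (part (- {k}) z))"
proof -
  obtain T where T: "T \<in> isoZ lp_norm" "T a = b" "\<And>z j i. j \<noteq> k \<Longrightarrow> T z j i = z j i"
     "\<And>x y. block_inner k (T x) (T y) = block_inner k x y"
    using ex_block_unitary[OF assms(2-6)] by blast
  then have Tn: "T \<in> isoZ nu" using isoZ_lp_norm_subset by auto
  obtain T' where T': "T' \<in> isoZ nu" "\<And>x. x \<in> Z \<Longrightarrow> T' (T x) = x" "\<And>x. x \<in> Z \<Longrightarrow> T (T' x) = x"
    using isoZ_inv[OF Tn] by blast
  note lin = linZD[OF isoZD(1)[OF Tn]] note lin' = linZD[OF isoZD(1)[OF T'(1)]]
  have "block_norm k (T y) = block_norm k y" using T(4)[of y y] by (rule block_norm_eqI)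
  then have "part {k} (T y) = 0"
    using block_norm_eq_0_iff lin(1) assms(7,8) by metis
  then have "T y = part (- {k}) (T y)" by (simp add: part_Compl)
  also have "\<dots> = part (- {k}) y" by (intro ext) (simp add: part_apply T(3))
  also have "\<dots> = y" using assms(8) by (simp add: part_Compl)
  finally have Tx: "T x = b + y" using assms lin T(2) by simp
  have "f (T' z) = s * block_inner k z b + g (part (- {k}) z)" if "z \<in> Z" for z
  proof -
    have "block_inner k (T' z) a = block_inner k z b" using T(4)[of "T' z" a] T'(3)[OF that] T(2) by simp
    moreover have "T' z j i = z j i" if "j \<noteq> k" for j i
      using T(3)[OF that, of "T' z"] T'(3)[OF \<open>z \<in> Z\<close>] by simp
    then have "part (- {k}) (T' z) = part (- {k}) z" by (intro ext) (auto simp: part_apply)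
    ultimately show ?thesis using f[of "T' z"] lin'(1) that by simp
  qed
  then show ?thesis using refl_pair_cong[OF refl_pair_conj[OF assms(1) Tn T'] Tx] by simp
qed

text \<open>
  The reflections in the vectors \<open>u + \<beta> d\<close> with \<open>u\<close> in block \<open>i\<close>, where \<open>d\<close> is the part of \<open>x\<close>
  outside block \<open>i\<close>: if one such vector puts the share \<open>b\<close> of its (normalised) weight on \<open>d\<close>, then
  reflecting the vectors of block \<open>i\<close> in it yields all shares up to \<open>4 b (1 - b)\<close>. Since blocks have
  dimension at least two, this reaches every share in \<open>[0, 1]\<close>.
\<close>

lemma refl_pair_span:
  assumes Sx: "refl_pair x f" and e0: "part {i} x \<noteq> 0" and d0: "x \<noteq> part {i} x"
  shows "\<exists>c v. 0 < c \<and> 0 < v \<and>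
    (\<forall>z\<in>Z. f (part {i} z) = of_real c * block_inner i z x) \<and>
    f (x - part {i} x) = of_real v \<and>
    (\<forall>u t. u \<in> Z \<longrightarrow> part {i} u = u \<longrightarrow> u \<noteq> 0 \<or> t \<noteq> 0 \<longrightarrow>
      refl_pair (u + vscale (of_real t) (x - part {i} x))
        (\<lambda>z. (of_real c * block_inner i z u + of_real t * f (z - part {i} z)) /
             of_real (c * (block_norm i u)\<^sup>2 + v * t\<^sup>2)))"
proof -
  note f = linear_functionalD[OF refl_pairD(2)[OF Sx]] note x = refl_pairD[OF Sx]
  define e d where "e = part {i} x" and "d = x - e"
  obtain a where a: "f e = of_real a" "0 < a" "a < 1"
    using refl_pair_part_01[OF Sx e0 d0] unfolding e_def by blast
  \<comment> \<open>\<open>a\<close> is the share of block \<open>i\<close> and \<open>v\<close> the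
    share of the rest; \<open>c\<close> turns the inner product with \<open>x\<close> into
    \<open>f\<close> on the block.\<close>
  define c v where "c = a / (block_norm i x)\<^sup>2" and "v = 1 - a"
  have bx: "0 < block_norm i x" using block_norm_eq_0_iff[OF x(1)] e0 by (metis block_norm_nonneg less_eq_real_def)
  have c: "0 < c" "c * (block_norm i x)\<^sup>2 = a" and v: "0 < v" using a bx by (auto simp: c_def v_def)
  have e: "e \<in> Z" "part {i} e = e" "block_norm i e = block_norm i x"
    and d: "d \<in> Z" "part {i} d = 0" using x by (auto simp: e_def d_def Z_part Z_diff part_diff block_norm_part)
  have ipd: "block_inner i d w = 0" for w using block_inner_part_left[of i "- {i}" x w] by (simp add: part_Compl d_def e_def)
  have fi: "f (part {i} z) = of_real c * block_inner i z x" if "z \<in> Z" for z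
  proof -
    have "of_real ((block_norm i x)\<^sup>2) * f (part {i} z) = of_real a * block_inner i z x"
      using refl_pair_part_inner[OF Sx that, of i] a by (simp add: block_inner_self mult.commute flip: e_def)
    then show ?thesis using bx by (simp add: c_def field_simps)
  qed
  have fd: "f d = of_real v" using f x e a by (simp add: d_def v_def)
  define g where "g z = f (z - part {i} z)" for z
  have g: "g (y + z) = g y + g z" "g (y - z) = g y - g z" "g (vscale s z) = s * g z"
    if "y \<in> Z" "z \<in> Z" for y z s
  proof -
    have gz: "g z = f z - f (part {i} z)" if "z \<in> Z" for z
      using that f by (simp add: g_def Z_part)
    show "g (y + z) = g y + g z" "g (y - z) = g y - g z" "g (vscale s z) = s * g z"
      using that f
      by (simp_all add: gz part_add part_diff part_vscale Z_part Z_diff Z_vscale Z_add right_diff_distrib)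
  qed
  have gd: "g d = of_real v" using d fd by (simp add: g_def)
  have gu: "g u = 0" if "part {i} u = u" for u using that f by (simp add: g_def)
  have fg: "f z = of_real c * block_inner i z x + g z" if "z \<in> Z" for z
    using fi[OF that] f that by (simp add: g_def Z_part)
  \<comment> \<open>\<open>q u t\<close> is the squared length of \<open>V u t\<close> in a Hilbert
    norm on block \<open>i\<close> plus the line of \<open>d\<close>, and \<open>F u t\<close> is
    the coefficient of the orthogonal projection onto \<open>V u t\<close>. The aim is that every
    such projection belongs to an isometric reflection.\<close>
  define q where "q u t = c * (block_norm i u)\<^sup>2 + v * t\<^sup>2" for u t
  define V where "V u t = u + vscale (of_real t) d" for u and t :: real
  define F where "F u t z = (of_real c * block_inner i z u + of_real t * g z) / of_real (q u t)" for u t z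
  define P where "P u t \<longleftrightarrow> u \<in> Z \<and> part {i} u = u \<and> refl_pair (V u t) (F u t)" for u t
  have PD: "u \<in> Z" "part {i} u = u" "V u t \<in> Z" "refl_pair (V u t) (F u t)" if "P u t" for u t
    using that d by (auto simp: P_def V_def Z_add Z_vscale)
  have gV: "g (V u t) = of_real (t * v)" if "u \<in> Z" "part {i} u = u" for u t
    using that d g gu gd by (simp add: V_def Z_vscale)
  have ipV: "block_inner i (V u t) w = block_inner i u w" for u t w by (simp add: V_def block_inner_simps ipd)

  have P_x: "P e 1"
  proof -
    have q: "q e 1 = 1" using c e by (simp add: q_def v_def)
    have "refl_pair (V e 1) (F e 1)"
    proof (rule refl_pair_cong[OF Sx])
      show "x = V e 1" by (simp add: V_def d_def)
      fix z assume "z \<in> Z"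
      then show "f z = F e 1 z"
        using fg[of z] q by (simp add: F_def e_def block_inner_part_right)
    qed
    then show ?thesis using e by (simp add: P_def)
  qed
  have P_block: "P u 0" if "u \<in> Z" "part {i} u = u" "u \<noteq> 0" for u
  proof -
    have "block_norm i u \<noteq> 0" using block_norm_eq_0_iff that by metis
    then have "refl_pair (V u 0) (F u 0)"
      using c by (intro refl_pair_cong[OF refl_pair_block[OF that]]) (auto simp: V_def F_def q_def block_inner_self)
    then show ?thesis using that by (simp add: P_def)
  qed
  have P_scale: "P (vscale (of_real s) u) (s * t)" if "P u t" "s \<noteq> 0" for u t s
  proof -
    have "refl_pair (V (vscale (of_real s) u) (s * t)) (F (vscale (of_real s) u) (s * t))"
    proof (rule refl_pair_cong[OF refl_pair_scale[OF PD(4)[OF that(1)], of "of_real s"]])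
      show "vscale (of_real s) (V u t) = V (vscale (of_real s) u) (s * t)"
        by (intro ext) (simp add: V_def algebra_simps)
      have q: "q (vscale (of_real s) u) (s * t) = s\<^sup>2 * q u t"
        by (simp add: q_def block_norm_vscale power_mult_distrib algebra_simps)
      show "F u t y / of_real s = F (vscale (of_real s) u) (s * t) y" if "y \<in> Z" for y
      proof -
        have "of_real c * block_inner i y (vscale (of_real s) u) + of_real (s * t) * g y
            = of_real s * (of_real c * block_inner i y u + of_real t * g y)"
          by (simp add: block_inner_simps algebra_simps)
        then show ?thesis using \<open>s \<noteq> 0\<close> unfolding F_def q by (simp add: power2_eq_square)
      qed
    qed (use that in simp)
    then show ?thesis using PD[OF that(1)] by (simp add: P_def Z_vscale part_vscale)
  qed
  have P_move: "P u' t" if "P u t" "u' \<in> Z" "part {i} u' = u'" "block_norm i u' = block_norm i u" for u u' t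
  proof -
    have q: "q u' t = q u t" by (simp add: q_def that)
    have "refl_pair (u' + vscale (of_real t) d)
        (\<lambda>z. of_real c / of_real (q u t) * block_inner i z u'
             + of_real t * f (part (- {i}) z) / of_real (q u t))"
    proof (rule refl_pair_move[OF PD(4)[OF that(1)] PD(1)[OF that(1)] that(2) PD(2)[OF that(1)] that(3)])
      show "V u t = u + vscale (of_real t) d" by (simp add: V_def)
      show "F u t z = of_real c / of_real (q u t) * block_inner i z u
          + of_real t * f (part (- {i}) z) / of_real (q u t)" if "z \<in> Z" for z
        by (simp add: F_def g_def part_Compl add_divide_distrib)
      show "vscale (of_real t) d \<in> Z" using d by (simp add: Z_vscale)
      show "part {i} (vscale (of_real t) d) = 0" using d by (simp add: part_vscale)
    qed (use that in auto)
    then have "refl_pair (V u' t) (F u' t)"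
      by (rule refl_pair_cong) (auto simp: V_def F_def g_def part_Compl add_divide_distrib q)
    then show ?thesis using that by (simp add: P_def)
  qed
  \<comment> \<open>The reflection in \<open>V u t\<close> conjugates the one in
    \<open>V u' t'\<close>; \<open>l\<close> is the coefficient of \<open>V u' t'\<close> along
    \<open>V u t\<close> with respect to \<open>q\<close>. Since \<open>q\<close> is preserved, the
    new functional has the form \<open>F\<close> again.\<close>
  have P_reflect: "P (u' - vscale (of_real (2 * l)) u) (t' - 2 * l * t)"
    if "P u t" "P u' t'" and r: "block_inner i u' u = of_real r" and l: "l * q u t = c * r + t * t' * v"
      and q0: "q u t \<noteq> 0" for u u' t t' r l
  proof -
    note u = PD[OF that(1)] note u' = PD[OF that(2)]
    define R where "R = (\<lambda>z. z - vscale (2 * F u t z) (V u t))"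
    have R: "R \<in> isoZ nu" "\<And>z. z \<in> Z \<Longrightarrow> R (R z) = z"
      using refl_pair_reflection[OF u(4)] unfolding R_def .
    have r': "block_inner i u u' = of_real r" using r cj_inner[of i u' u] by simp
    have FV: "F u t (V u' t') = of_real l"
    proof -
      have "of_real c * block_inner i (V u' t') u + of_real t * g (V u' t') = (of_real (l * q u t) :: 'a)"
        using gV[OF u'(1,2)] by (simp add: ipV r l algebra_simps)
      then show ?thesis using q0 by (simp add: F_def)
    qed
    have RV: "R (V u' t') = V (u' - vscale (of_real (2 * l)) u) (t' - 2 * l * t)"
      unfolding R_def FV by (intro ext) (simp add: V_def algebra_simps)
    have q': "q (u' - vscale (of_real (2 * l)) u) (t' - 2 * l * t) = q u' t'"
    proof -
      have "q (u' - vscale (of_real (2 * l)) u) (t' - 2 * l * t)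
          = q u' t' - 4 * l * (c * r + t * t' * v) + 4 * l\<^sup>2 * q u t"
        unfolding q_def block_norm_diff_sq[OF r] by (simp add: algebra_simps power2_eq_square)
      then show ?thesis by (simp add: l[symmetric] power2_eq_square)
    qed
    have FR: "F u' t' (R z) = F (u' - vscale (of_real (2 * l)) u) (t' - 2 * l * t) z" if z: "z \<in> Z" for z
    proof -
      have N: "F u t z * of_real (q u t) = of_real c * block_inner i z u + of_real t * g z"
        using q0 by (simp add: F_def)
      have "of_real c * block_inner i (R z) u' + of_real t' * g (R z)
         = of_real c * block_inner i z u' + of_real t' * g z - 2 * F u t z * of_real (c * r + t * t' * v)"
      proof -
        have gR: "g (R z) = g z - 2 * F u t z * of_real (t * v)"
          using z u g(2)[OF z Z_vscale[OF u(3)]] g(3)[OF z u(3)] gV[OF u(1,2)] by (simp add: R_def)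
        have ipR: "block_inner i (R z) u' = block_inner i z u' - 2 * F u t z * of_real r"
          by (simp add: R_def block_inner_simps ipV r')
        show ?thesis unfolding gR ipR by (simp add: algebra_simps)
      qed
      also have "2 * F u t z * of_real (c * r + t * t' * v)
          = 2 * of_real l * (F u t z * of_real (q u t))" by (simp add: l[symmetric])
      also have "of_real c * block_inner i z u' + of_real t' * g z - \<dots> =
         of_real c * block_inner i z (u' - vscale (of_real (2 * l)) u) + of_real (t' - 2 * l * t) * g z"
        unfolding N by (simp add: block_inner_simps cj_mult algebra_simps)
      finally show ?thesis unfolding F_def q' by simp
    qed
    have "refl_pair (V (u' - vscale (of_real (2 * l)) u) (t' - 2 * l * t))
        (F (u' - vscale (of_real (2 * l)) u) (t' - 2 * l * t))"
      using R by (intro refl_pair_cong[OF refl_pair_conj[OF u'(4), of R R] RV FR]) auto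
    then show ?thesis using u u' by (simp add: P_def Z_diff Z_vscale part_diff part_vscale)
  qed

  \<comment> \<open>Some vector of \<open>q\<close>-length one with share \<open>b\<close> on
    \<open>d\<close> carries a reflection; by unitaries of the block and a change of sign all such
    vectors then do (\<open>W_all\<close>).\<close>
  define W where "W b \<longleftrightarrow> (\<exists>u t. P u t \<and> c * (block_norm i u)\<^sup>2 = 1 - b \<and> v * t\<^sup>2 = b)" for b
  have W_all: "P u t" if "W b" "u \<in> Z" "part {i} u = u" "c * (block_norm i u)\<^sup>2 = 1 - b" "v * t\<^sup>2 = b" for b u t
  proof -
    from that(1) obtain u' t' where u': "P u' t'" "c * (block_norm i u')\<^sup>2 = 1 - b" "v * t'\<^sup>2 = b"
      unfolding W_def by blast
    have "(block_norm i u')\<^sup>2 = (block_norm i u)\<^sup>2" using u'(2) that(4) c by (metis less_irrefl mult_cancel_left)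
    then have block_norm: "block_norm i u = block_norm i u'" by (metis block_norm_nonneg power2_eq_iff_nonneg)
    have "t'\<^sup>2 = t\<^sup>2" using u'(3) that(5) v by (metis less_irrefl mult_cancel_left)
    then consider "t = t'" | "t = - t'" by (auto simp: power2_eq_iff)
    then show ?thesis
    proof cases
      case 1
      then show ?thesis using P_move[OF u'(1) that(2,3) block_norm] by simp
    next
      case 2
      have "P (vscale (of_real (- 1)) u') (- 1 * t')" using P_scale[OF u'(1), of "- 1"] by simp
      then show ?thesis using P_move[of "vscale (of_real (- 1)) u'" "- t'" u] 2 block_norm that by (simp add: block_norm_vscale)
    qed
  qed
  have W_start: "W v" unfolding W_def using P_x c e by (intro exI[of _ e] exI[of _ 1]) (simp add: v_def)
  have W_step: "W b'" if "W b" "0 < b" "b < 1" "0 \<le> b'" "b' \<le> 4 * b * (1 - b)" for b b'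
  proof -
    \<comment> \<open>A unit vector \<open>u'\<close> of block \<open>i\<close> with coefficient
      \<open>l\<close> along \<open>V u t\<close> is reflected to a vector with share
      \<open>4 * l^2 * b\<close> on \<open>d\<close>. Prescribing \<open>b'\<close> determines
      \<open>l\<close>, and Cauchy-Schwarz demands \<open>l^2 \<le> 1 - b\<close>, which is the
      bound \<open>4 * b * (1 - b)\<close>.\<close>
    define l where "l = sqrt (b' / (4 * b))"
    have l2: "l\<^sup>2 = b' / (4 * b)" using that by (simp add: l_def)
    then have l2': "4 * l\<^sup>2 * b = b'" using that by simp
    have le: "l\<^sup>2 \<le> 1 - b" unfolding l2 using that by (simp add: divide_le_eq mult.commute)
    have "0 \<le> sqrt ((1 - b) / c)" using that c by simp
    then obtain u where u: "u \<in> Z" "part {i} u = u" "block_norm i u = sqrt ((1 - b) / c)"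
      using ex_block_orthogonal[OF n_ge_2] by metis
    have cu: "c * (block_norm i u)\<^sup>2 = 1 - b" using u c that by simp
    define t where "t = sqrt (b / v)"
    have t: "v * t\<^sup>2 = b" using v that by (simp add: t_def)
    have Put: "P u t" using W_all[OF that(1) u(1,2) cu t] .
    define m where "m = sqrt ((1 - l\<^sup>2 / (1 - b)) / c)"
    have m: "0 \<le> m" "c * m\<^sup>2 = 1 - l\<^sup>2 / (1 - b)"
      using le that c by (auto simp: m_def divide_le_eq intro!: divide_nonneg_pos)
    \<comment> \<open>The component of \<open>u'\<close> along \<open>u\<close> is dictated by
      \<open>l\<close>; a vector orthogonal to \<open>u\<close> supplies the remaining
      length.\<close>
    obtain w where w: "w \<in> Z" "part {i} w = w" "block_inner i w u = 0" "block_norm i w = m"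
      using ex_block_orthogonal[OF n_ge_2 m(1), of i u] by blast
    define u' where "u' = w - vscale (of_real (- (l / (1 - b)))) u"
    have u': "u' \<in> Z" "part {i} u' = u'" using w u by (auto simp: u'_def Z_diff Z_vscale part_diff part_vscale)
    have "c * (block_norm i u')\<^sup>2 = c * m\<^sup>2 + (l / (1 - b))\<^sup>2 * (c * (block_norm i u)\<^sup>2)"
    proof -
      have "block_inner i w u = of_real 0" using w by simp
      from block_norm_diff_sq[OF this, of "- (l / (1 - b))"] show ?thesis
        unfolding u'_def w(4) by (simp add: distrib_left mult.left_commute del: of_real_minus of_real_divide of_real_diff)
    qed
    also have "\<dots> = 1"
    proof -
      have "1 - l\<^sup>2 / s + (l / s)\<^sup>2 * s = 1" if "s \<noteq> 0" for s
        using that by (simp add: power_divide power2_eq_square)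
      then show ?thesis unfolding m cu using \<open>b < 1\<close> by simp
    qed
    finally have cu': "c * (block_norm i u')\<^sup>2 = 1" .
    have "u' \<noteq> 0" using cu' by auto
    then have Pu': "P u' 0" using P_block u' by blast
    have r: "block_inner i u' u = of_real (l / c)"
    proof -
      have "block_inner i u' u = of_real (l / (1 - b) * (block_norm i u)\<^sup>2)" using w by (simp add: u'_def block_inner_simps block_inner_self)
      also have "l / (1 - b) * (block_norm i u)\<^sup>2 = l / c"
      proof -
        have "(block_norm i u)\<^sup>2 = (1 - b) / c" using cu c by (simp add: nonzero_eq_divide_eq mult.commute)
        then show ?thesis using \<open>b < 1\<close> by simp
      qed
      finally show ?thesis .
    qed
    have q1: "q u t = 1" using cu t by (simp add: q_def)
    have "P (u' - vscale (of_real (2 * l)) u) (0 - 2 * l * t)"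
      using P_reflect[OF Put Pu' r, of l] c q1 by simp
    moreover have "c * (block_norm i (u' - vscale (of_real (2 * l)) u))\<^sup>2 = 1 - b'"
    proof -
      have "c * (block_norm i (u' - vscale (of_real (2 * l)) u))\<^sup>2
          = c * (block_norm i u')\<^sup>2 - 4 * l\<^sup>2 + 4 * l\<^sup>2 * (c * (block_norm i u)\<^sup>2)"
        unfolding block_norm_diff_sq[OF r] using c by (simp add: algebra_simps power2_eq_square)
      then show ?thesis unfolding cu cu' using l2' by (simp add: algebra_simps)
    qed
    moreover have "v * (0 - 2 * l * t)\<^sup>2 = b'"
    proof -
      have "v * (0 - 2 * l * t)\<^sup>2 = 4 * l\<^sup>2 * (v * t\<^sup>2)" by (simp add: power2_eq_square)
      then show ?thesis using t l2' by simp
    qed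
    ultimately show ?thesis unfolding W_def by blast
  qed
  \<comment> \<open>One step from \<open>v\<close> reaches all sufficiently small shares. Since
    \<open>2 * s \<le> 4 * s * (1 - s)\<close> for small \<open>s\<close>, a small power of
    \<open>1 / 2\<close> can be doubled up to \<open>1 / 2\<close>, and from there a single step
    reaches all of \<open>[0, 1]\<close>.\<close>
  have W_half: "W (1 / 2)"
  proof -
    define b where "b = 4 * v * (1 - v)"
    have v1: "v < 1" using a by (simp add: v_def)
    have "0 < b" using v v1 by (simp add: b_def)
    then obtain m where m: "(1 / 2 :: real) ^ m < b" using real_arch_pow_inv[of b "1/2"] by auto
    have "(1 / 2 :: real) ^ Suc m \<le> b" using m \<open>0 < b\<close> zero_less_power[of "1/2::real" m] by simp
    then have "W ((1 / 2) ^ Suc m)" using W_step[OF W_start v v1] by (simp add: b_def)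
    then show ?thesis
    proof (induction m)
      case (Suc m)
      have le: "(1 / 2 :: real) ^ Suc m \<le> 1 / 2" by (simp add: power_le_one)
      define s where "s = (1 / 2 :: real) ^ Suc (Suc m)"
      have s: "0 < s" "s \<le> 1 / 4" "(1 / 2 :: real) ^ Suc m = 2 * s" using le by (auto simp: s_def)
      have "2 * s \<le> 4 * s * (1 - s)"
        using mult_left_mono[of "1/2" "1 - s" "4 * s"] s by simp
      then have "W (2 * s)" using W_step[of s "2 * s"] Suc.prems s by (auto simp: s_def)
      then show ?case using Suc.IH s by simp
    qed simp
  qed
  have W: "W b" if "0 \<le> b" "b \<le> 1" for b
    using W_step[OF W_half, of b] that by simp
  have P: "P u t" if "u \<in> Z" "part {i} u = u" "u \<noteq> 0 \<or> t \<noteq> 0" for u t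
  proof -
    have "block_norm i u \<noteq> 0 \<or> t \<noteq> 0" using that block_norm_eq_0_iff by metis
    then have pos: "0 < q u t" unfolding q_def using c v
      by (metis add_nonneg_pos add_pos_nonneg mult_nonneg_nonneg mult_pos_pos order_less_imp_le
          zero_le_power2 zero_less_power2)
    define s where "s = sqrt (q u t)"
    have s: "0 < s" "s\<^sup>2 = q u t" using pos by (auto simp: s_def)
    have "P (vscale (of_real (1 / s)) u) (t / s)"
    proof (rule W_all[OF W])
      show "c * (block_norm i (vscale (of_real (1 / s)) u))\<^sup>2 = 1 - v * t\<^sup>2 / q u t"
        using pos by (simp add: block_norm_vscale power_divide s norm_divide) (simp add: q_def field_simps)
      show "v * (t / s)\<^sup>2 = v * t\<^sup>2 / q u t" by (simp add: power_divide s)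
      show "0 \<le> v * t\<^sup>2 / q u t" using v pos by simp
      show "v * t\<^sup>2 / q u t \<le> 1" using pos c by (simp add: divide_le_eq) (simp add: q_def)
    qed (use that in \<open>auto simp: Z_vscale part_vscale\<close>)
    from P_scale[OF this, of s] show ?thesis using s by (simp flip: of_real_mult)
  qed
  show ?thesis
  proof (intro exI conjI ballI allI impI)
    show "0 < c" "0 < v" by fact+
    show "f (part {i} z) = of_real c * block_inner i z x" if "z \<in> Z" for z using fi[OF that] .
    show "f (x - part {i} x) = of_real v" using fd by (simp add: d_def e_def)
    show "refl_pair (u + vscale (of_real t) (x - part {i} x))
        (\<lambda>z. (of_real c * block_inner i z u + of_real t * f (z - part {i} z)) /
             of_real (c * (block_norm i u)\<^sup>2 + v * t\<^sup>2))"
      if "u \<in> Z" "part {i} u = u" "u \<noteq> 0 \<or> t \<noteq> 0" for u t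
      using PD(4)[OF P[OF that]] unfolding V_def F_def q_def g_def d_def e_def .
  qed
qed

end

section \<open>Linked blocks\<close>

context sym_norm
begin

text \<open>\<open>refl_pair_span\<close> already allows every vector of block \<open>i\<close> next
  to multiples of the fixed part in block \<open>j\<close>; a unitary of block \<open>j\<close>
  turns that part into any direction.\<close>

lemma refl_pair_two_block_aux:
  assumes Sx: "refl_pair x f" and ij: "i \<noteq> j" and nz: "part {i} x \<noteq> 0" "part {j} x \<noteq> 0" and x2: "part {i, j} x = x"
  obtains r where "0 < r"
    "\<And>u v. u \<in> Z \<Longrightarrow> part {i} u = u \<Longrightarrow> v \<in> Z \<Longrightarrow> part {j} v = v \<Longrightarrow> u \<noteq> 0 \<or> v \<noteq> 0 \<Longrightarrow>
      refl_pair (u + v) (\<lambda>z. (block_inner i z u + of_real r * block_inner j z v) / of_real ((block_norm i u)\<^sup>2 + r * (block_norm j v)\<^sup>2))"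
proof -
  note f = linear_functionalD[OF refl_pairD(2)[OF Sx]] note x = refl_pairD[OF Sx]
  have "part ({i} \<union> {j}) x = part {i} x + part {j} x" using ij by (intro part_Un) auto
  then have x_sum: "x = part {i} x + part {j} x" using x2 by (simp add: insert_commute)
  then have d: "x - part {i} x = part {j} x" unfolding diff_eq_eq by (rule trans[OF _ add.commute])
  then have "x \<noteq> part {i} x" using nz by auto
  from refl_pair_span[OF Sx nz(1) this, unfolded d]
  obtain c v where c: "0 < c" and v: "0 < v" and fv: "f (part {j} x) = of_real v"
    and span: "\<forall>u t. u \<in> Z \<longrightarrow> part {i} u = u \<longrightarrow> u \<noteq> 0 \<or> t \<noteq> 0 \<longrightarrow>
      refl_pair (u + vscale (of_real t) (part {j} x))
        (\<lambda>z. (of_real c * block_inner i z u + of_real t * f (z - part {i} z)) /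
             of_real (c * (block_norm i u)\<^sup>2 + v * t\<^sup>2))"
    by (elim exE conjE) (rule that; assumption)
  have bx: "0 < block_norm j x" using block_norm_eq_0_iff[OF x(1)] nz by (metis block_norm_nonneg less_eq_real_def)
  have fj: "f (z - part {i} z) = of_real (v / (block_norm j x)\<^sup>2) * block_inner j z x" if z: "z \<in> Z" for z
  proof -
    have "part (- {i, j}) x = 0" using x2 by (simp add: part_Compl)
    then have "f (part (- {i, j}) z) = 0" using refl_pair_off_support[OF Sx _ z] by blast
    moreover have "z - part {i} z = part {j} z + part (- {i, j}) z"
      using ij by (intro ext) (auto simp: part_apply)
    ultimately have "f (z - part {i} z) = f (part {j} z)" using f z by (simp add: Z_part)
    moreover have "of_real ((block_norm j x)\<^sup>2) * f (part {j} z) = block_inner j z x * of_real v"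
      using refl_pair_part_inner[OF Sx z, of j] fv by (simp add: block_inner_self)
    ultimately show ?thesis using bx by (simp add: field_simps)
  qed
  \<comment> \<open>After division by \<open>c\<close>, block \<open>i\<close> carries its own norm,
    and \<open>r\<close> is the factor left on block \<open>j\<close>.\<close>
  define r where "r = v / (c * (block_norm j x)\<^sup>2)"
  have r: "0 < r" "v / (block_norm j x)\<^sup>2 = c * r" using c v bx by (auto simp: r_def)
  show ?thesis
  proof (rule that[OF r(1)])
    fix u w assume u: "u \<in> Z" "part {i} u = u" and w: "w \<in> Z" "part {j} w = w" and uw: "u \<noteq> 0 \<or> w \<noteq> 0"
    define t where "t = block_norm j w / block_norm j x"
    have "u \<noteq> 0 \<or> t \<noteq> 0" using uw block_norm_eq_0_iff[OF w(1), of j] w bx by (auto simp: t_def)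
    note Su = span[rule_format, OF u this]
    define q where "q = (block_norm i u)\<^sup>2 + r * (block_norm j w)\<^sup>2"
    have q: "c * (block_norm i u)\<^sup>2 + v * t\<^sup>2 = c * q"
      using bx c by (simp add: q_def t_def r_def field_simps)
    have "part {i} u k l = u k l" for k l using u by simp
    then have bu: "part {j} u = 0" using ij by (intro ext) (metis part_apply singletonD zero_fun_apply)
    have ipu: "block_inner i (part (- {j}) z) u = block_inner i z u" for z using ij by (simp add: block_inner_part_left)
    have "refl_pair (w + u) (\<lambda>z. of_real (c * r) / of_real (c * q) * block_inner j z w
        + of_real c * block_inner i (part (- {j}) z) u / of_real (c * q))"
    proof (rule refl_pair_move[OF Su _ w(1) _ w(2) _ u(1) bu])
      show "vscale (of_real t) (part {j} x) \<in> Z" using x by (simp add: Z_vscale Z_part)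
      show "part {j} (vscale (of_real t) (part {j} x)) = vscale (of_real t) (part {j} x)" by (simp add: part_vscale)
      show "block_norm j (vscale (of_real t) (part {j} x)) = block_norm j w" using bx by (simp add: block_norm_vscale block_norm_part t_def norm_divide)
      show "u + vscale (of_real t) (part {j} x) = vscale (of_real t) (part {j} x) + u" by simp
      fix z assume "z \<in> Z"
      show "(of_real c * block_inner i z u + of_real t * f (z - part {i} z)) / of_real (c * (block_norm i u)\<^sup>2 + v * t\<^sup>2)
        = of_real (c * r) / of_real (c * q) * block_inner j z (vscale (of_real t) (part {j} x))
        + of_real c * block_inner i (part (- {j}) z) u / of_real (c * q)"
        unfolding fj[OF \<open>z \<in> Z\<close>] r(2) q ipu
        by (simp add: block_inner_simps block_inner_part_right add_divide_distrib mult_ac)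
    qed
    then show "refl_pair (u + w) (\<lambda>z. (block_inner i z u + of_real r * block_inner j z w) / of_real ((block_norm i u)\<^sup>2 + r * (block_norm j w)\<^sup>2))"
    proof (rule refl_pair_cong)
      fix z :: "nat \<Rightarrow> nat \<Rightarrow> 'a"
      have "of_real (c * r) / of_real (c * q) * block_inner j z w + of_real c * block_inner i (part (- {j}) z) u / of_real (c * q)
        = of_real c * (block_inner i z u + of_real r * block_inner j z w) / (of_real c * of_real q)"
        unfolding ipu by (simp add: add_divide_distrib algebra_simps)
      also have "\<dots> = (block_inner i z u + of_real r * block_inner j z w) / of_real q" using c by simp
      finally show "of_real (c * r) / of_real (c * q) * block_inner j z w
        + of_real c * block_inner i (part (- {j}) z) u / of_real (c * q)
        = (block_inner i z u + of_real r * block_inner j z w) / of_real ((block_norm i u)\<^sup>2 + r * (block_norm j w)\<^sup>2)" unfolding q_def .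
    qed simp
  qed
qed

text \<open>If \<open>x\<close> has further parts, a reflection in a combination of its blocks outside \<open>i\<close> carries all
  of them into block \<open>j\<close> and fixes block \<open>i\<close>.\<close>

lemma refl_pair_two_block:
  assumes Sx: "refl_pair x f" and ij: "i \<noteq> j" and nz: "part {i} x \<noteq> 0" "part {j} x \<noteq> 0"
  obtains r where "0 < r"
    "\<And>u v. u \<in> Z \<Longrightarrow> part {i} u = u \<Longrightarrow> v \<in> Z \<Longrightarrow> part {j} v = v \<Longrightarrow> u \<noteq> 0 \<or> v \<noteq> 0 \<Longrightarrow>
      refl_pair (u + v) (\<lambda>z. (block_inner i z u + of_real r * block_inner j z v) / of_real ((block_norm i u)\<^sup>2 + r * (block_norm j v)\<^sup>2))"
proof (cases "part {i, j} x = x")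
  case True
  then show ?thesis using refl_pair_two_block_aux[OF Sx ij nz] that by blast
next
  case False
  note f = linear_functionalD[OF refl_pairD(2)[OF Sx]] note x = refl_pairD[OF Sx]
  define d where "d = x - part {i} x"
  have dZ: "d \<in> Z" using x by (simp add: d_def Z_diff Z_part)
  have dj: "part {j} d = part {j} x" using ij by (simp add: d_def part_diff)
  have "part ({i} \<union> {j}) x = part {i} x + part {j} x" using ij by (intro part_Un) auto
  then have x2: "part {i, j} x = part {i} x + part {j} x" by (simp add: insert_commute)
  have d2: "d \<noteq> part {j} d" unfolding dj using False x2 by (metis d_def add.commute diff_add_cancel)
  have "d \<noteq> 0" using dj nz by auto
  then have "x \<noteq> part {i} x" by (auto simp: d_def)
  from refl_pair_span[OF Sx nz(1) this, folded d_def] obtain c v where v: "0 < v" and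
    span: "\<forall>u t. u \<in> Z \<longrightarrow> part {i} u = u \<longrightarrow> u \<noteq> 0 \<or> t \<noteq> 0 \<longrightarrow>
      refl_pair (u + vscale (of_real t) d)
        (\<lambda>z. (of_real c * block_inner i z u + of_real t * f (z - part {i} z)) / of_real (c * (block_norm i u)\<^sup>2 + v * t\<^sup>2))"
    by (elim exE conjE) (rule that; assumption)
  define fd where "fd z = f (z - part {i} z) / of_real v" for z
  have Sd: "refl_pair d fd"
    by (rule refl_pair_cong[OF span[rule_format, of 0 1]]) (auto simp: fd_def)
  note fd = linear_functionalD[OF refl_pairD(2)[OF Sd]]
  have "part {j} d \<noteq> 0" using nz dj by simp
  from refl_pair_span[OF Sd this d2] obtain c2 v2 where c2: "0 < c2" and v2: "0 < v2" and
    fd_j: "\<forall>z\<in>Z. fd (part {j} z) = of_real c2 * block_inner j z d" and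
    fd_v: "fd (d - part {j} d) = of_real v2" and
    span2: "\<forall>u t. u \<in> Z \<longrightarrow> part {j} u = u \<longrightarrow> u \<noteq> 0 \<or> t \<noteq> 0 \<longrightarrow>
      refl_pair (u + vscale (of_real t) (d - part {j} d))
        (\<lambda>z. (of_real c2 * block_inner j z u + of_real t * fd (z - part {j} z)) /
             of_real (c2 * (block_norm j u)\<^sup>2 + v2 * t\<^sup>2))"
    by (elim exE conjE) (rule that; assumption)
  define t where "t = c2 * (block_norm j d)\<^sup>2"
  have "block_norm j d \<noteq> 0" using block_norm_eq_0_iff[OF dZ] dj nz by metis
  then have t0: "0 < t" using c2 by (simp add: t_def)
  have "of_real (t + v2) = (of_real 1 :: 'a)"
    using fd_j[rule_format, OF dZ] fd_v fd(3)[OF dZ Z_part[OF dZ], of "{j}"] refl_pairD(3)[OF Sd] by (simp add: t_def block_inner_self diff_eq_eq add.commute)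
  then have tv: "t + v2 = 1" by (simp only: of_real_eq_iff)
  \<comment> \<open>\<open>t\<close> is the share of block \<open>j\<close> in \<open>d\<close>, so
    scaling that part of \<open>d\<close> by \<open>s\<close> gives it the full length of
    \<open>d\<close>. The reflection in the difference \<open>w\<close> carries \<open>d\<close> to
    the scaled part, which is why \<open>Fw d\<close> must be \<open>1 / 2\<close>.\<close>
  define s where "s = 1 / sqrt t"
  have s: "s\<^sup>2 * t = 1" "0 < s" "s * t < 1"
  proof -
    show "s\<^sup>2 * t = 1" "0 < s" using t0 by (auto simp: s_def power_divide)
    have "s * t = sqrt t" using t0 by (simp add: s_def real_div_sqrt)
    then show "s * t < 1" using tv v2 by simp
  qed
  define w where "w = d - vscale (of_real s) (part {j} d)"
  define Fw where "Fw z = (of_real (c2 * (1 - s)) * block_inner j z d + fd (z - part {j} z)) /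
             of_real (2 * (1 - s * t))" for z
  have "1 - 2 * s * t + s\<^sup>2 * t = 2 * (1 - s * t)" using s(1) by simp
  moreover have "block_norm j (vscale (of_real (1 - s)) (part {j} d)) = \<bar>1 - s\<bar> * block_norm j d"
    by (simp add: block_norm_vscale block_norm_part del: of_real_diff)
  then have "c2 * (block_norm j (vscale (of_real (1 - s)) (part {j} d)))\<^sup>2 + v2 * 1\<^sup>2 = (1 - s)\<^sup>2 * t + v2"
    by (simp add: power_mult_distrib t_def)
  moreover have "(1 - s)\<^sup>2 * t + v2 = 1 - 2 * s * t + s\<^sup>2 * t"
    using tv by (simp add: power2_eq_square algebra_simps)
  ultimately have q: "c2 * (block_norm j (vscale (of_real (1 - s)) (part {j} d)))\<^sup>2 + v2 * 1\<^sup>2 = 2 * (1 - s * t)"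
    by simp
  have "refl_pair (vscale (of_real (1 - s)) (part {j} d) + vscale (of_real 1) (d - part {j} d))
        (\<lambda>z. (of_real c2 * block_inner j z (vscale (of_real (1 - s)) (part {j} d)) + of_real 1 * fd (z - part {j} z)) /
             of_real (2 * (1 - s * t)))"
    using span2[rule_format, of "vscale (of_real (1 - s)) (part {j} d)" 1] dZ unfolding q by (simp add: Z_vscale Z_part part_vscale)
  then have Sw: "refl_pair w Fw"
  proof (rule refl_pair_cong)
    show "vscale (of_real (1 - s)) (part {j} d) + vscale (of_real 1) (d - part {j} d) = w"
      by (intro ext) (simp add: w_def algebra_simps)
  qed (auto simp: Fw_def block_inner_simps block_inner_part_right cj_diff)
  note Fw = linear_functionalD[OF refl_pairD(2)[OF Sw]]
  have "of_real (c2 * (1 - s)) * block_inner j d d + of_real v2 = (of_real (1 - s * t) :: 'a)"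
  proof -
    have "of_real (c2 * (1 - s)) * block_inner j d d + of_real v2 = (of_real ((1 - s) * t + v2) :: 'a)"
      by (simp add: block_inner_self t_def)
    then show ?thesis using tv by (simp add: algebra_simps flip: of_real_add of_real_mult)
  qed
  then have "Fw d = of_real (1 - s * t) / of_real (2 * (1 - s * t))" unfolding Fw_def fd_v by simp
  also have "\<dots> = 1 / 2"
  proof -
    have "of_real r / of_real (2 * r) = (1 / 2 :: 'a)" if "r \<noteq> 0" for r
      using that by (simp flip: of_real_divide)
    moreover have "1 - s * t \<noteq> 0" using s by simp
    ultimately show ?thesis by blast
  qed
  finally have Fwd: "Fw d = 1 / 2" .
  have "part {j} (part {i} x) = 0" using ij by simp
  then have "fd (part {i} x) = 0" "block_inner j (part {i} x) d = 0"
    using f ij by (simp_all add: fd_def block_inner_part_left)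
  then have Fwi: "Fw (part {i} x) = 0" using ij by (simp add: Fw_def)
  have "Fw x = Fw (part {i} x) + Fw d" using Fw(1)[OF Z_part[OF x(1)] dZ, of "{i}"] by (simp add: d_def)
  then have Fwx: "Fw x = 1 / 2" using Fwd Fwi by simp
  define R where "R = (\<lambda>z. z - vscale (2 * Fw z) w)"
  have R: "R \<in> isoZ nu" "\<And>z. z \<in> Z \<Longrightarrow> R (R z) = z"
    using refl_pair_reflection[OF Sw] unfolding R_def .
  have Rx: "R x = part {i} x + vscale (of_real s) (part {j} x)"
    unfolding R_def Fwx by (simp add: w_def d_def dj[unfolded d_def])
  have "refl_pair (R x) (\<lambda>y. f (R y))" by (rule refl_pair_conj[OF Sx R(1) R(1) R(2) R(2)])
  moreover have "part {i} (R x) \<noteq> 0" "part {j} (R x) \<noteq> 0"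
    unfolding Rx using nz ij s by (auto simp: part_add part_vscale)
  moreover have "part {i, j} (R x) = R x" unfolding Rx by (simp add: part_add part_vscale)
  ultimately show ?thesis using refl_pair_two_block_aux[OF _ ij] that by blast
qed

definition linked :: "nat \<Rightarrow> nat \<Rightarrow> bool"
  where "linked i j \<longleftrightarrow> (\<exists>x f. refl_pair x f \<and> part {i} x \<noteq> 0 \<and> part {j} x \<noteq> 0)"

definition cluster :: "nat \<Rightarrow> nat set"
  where "cluster i = {j. linked i j}"

text \<open>For linked blocks \<open>nu_component\<close> shows this to be the squared ratio of
  \<open>nu\<close> on unit vectors of block \<open>j\<close> to \<open>nu\<close> on unit vectors
  of block \<open>i\<close>.\<close>

definition weight :: "nat \<Rightarrow> nat \<Rightarrow> real"
  where "weight i j = (if i = j then 1 else SOME r. 0 < r \<and>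
    (\<forall>u v. u \<in> Z \<longrightarrow> part {i} u = u \<longrightarrow> v \<in> Z \<longrightarrow> part {j} v = v \<longrightarrow> u \<noteq> 0 \<or> v \<noteq> 0 \<longrightarrow>
      refl_pair (u + v) (\<lambda>z. (block_inner i z u + of_real r * block_inner j z v) / of_real ((block_norm i u)\<^sup>2 + r * (block_norm j v)\<^sup>2))))"

lemma ex_block_vector:
  assumes "0 \<le> r"
  obtains w where "w \<in> Z" "part {i} w = w" "block_norm i w = r"
  using ex_block_orthogonal[OF n_ge_2 assms] by metis

lemma linked_refl: "linked i i"
proof -
  obtain u where u: "u \<in> Z" "part {i} u = u" "block_norm i u = 1" using ex_block_vector[of 1 i] by auto
  then have "u \<noteq> 0" by auto
  then show ?thesis using refl_pair_block[OF u(1,2)] u unfolding linked_def by metis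
qed

lemma linked_sym: "linked i j \<Longrightarrow> linked j i"
  by (auto simp: linked_def)

lemma weight:
  assumes "linked i j"
  shows "0 < weight i j"
    "i \<noteq> j \<Longrightarrow> u \<in> Z \<Longrightarrow> part {i} u = u \<Longrightarrow> v \<in> Z \<Longrightarrow> part {j} v = v \<Longrightarrow> u \<noteq> 0 \<or> v \<noteq> 0 \<Longrightarrow>
      refl_pair (u + v) (\<lambda>z. (block_inner i z u + of_real (weight i j) * block_inner j z v) /
        of_real ((block_norm i u)\<^sup>2 + weight i j * (block_norm j v)\<^sup>2))"
proof -
  have *: "0 < weight i j \<and>
    (\<forall>u v. u \<in> Z \<longrightarrow> part {i} u = u \<longrightarrow> v \<in> Z \<longrightarrow> part {j} v = v \<longrightarrow> u \<noteq> 0 \<or> v \<noteq> 0 \<longrightarrow>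
      refl_pair (u + v) (\<lambda>z. (block_inner i z u + of_real (weight i j) * block_inner j z v) /
        of_real ((block_norm i u)\<^sup>2 + weight i j * (block_norm j v)\<^sup>2)))" if ij: "i \<noteq> j"
  proof -
    obtain x f where x: "refl_pair x f" "part {i} x \<noteq> 0" "part {j} x \<noteq> 0" using assms by (auto simp: linked_def)
    obtain r where "0 < r" and
      "\<And>u v. u \<in> Z \<Longrightarrow> part {i} u = u \<Longrightarrow> v \<in> Z \<Longrightarrow> part {j} v = v \<Longrightarrow> u \<noteq> 0 \<or> v \<noteq> 0 \<Longrightarrow>
      refl_pair (u + v) (\<lambda>z. (block_inner i z u + of_real r * block_inner j z v) / of_real ((block_norm i u)\<^sup>2 + r * (block_norm j v)\<^sup>2))"
      using refl_pair_two_block[OF x(1) ij x(2,3)] by blast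
    then have "\<exists>r. 0 < r \<and>
    (\<forall>u v. u \<in> Z \<longrightarrow> part {i} u = u \<longrightarrow> v \<in> Z \<longrightarrow> part {j} v = v \<longrightarrow> u \<noteq> 0 \<or> v \<noteq> 0 \<longrightarrow>
      refl_pair (u + v) (\<lambda>z. (block_inner i z u + of_real r * block_inner j z v) / of_real ((block_norm i u)\<^sup>2 + r * (block_norm j v)\<^sup>2)))"
      by blast
    then have "0 < (SOME r. 0 < r \<and>
    (\<forall>u v. u \<in> Z \<longrightarrow> part {i} u = u \<longrightarrow> v \<in> Z \<longrightarrow> part {j} v = v \<longrightarrow> u \<noteq> 0 \<or> v \<noteq> 0 \<longrightarrow>
      refl_pair (u + v) (\<lambda>z. (block_inner i z u + of_real r * block_inner j z v) / of_real ((block_norm i u)\<^sup>2 + r * (block_norm j v)\<^sup>2)))) \<and> 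
      (\<forall>u v. u \<in> Z \<longrightarrow> part {i} u = u \<longrightarrow> v \<in> Z \<longrightarrow> part {j} v = v \<longrightarrow> u \<noteq> 0 \<or> v \<noteq> 0 \<longrightarrow>
      refl_pair (u + v) (\<lambda>z. (block_inner i z u + of_real (weight i j) * block_inner j z v) /
        of_real ((block_norm i u)\<^sup>2 + weight i j * (block_norm j v)\<^sup>2)))"
      using ij unfolding weight_def by simp (rule someI_ex)
    then show ?thesis using ij by (simp add: weight_def)
  qed
  show "0 < weight i j" using * by (cases "i = j") (auto simp: weight_def)
  show "i \<noteq> j \<Longrightarrow> u \<in> Z \<Longrightarrow> part {i} u = u \<Longrightarrow> v \<in> Z \<Longrightarrow> part {j} v = v \<Longrightarrow> u \<noteq> 0 \<or> v \<noteq> 0 \<Longrightarrow>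
      refl_pair (u + v) (\<lambda>z. (block_inner i z u + of_real (weight i j) * block_inner j z v) /
        of_real ((block_norm i u)\<^sup>2 + weight i j * (block_norm j v)\<^sup>2))"
    using * by blast
qed

lemma part_single_disjoint:
  assumes "part {i} u = u" "i \<notin> A"
  shows "part A u = 0"
proof -
  have "part A u = part (A \<inter> {i}) u" using assms(1) part_part by metis
  then show ?thesis using assms(2) by simp
qed

text \<open>Two vectors of equal length with real inner product are exchanged by the reflection in
  their difference \<open>a - v - w\<close>; a real product is what makes the coefficient of
  \<open>a\<close> along the difference equal to \<open>1 / 2\<close>.\<close>

lemma linked_swap:
  assumes im: "linked i m" "i \<noteq> m"
    and a: "a \<in> Z" "part {i} a = a" and v: "v \<in> Z" "part {i} v = v" and w: "w \<in> Z" "part {m} w = w"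
    and s: "block_inner i a v = of_real s" and eq: "(block_norm i a)\<^sup>2 = (block_norm i v)\<^sup>2 + weight i m * (block_norm m w)\<^sup>2"
  shows "\<exists>h\<in>isoZ nu. h a = v + w \<and> (\<forall>z\<in>Z. part {i} z = 0 \<longrightarrow> part {m} z = 0 \<longrightarrow> h z = z)"
proof -
  define u' w' where "u' = a - v" and "w' = - w"
  show ?thesis
  proof (cases "u' = 0 \<and> w' = 0")
    case True
    then have "a = v + w" by (auto simp: u'_def w'_def)
    moreover have "(\<lambda>x. x) \<in> isoZ nu" by (auto simp: isoZ_def linZ_def)
    ultimately show ?thesis by (intro bexI[of _ "\<lambda>x. x"]) auto
  next
    case False
    have u': "u' \<in> Z" "part {i} u' = u'" using a v by (auto simp: u'_def Z_diff part_diff)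
    have w': "w' = vscale (- 1) w" by (simp add: w'_def vscale_minus1)
    then have w'Z: "w' \<in> Z" "part {m} w' = w'" using w by (simp_all only: Z_vscale part_vscale)
    define q where "q = (block_norm i u')\<^sup>2 + weight i m * (block_norm m w')\<^sup>2"
    define F where "F z = (block_inner i z u' + of_real (weight i m) * block_inner m z w') / of_real q" for z
    have SF: "refl_pair (u' + w') F" unfolding F_def q_def
      using weight(2)[OF im u' w'Z] False by blast
    have "(block_norm i (a - vscale (of_real 1) v))\<^sup>2 = (block_norm i a)\<^sup>2 - 2 * 1 * s + 1\<^sup>2 * (block_norm i v)\<^sup>2"
      using block_norm_diff_sq[OF s] .
    then have q: "q = 2 * ((block_norm i a)\<^sup>2 - s)"
      using eq by (simp add: q_def u'_def w' block_norm_vscale)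
    have q0: "q \<noteq> 0"
      using refl_pairD(3)[OF SF] by (auto simp: F_def)
    have "block_inner m a w' = 0" using block_inner_part_left[of m "{i}" a w'] a im by simp
    moreover have "block_inner i a u' = of_real ((block_norm i a)\<^sup>2 - s)"
      using s by (simp add: u'_def block_inner_simps block_inner_self)
    ultimately have "F a = of_real ((block_norm i a)\<^sup>2 - s) / of_real (2 * ((block_norm i a)\<^sup>2 - s))"
      by (simp add: F_def q)
    also have "\<dots> = 1 / 2"
    proof -
      have "of_real r / of_real (2 * r) = (1 / 2 :: 'a)" if "r \<noteq> 0" for r
        using that by (simp flip: of_real_divide)
      moreover have "(block_norm i a)\<^sup>2 - s \<noteq> 0" using q0 q by simp
      ultimately show ?thesis by blast
    qed
    finally have Fa: "F a = 1 / 2" .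
    define R where "R = (\<lambda>z. z - vscale (2 * F z) (u' + w'))"
    have R: "R \<in> isoZ nu" using refl_pair_reflection(1)[OF SF] unfolding R_def .
    have "R a = v + w" unfolding R_def Fa by (simp add: u'_def w'_def)
    moreover have "R z = z" if "z \<in> Z" "part {i} z = 0" "part {m} z = 0" for z
    proof -
      have "block_inner i z u' = 0" using block_inner_part_left[of i "{i}" z u'] that by simp
      moreover have "block_inner m z w' = 0" using block_inner_part_left[of m "{m}" z w'] that by simp
      ultimately show ?thesis by (simp add: R_def F_def)
    qed
    ultimately show ?thesis using R by blast
  qed
qed

text \<open>The blocks of \<open>F\<close> are absorbed one at a time: \<open>linked_swap\<close>
  trades the parts of \<open>w\<close> in blocks \<open>i\<close> and \<open>m\<close> for a single
  vector of block \<open>i\<close>, without changing the weighted sum of squares.\<close>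

lemma isoZ_transitive:
  assumes "finite F" "i \<notin> F" "\<forall>k\<in>F. linked i k" "w \<in> Z" "part (insert i F) w = w" "u \<in> Z" "part {i} u = u"
    "(block_norm i u)\<^sup>2 = (\<Sum>k\<in>insert i F. weight i k * (block_norm k w)\<^sup>2)"
  shows "\<exists>h\<in>isoZ nu. h u = w"
  using assms
proof (induction F arbitrary: w u rule: finite_induct)
  case empty
  then have "(block_norm i u)\<^sup>2 = (block_norm i w)\<^sup>2" by (simp add: weight_def)
  then have "block_norm i u = block_norm i w" by simp
  then show ?case
    using ex_block_unitary[of u w i] empty isoZ_lp_norm_subset by (metis insert_absorb2 subset_iff)
next
  case (insert m F)
  define v wm where "v = part {i} w" and "wm = part {m} w"
  have v: "v \<in> Z" "part {i} v = v" "block_norm i v = block_norm i w" and wm: "wm \<in> Z" "part {m} wm = wm" "block_norm m wm = block_norm m w"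
    using insert.prems by (auto simp: v_def wm_def Z_part block_norm_part)
  have im: "i \<noteq> m" "linked i m" using insert by auto
  define l where "l = sqrt ((block_norm i v)\<^sup>2 + weight i m * (block_norm m wm)\<^sup>2)"
  have l: "0 \<le> l" "l\<^sup>2 = (block_norm i v)\<^sup>2 + weight i m * (block_norm m wm)\<^sup>2"
    using weight(1)[OF im(2)] by (auto simp: l_def)
  \<comment> \<open>\<open>a\<close> is taken parallel to \<open>v\<close> so that their product is
    real, as \<open>linked_swap\<close> demands; for \<open>v = 0\<close> every direction
    qualifies.\<close>
  obtain a s where a: "a \<in> Z" "part {i} a = a" "block_norm i a = l" "block_inner i a v = of_real s"
  proof (cases "v = 0")
    case True
    obtain a where "a \<in> Z" "part {i} a = a" "block_norm i a = l" using ex_block_vector[OF l(1)] by blast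
    then show ?thesis using that[of a 0] True by simp
  next
    case False
    then have pos: "block_norm i v \<noteq> 0" using block_norm_eq_0_iff[OF v(1)] v by metis
    show ?thesis
      by (rule that[of "vscale (of_real (l / block_norm i v)) v" "l / block_norm i v * (block_norm i v)\<^sup>2"])
        (use v pos l in \<open>auto simp: Z_vscale part_vscale block_norm_vscale block_inner_simps block_inner_self norm_divide\<close>)
  qed
  obtain h2 where h2: "h2 \<in> isoZ nu" "h2 a = v + wm"
    "\<And>z. z \<in> Z \<Longrightarrow> part {i} z = 0 \<Longrightarrow> part {m} z = 0 \<Longrightarrow> h2 z = z"
    using linked_swap[OF im(2,1) a(1,2) v(1,2) wm(1,2) a(4)] l a by metis
  define rest where "rest = w - v - wm"
  have rest: "rest \<in> Z" "part {i} rest = 0" "part {m} rest = 0"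
    using insert.prems v wm im by (auto simp: rest_def Z_diff part_diff v_def wm_def)
  have restF: "part (insert i F) rest = rest"
  proof -
    have eq: "part (insert i F) w + wm = part (insert i F \<union> {m}) w"
      unfolding wm_def using insert.hyps im by (subst part_Un) auto
    have "insert i F \<union> {m} = insert i (insert m F)" by auto
    then have "part (insert i F) w + wm = w" using eq insert.prems by simp
    then have "part (insert i F) w = w - wm" by (metis add_diff_cancel_right')
    moreover have "part (insert i F) v = v" using v part_subset_id[of "{i}" v "insert i F"] by simp
    moreover have "part (insert i F) wm = 0"
      using part_single_disjoint[OF wm(2)] insert.hyps im by simp
    ultimately show ?thesis by (simp add: rest_def part_diff diff_diff_eq2 diff_right_commute)
  qed
  define w1 where "w1 = rest + a"
  have w1: "w1 \<in> Z" "part (insert i F) w1 = w1"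
    using rest restF a part_subset_id[of "{i}" a "insert i F"] by (auto simp: w1_def Z_add part_add)
  have "part {i} w1 = a" using rest a by (simp add: w1_def part_add)
  then have bi: "block_norm i w1 = l" using block_norm_part[of i "{i}" w1] a by simp
  have bk: "block_norm k w1 = block_norm k w" if "k \<in> F" for k
  proof -
    have k: "k \<noteq> i" "k \<noteq> m" using that insert by auto
    have "part {k} w1 = part {k} w"
      using k part_single_disjoint[OF a(2), of "{k}"] part_single_disjoint[OF v(2), of "{k}"]
        part_single_disjoint[OF wm(2), of "{k}"]
      by (simp add: w1_def rest_def part_add part_diff)
    then show ?thesis using block_norm_part[of k "{k}" w1] block_norm_part[of k "{k}" w] by simp
  qed
  have "(block_norm i u)\<^sup>2 = (\<Sum>k\<in>insert i F. weight i k * (block_norm k w1)\<^sup>2)"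
  proof -
    have "(block_norm i u)\<^sup>2 = (block_norm i w)\<^sup>2 + weight i m * (block_norm m w)\<^sup>2 + (\<Sum>k\<in>F. weight i k * (block_norm k w)\<^sup>2)"
      using insert im by (simp add: weight_def)
    also have "\<dots> = l\<^sup>2 + (\<Sum>k\<in>F. weight i k * (block_norm k w1)\<^sup>2)"
      using l v wm bk by simp
    finally show ?thesis using insert bi by (simp add: weight_def)
  qed
  then obtain h1 where h1: "h1 \<in> isoZ nu" "h1 u = w1"
    using insert.IH[of w1 u] insert.prems w1 by auto
  have "h2 (h1 u) = h2 rest + h2 a"
    using h1 linZD(2)[OF isoZD(1)[OF h2(1)] rest(1) a(1)] by (simp add: w1_def)
  also have "\<dots> = w" using h2 rest by (simp add: rest_def)
  finally show ?case using isoZ_comp[OF h2(1) h1(1)] by (intro bexI[of _ "\<lambda>x. h2 (h1 x)"])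
qed

text \<open>Vectors over finitely many linked blocks lie in the orbits of the multiples of
  \<open>e\<close>, and \<open>nu\<close> is constant on orbits. This is the Hilbert norm on a
  cluster.\<close>

lemma nu_component:
  assumes "finite F" "i \<notin> F" "\<forall>k\<in>F. linked i k" "w \<in> Z" "part (insert i F) w = w"
    and e: "e \<in> Z" "part {i} e = e" "block_norm i e = 1"
  shows "nu w = sqrt (\<Sum>k\<in>insert i F. weight i k * (block_norm k w)\<^sup>2) * nu e"
proof -
  define s where "s = (\<Sum>k\<in>insert i F. weight i k * (block_norm k w)\<^sup>2)"
  have s: "0 \<le> s" unfolding s_def
    using assms weight(1) linked_refl by (intro sum_nonneg mult_nonneg_nonneg) (auto simp: less_imp_le)
  define u where "u = vscale (of_real (sqrt s)) e"
  have u: "u \<in> Z" "part {i} u = u" "(block_norm i u)\<^sup>2 = s" using e s by (auto simp: u_def Z_vscale part_vscale block_norm_vscale)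
  obtain h where "h \<in> isoZ nu" "h u = w"
    using isoZ_transitive[OF assms(1-5) u(1,2)] u(3) s_def by auto
  then have "nu w = nu u" using isoZD(2) u(1) by metis
  then show ?thesis using nu_vscale[OF e(1)] s by (simp add: u_def s_def)
qed

end

section \<open>Dimensions of finite sums of blocks\<close>

definition fin_space :: "(nat \<Rightarrow> nat) \<Rightarrow> nat set \<Rightarrow> (nat \<Rightarrow> nat \<Rightarrow> 'a::real_normed_field) set"
  where "fin_space m A = {z. \<forall>k i. k \<notin> A \<or> m k \<le> i \<longrightarrow> z k i = 0}"

text \<open>The images of the coordinate vectors over \<open>A\<close> stay independent and lie in
  the span of the coordinate vectors over \<open>B\<close>; the exchange lemma compares their
  numbers.\<close>

lemma dimension_le:
  fixes T :: "(nat \<Rightarrow> nat \<Rightarrow> 'a::real_normed_field) \<Rightarrow> (nat \<Rightarrow> nat \<Rightarrow> 'a)"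
  assumes A: "finite A" and B: "finite B"
    and add: "\<And>x y. x \<in> fin_space m A \<Longrightarrow> y \<in> fin_space m A \<Longrightarrow> T (x + y) = T x + T y"
    and scale: "\<And>c x. x \<in> fin_space m A \<Longrightarrow> T (vscale c x) = vscale c (T x)"
    and inj: "\<And>x. x \<in> fin_space m A \<Longrightarrow> T x = 0 \<Longrightarrow> x = 0"
    and maps: "\<And>x. x \<in> fin_space m A \<Longrightarrow> T x \<in> fin_space m' B"
  shows "sum m A \<le> sum m' B"
proof -
  interpret vector_space "vscale :: 'a \<Rightarrow> _"
    by unfold_locales (auto simp: vscale_add vscale_left_add)
  define E :: "nat \<times> nat \<Rightarrow> nat \<Rightarrow> nat \<Rightarrow> 'a"
    where "E = (\<lambda>q k i. if k = fst q \<and> i = snd q then 1 else 0)"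
  define I where "I = Sigma A (\<lambda>k. {..<m k})"
  define J where "J = Sigma B (\<lambda>k. {..<m' k})"
  have fin: "finite I" "finite J" using A B by (auto simp: I_def J_def)
  have E: "E q \<in> fin_space m A" if "q \<in> I" for q using that by (auto simp: E_def I_def fin_space_def)
  have comb: "(\<Sum>q\<in>K. vscale (g q) (E q)) k i = (if (k, i) \<in> K then g (k, i) else 0)"
    if "finite K" for K g k i
  proof -
    have "(\<Sum>q\<in>K. vscale (g q) (E q)) k i = (\<Sum>q\<in>K. if q = (k, i) then g q else 0)"
      using that by (induction K) (auto simp: E_def)
    then show ?thesis using that by (simp add: sum.delta')
  qed
  have T0: "T 0 = 0" using scale[of 0 0] by (simp add: fin_space_def)
  have Tsum: "T (\<Sum>q\<in>K. vscale (g q) (E q)) = (\<Sum>q\<in>K. vscale (g q) (T (E q))) \<and> (\<Sum>q\<in>K. vscale (g q) (E q)) \<in> fin_space m A"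
    if "finite K" "K \<subseteq> I" for K g
    using that
  proof (induction K)
    case empty
    have "(0 :: nat \<Rightarrow> nat \<Rightarrow> 'a) \<in> fin_space m A" by (simp add: fin_space_def)
    then show ?case using T0 by (simp only: sum.empty simp_thms)
  next
    case (insert q K)
    let ?s = "\<Sum>q\<in>K. vscale (g q) (E q)"
    have q: "E q \<in> fin_space m A" using E insert by simp
    then have a: "vscale (g q) (E q) \<in> fin_space m A" by (simp add: fin_space_def)
    have b: "T ?s = (\<Sum>q\<in>K. vscale (g q) (T (E q)))" "?s \<in> fin_space m A" using insert by blast+
    have "vscale (g q) (E q) + ?s \<in> fin_space m A"
      using a b(2) unfolding fin_space_def mem_Collect_eq plus_fun_apply by simp
    moreover have "T (vscale (g q) (E q) + ?s) = vscale (g q) (T (E q)) + (\<Sum>q\<in>K. vscale (g q) (T (E q)))"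
      by (simp only: add[OF a b(2)] scale[OF q] b(1))
    ultimately show ?case
      by (simp only: sum.insert[OF insert.hyps] simp_thms)
  qed
  define G where "G = (\<lambda>q. T (E q))"
  have injG: "inj_on G I"
  proof (rule inj_onI)
    fix q r assume qr: "q \<in> I" "r \<in> I" "G q = G r"
    have "E q - E r = E q + vscale (- 1) (E r)" by (simp add: vscale_minus1)
    moreover have mem: "vscale (- 1) (E r) \<in> fin_space m A" using E[OF qr(2)] by (auto simp: fin_space_def)
    ultimately have "T (E q - E r) = 0"
      using add[OF E[OF qr(1)] mem] scale[OF E[OF qr(2)], of "- 1"] qr(3) by (simp add: G_def vscale_minus1)
    moreover have "E q - E r \<in> fin_space m A" using E[OF qr(1)] E[OF qr(2)] by (auto simp: fin_space_def)
    ultimately have "E q = E r" using inj by force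
    then have "E q (fst r) (snd r) = 1" by (simp add: E_def)
    then show "q = r" by (auto simp: E_def prod_eq_iff split: if_splits)
  qed
  have "independent (G ` I)"
  proof (rule independent_if_scalars_zero)
    fix f x assume s: "(\<Sum>x\<in>G ` I. vscale (f x) x) = 0" and x: "x \<in> G ` I"
    obtain q where q: "q \<in> I" "x = G q" using x by blast
    have "(\<Sum>r\<in>I. vscale (f (G r)) (G r)) = 0" using s by (simp add: sum.reindex[OF injG])
    then have "T (\<Sum>r\<in>I. vscale (f (G r)) (E r)) = 0"
      using Tsum[OF fin(1) order_refl, of "\<lambda>r. f (G r)"] by (simp add: G_def)
    then have "(\<Sum>r\<in>I. vscale (f (G r)) (E r)) = 0"
      using inj Tsum[OF fin(1) order_refl, of "\<lambda>r. f (G r)"] by blast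
    then have "(\<Sum>r\<in>I. vscale (f (G r)) (E r)) (fst q) (snd q) = 0" by simp
    then show "f x = 0" using q unfolding comb[OF fin(1)] by simp
  qed (use fin in simp)
  moreover have "G ` I \<subseteq> span (E ` J)"
  proof
    fix x assume "x \<in> G ` I"
    then have x: "x \<in> fin_space m' B" using maps E by (auto simp: G_def)
    have "x = (\<Sum>q\<in>J. vscale (x (fst q) (snd q)) (E q))"
    proof (intro ext)
      fix k i show "x k i = (\<Sum>q\<in>J. vscale (x (fst q) (snd q)) (E q)) k i"
        unfolding comb[OF fin(2)] using x by (auto simp: J_def fin_space_def not_less)
    qed
    moreover have "(\<Sum>q\<in>J. vscale (x (fst q) (snd q)) (E q)) \<in> span (E ` J)"
      by (intro span_sum span_scale span_base) auto
    ultimately show "x \<in> span (E ` J)" by simp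
  qed
  ultimately have "card (G ` I) \<le> card (E ` J)"
    using independent_span_bound[of "E ` J" "G ` I"] fin by blast
  also have "\<dots> \<le> card J" using fin by (rule_tac card_image_le)
  finally have "card I \<le> card J" by (simp add: card_image[OF injG])
  then show ?thesis using A B by (simp add: I_def J_def)
qed

section \<open>Finiteness of clusters and the action of isometries on them\<close>

context sym_norm
begin

lemma fin_space_iff:
  assumes "finite A"
  shows "w \<in> fin_space n A \<longleftrightarrow> w \<in> Z \<and> part A w = w"
proof
  assume w: "w \<in> fin_space n A"
  then have "w \<in> Z" using assms by (intro Z_finite[of A]) (auto simp: fin_space_def)
  moreover have "part A w = w" using w by (intro ext) (auto simp: fin_space_def part_apply)
  ultimately show "w \<in> Z \<and> part A w = w" by blast
next
  assume w: "w \<in> Z \<and> part A w = w"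
  have "w k i = 0" if "k \<notin> A" for k i
  proof -
    have "w k i = part A w k i" using w by simp
    then show ?thesis using that by (simp add: part_apply)
  qed
  then show "w \<in> fin_space n A" using w ZD by (auto simp: fin_space_def)
qed

lemma hi_pos: "0 < hi"
proof -
  obtain e where e: "e \<in> Z" "part {0} e = e" "block_norm 0 e = 1" using ex_block_vector[of 1 0] by auto
  then have "e \<noteq> 0" by auto
  then have "0 < nu e" using nu_pos e by blast
  then show ?thesis using nu_hi[OF e(1)] lp_norm_nonneg[of e]
    by (meson less_le_trans zero_less_mult_pos2 mult_pos_pos not_less mult_nonpos_nonneg)
qed

text \<open>On \<open>m\<close> blocks of a cluster a rescaled Hilbert norm is equivalent to the \<open>p\<close>-norm uniformly in \<open>m\<close>,
  which bounds \<open>m\<close> since \<open>p \<noteq> 2\<close>.\<close>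

lemma finite_cluster: "finite (cluster i)"
proof (rule ccontr)
  assume "infinite (cluster i)"
  then have inf: "infinite (cluster i - {i})" by simp
  obtain e where e: "e \<in> Z" "part {i} e = e" "block_norm i e = 1" using ex_block_vector[of 1 i] by auto
  then have "e \<noteq> 0" by auto
  define K where "K = nu e"
  have K: "0 < K" using nu_pos e \<open>e \<noteq> 0\<close> by (simp add: K_def)
  \<comment> \<open>Vectors of this length in the blocks \<open>k\<close> all have
    \<open>nu\<close>-norm \<open>K\<close>, so that their \<open>lp_norm\<close> lies between
    \<open>K / hi\<close> and \<open>K / lo\<close>.\<close>
  define r where "r k = 1 / sqrt (weight i k)" for k
  have "\<forall>k. \<exists>y. y \<in> Z \<and> part {k} y = y \<and> (linked i k \<longrightarrow> block_norm k y = r k)"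
  proof
    fix k show "\<exists>y. y \<in> Z \<and> part {k} y = y \<and> (linked i k \<longrightarrow> block_norm k y = r k)"
    proof (cases "linked i k")
      case True
      then have "0 \<le> r k" using weight(1) by (simp add: r_def less_imp_le)
      then show ?thesis using ex_block_vector by metis
    next
      case False
      then show ?thesis by (intro exI[of _ 0]) auto
    qed
  qed
  then obtain y where y: "\<And>k. y k \<in> Z" "\<And>k. part {k} (y k) = y k" "\<And>k. linked i k \<Longrightarrow> block_norm k (y k) = r k"
    by metis
  have r: "0 < r k" "weight i k * (r k)\<^sup>2 = 1" if "linked i k" for k
    using weight(1)[OF that] by (auto simp: r_def power_divide)
  have rb: "K / hi \<le> r k" "r k \<le> K / lo" if k: "k \<in> cluster i - {i}" for k
  proof -
    have ck: "linked i k" "i \<noteq> k" using k by (auto simp: cluster_def)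
    have "block_norm i (y k) = 0"
      using block_norm_eq_0_iff[OF y(1)] part_single_disjoint[OF y(2)[of k], of "{i}"] ck by simp
    then have "nu (y k) = K"
      using nu_component[of "{k}" i "y k" e] ck y r e part_subset_id[OF y(2)[of k], of "{i, k}"]
      by (simp add: K_def)
    moreover have "lp_norm (y k) = r k"
      using lp_norm_finite[of "{k}" "y k"] y ck r p_gt_1 by (simp add: powr_powr less_imp_le)
    ultimately have "lo * r k \<le> K" "K \<le> hi * r k" using nu_lo nu_hi y by metis+
    then show "K / hi \<le> r k" "r k \<le> K / lo" using lo_pos hi_pos by (simp_all add: field_simps)
  qed
  \<comment> \<open>A sum of \<open>N\<close> such vectors from distinct blocks has
    \<open>nu\<close>-norm \<open>sqrt N * K\<close>, but an \<open>lp_norm\<close> comparable to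
    \<open>N powr (1 / p)\<close>. Both comparisons are kept: which one fails for large
    \<open>N\<close> depends on the side of \<open>2\<close> on which \<open>p\<close> lies.\<close>
  have main: "real N powr (1 / 2 - 1 / p) \<le> hi / lo \<and> real N powr (1 / p - 1 / 2) \<le> hi / lo"
    if "0 < N" for N :: nat
  proof -
    obtain F where F: "F \<subseteq> cluster i - {i}" "finite F" "card F = N"
      using infinite_arbitrarily_large[OF inf] by blast
    have cF: "linked i k" "k \<noteq> i" if "k \<in> F" for k using F that by (auto simp: cluster_def)
    define w where "w = (\<lambda>k. if k \<in> F then y k k else (\<lambda>_. 0))"
    have wZ: "w \<in> Z" using F by (intro Z_finite[of F]) (auto simp: w_def ZD[OF y(1)])
    have bw: "part F w = w" by (intro ext) (simp add: w_def part_apply)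
    have bnw: "block_norm k w = r k" if "k \<in> F" for k
    proof -
      have "block_norm k w = block_norm k (y k)" by (rule block_norm_off) (simp add: w_def that)
      then show ?thesis using y cF that by simp
    qed
    have "i \<notin> F" using F by auto
    then have "block_norm i w = 0" unfolding block_norm_def by (simp add: w_def L2_set_0')
    then have "(\<Sum>k\<in>insert i F. weight i k * (block_norm k w)\<^sup>2) = (\<Sum>k\<in>F. 1)"
      using F \<open>i \<notin> F\<close> cF r bnw by simp
    moreover have "part (insert i F) w = w" using bw by (rule part_subset_id) auto
    ultimately have nuw: "nu w = sqrt N * K"
      using nu_component[OF F(2) \<open>i \<notin> F\<close> _ wZ _ e] cF F by (simp add: K_def)
    have znw: "lp_norm w = (\<Sum>k\<in>F. r k powr p) powr (1 / p)"
      using lp_norm_finite[OF F(2) bw] bnw by simp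
    have up: "lp_norm w \<le> real N powr (1 / p) * (K / lo)"
    proof -
      have "(\<Sum>k\<in>F. r k powr p) \<le> (\<Sum>k\<in>F. (K / lo) powr p)"
        using F rb r cF p_gt_1 by (intro sum_mono powr_mono2) (auto simp: less_imp_le)
      then have "lp_norm w \<le> (real N * (K / lo) powr p) powr (1 / p)"
        unfolding znw using F p_gt_1 by (intro powr_mono2) (auto intro: sum_nonneg)
      then show ?thesis using K lo_pos p_gt_1 by (simp add: powr_mult powr_powr)
    qed
    have low: "real N powr (1 / p) * (K / hi) \<le> lp_norm w"
    proof -
      have "(\<Sum>k\<in>F. (K / hi) powr p) \<le> (\<Sum>k\<in>F. r k powr p)"
        using F rb K hi_pos p_gt_1 by (intro sum_mono powr_mono2) (auto simp: less_imp_le)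
      then have "(real N * (K / hi) powr p) powr (1 / p) \<le> lp_norm w"
        unfolding znw using F p_gt_1 by (intro powr_mono2) auto
      then show ?thesis using K hi_pos p_gt_1 by (simp add: powr_mult powr_powr)
    qed
    have "sqrt N * K \<le> hi * (real N powr (1 / p) * (K / lo))"
      using nu_hi[OF wZ] up hi_pos nuw by (smt (verit, best) mult_left_mono)
    then have 1: "sqrt N \<le> (hi / lo) * real N powr (1 / p)" using K lo_pos by (simp add: field_simps)
    have "lo * (real N powr (1 / p) * (K / hi)) \<le> sqrt N * K"
      using nu_lo[OF wZ] low lo_pos nuw by (smt (verit, best) mult_left_mono)
    then have 2: "real N powr (1 / p) \<le> (hi / lo) * sqrt N" using K lo_pos hi_pos by (simp add: field_simps)
    have sq: "sqrt N = real N powr (1 / 2)" by (simp add: powr_half_sqrt)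
    have "0 < real N powr (1 / p)" "0 < real N powr (1 / 2)" using that by auto
    then show ?thesis using 1 2 unfolding sq powr_diff by (simp add: divide_le_eq)
  qed
  define s where "s = \<bar>1 / 2 - 1 / p\<bar>"
  have s: "0 < s" using p_ne_2 p_gt_1 by (simp add: s_def field_simps)
  have bound: "real N powr s \<le> hi / lo" if "0 < N" for N :: nat
    using main[OF that] by (auto simp: s_def abs_if)
  define b where "b = (hi / lo + 1) powr (1 / s)"
  obtain N :: nat where N: "b \<le> real N" "0 < N"
    by (metis gr0I of_nat_0 order_refl powr_ge_zero real_arch_simple b_def
        add_pos_nonneg divide_pos_pos hi_pos lo_pos not_less order_less_le powr_gt_zero zero_le_one)
  have "hi / lo + 1 = b powr s" using s hi_pos lo_pos by (simp add: b_def powr_powr)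
  also have "\<dots> \<le> real N powr s" using N s by (intro powr_mono2) (auto simp: b_def)
  finally show False using bound[OF N(2)] by simp
qed

lemma cluster_insert: "insert i (cluster i - {i}) = cluster i"
  using linked_refl by (auto simp: cluster_def)

lemma cluster_transitive:
  assumes w: "w \<in> Z" "part (cluster i) w = w" and e: "e \<in> Z" "part {i} e = e" "block_norm i e = 1"
  obtains h s where "h \<in> isoZ nu" "h (vscale (of_real s) e) = w" 
proof -
  define s where "s = (\<Sum>k\<in>cluster i. weight i k * (block_norm k w)\<^sup>2)"
  have "0 \<le> s" unfolding s_def
    using weight(1) by (intro sum_nonneg mult_nonneg_nonneg) (auto simp: cluster_def less_imp_le)
  then have "(block_norm i (vscale (of_real (sqrt s)) e))\<^sup>2 = s" using e by (simp add: block_norm_vscale)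
  moreover have "\<forall>k\<in>cluster i - {i}. linked i k" by (simp add: cluster_def)
  ultimately have "\<exists>h\<in>isoZ nu. h (vscale (of_real (sqrt s)) e) = w"
    using isoZ_transitive[of "cluster i - {i}" i w "vscale (of_real (sqrt s)) e"] finite_cluster w e
    unfolding cluster_insert s_def by (simp add: Z_vscale part_vscale)
  then show ?thesis using that by blast
qed

text \<open>\<open>w\<close> is the image of a vector of block \<open>i\<close> under an isometry,
  which carries the Householder reflection along.\<close>

lemma refl_pair_comp:
  assumes "w \<in> Z" "part (cluster i) w = w" "w \<noteq> 0"
  shows "\<exists>f. refl_pair w f"
proof -
  obtain e where e: "e \<in> Z" "part {i} e = e" "block_norm i e = 1" using ex_block_vector[of 1 i] by auto
  obtain h s where h: "h \<in> isoZ nu" "h (vscale (of_real s) e) = w"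
    using cluster_transitive[OF assms(1,2) e] by blast
  define u where "u = vscale (of_real s :: 'a) e"
  have u: "u \<in> Z" "part {i} u = u" using e by (auto simp: u_def Z_vscale part_vscale)
  have "u \<noteq> 0" using assms(3) h linZD(5)[OF isoZD(1)[OF h(1)]] unfolding u_def by metis
  obtain h' where "h' \<in> isoZ nu" "\<And>x. x \<in> Z \<Longrightarrow> h' (h x) = x" "\<And>x. x \<in> Z \<Longrightarrow> h (h' x) = x"
    using isoZ_inv[OF h(1)] by blast
  then have "refl_pair (h u) (\<lambda>y. block_inner i (h' y) u / block_inner i u u)"
    using refl_pair_conj[OF refl_pair_block[OF u \<open>u \<noteq> 0\<close>] h(1)] by blast
  then show ?thesis using h unfolding u_def by blast
qed

text \<open>A sum of vectors from blocks \<open>j\<close> and \<open>k\<close> lies over the cluster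
  of \<open>i\<close>, so \<open>refl_pair_comp\<close> makes it a reflection vector that meets
  both.\<close>

lemma linked_trans:
  assumes "linked i j" "linked i k"
  shows "linked j k"
proof (cases "j = k")
  case False
  obtain y where y: "y \<in> Z" "part {j} y = y" "block_norm j y = 1" using ex_block_vector[of 1 j] by auto
  obtain z where z: "z \<in> Z" "part {k} z = z" "block_norm k z = 1" using ex_block_vector[of 1 k] by auto
  have nz: "y \<noteq> 0" "z \<noteq> 0" using y z by auto
  have "part {j} z = 0" "part {k} y = 0"
    using part_single_disjoint[OF z(2), of "{j}"] part_single_disjoint[OF y(2), of "{k}"] False by auto
  then have b: "part {j} (y + z) = y" "part {k} (y + z) = z" using y z by (auto simp: part_add)
  have "part (cluster i) y = y" "part (cluster i) z = z"
    using part_subset_id y(2) z(2) assms by (metis cluster_def empty_subsetI insert_subset mem_Collect_eq)+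
  moreover have "y + z \<noteq> 0" using b(1) nz(1) by (metis part_zero)
  ultimately have "\<exists>f. refl_pair (y + z) f"
    using refl_pair_comp[of "y + z" i] y z by (simp add: Z_add part_add)
  then show ?thesis using b nz unfolding linked_def by metis
qed (simp add: linked_refl)

lemma cluster_eq: "linked i j \<Longrightarrow> cluster i = cluster j"
  unfolding cluster_def using linked_trans linked_sym by blast

text \<open>A nonzero vector over the cluster carries a reflection, hence so does its image, and the
  blocks met by the image are pairwise linked. The image of one vector \<open>u\<close> selects the
  cluster \<open>j\<close>.\<close>

lemma isoZ_comp_image:
  assumes h: "h \<in> isoZ nu"
  obtains j where "\<And>w. w \<in> Z \<Longrightarrow> part (cluster i) w = w \<Longrightarrow> part (cluster j) (h w) = h w"
proof -
  note lin = linZD[OF isoZD(1)[OF h]]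
  obtain h' where h': "h' \<in> isoZ nu" "\<And>x. x \<in> Z \<Longrightarrow> h' (h x) = x" "\<And>x. x \<in> Z \<Longrightarrow> h (h' x) = x"
    using isoZ_inv[OF h] by blast
  have inj: "h w \<noteq> 0" if "w \<in> Z" "w \<noteq> 0" for w
    using h'(2)[OF that(1)] that(2) linZD(5)[OF isoZD(1)[OF h'(1)]] by metis
  have linked: "linked j m"
    if w: "w \<in> Z" "part (cluster i) w = w" and jm: "part {j} (h w) \<noteq> 0" "part {m} (h w) \<noteq> 0" for w j m
  proof -
    have "w \<noteq> 0" using jm lin(5) by auto
    from refl_pair_comp[OF w this] obtain f where f: "refl_pair w f" ..
    show ?thesis using refl_pair_conj[OF f h h'] jm unfolding linked_def by blast
  qed
  obtain u where u: "u \<in> Z" "part {i} u = u" "block_norm i u = 1" using ex_block_vector[of 1 i] by auto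
  have uc: "part (cluster i) u = u"
    using part_subset_id[OF u(2)] linked_refl by (simp add: cluster_def)
  have "u \<noteq> 0" using u by auto
  then have "h u \<noteq> 0" using inj u by blast
  then obtain j where j: "part {j} (h u) \<noteq> 0"
    using part_eq_0_iff[of UNIV "h u"] by (auto simp: part_def)
  show ?thesis
  proof (rule that)
    fix w assume w: "w \<in> Z" "part (cluster i) w = w"
    have "linked j m" if m: "part {m} (h w) \<noteq> 0" for m
    proof (rule ccontr)
      assume nc: "\<not> linked j m"
      have "part {m} (h u) = 0" "part {j} (h w) = 0" using linked[OF u(1) uc j] linked[OF w _ m] nc by blast+
      \<comment> \<open>Each of the two images meets just one of the blocks \<open>j\<close> and
        \<open>m\<close>, so the image of the sum meets both; and the sum still lies over the
        cluster.\<close>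
      then have "part {m} (h (w + u)) \<noteq> 0" "part {j} (h (w + u)) \<noteq> 0"
        using m j lin w u by (auto simp: part_add)
      then show False
        using linked[of "w + u" j m] nc w u uc by (auto simp: Z_add part_add)
    qed
    then have "part {m} (h w) = 0" if "m \<notin> cluster j" for m using that by (auto simp: cluster_def)
    then have "part (- cluster j) (h w) = 0" using part_eq_0_iff by blast
    then show "part (cluster j) (h w) = h w" by (simp add: part_Compl)
  qed
qed

text \<open>Minimality of clusters: half the difference of \<open>y\<close> and a sign change of it
  isolates a nonzero part in one block, and the orbits of its multiples fill the cluster.\<close>

lemma invariant_subspace_contains_comp:
  assumes diff: "\<And>x y. x \<in> Y \<Longrightarrow> y \<in> Y \<Longrightarrow> x - y \<in> Y" and scale: "\<And>c x. x \<in> Y \<Longrightarrow> vscale c x \<in> Y"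
    and inv: "\<And>h x. h \<in> isoZ nu \<Longrightarrow> x \<in> Y \<Longrightarrow> h x \<in> Y"
    and y: "y \<in> Y" "y \<in> Z" "y \<noteq> 0"
  obtains i where "\<And>w. w \<in> Z \<Longrightarrow> part (cluster i) w = w \<Longrightarrow> w \<in> Y"
proof -
  obtain i where i: "part {i} y \<noteq> 0"
    using part_eq_0_iff[of UNIV y] y by (auto simp: part_def)
  define u where "u = part {i} y"
  have u: "u \<in> Z" "part {i} u = u" "u \<noteq> 0" using y i by (auto simp: u_def Z_part)
  have "vscale (1 / 2) (y - block_scale {i} (- 1) y) = u"
    by (intro ext) (simp add: u_def block_scale_eq)
  moreover have "block_scale {i} (- 1) y \<in> Y" using inv[OF block_scale_isoZ y(1)] by simp
  then have "vscale (1 / 2) (y - block_scale {i} (- 1) y) \<in> Y" by (rule scale[OF diff[OF y(1)]])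
  ultimately have uY: "u \<in> Y" by simp
  define e where "e = vscale (of_real (1 / block_norm i u)) u"
  have "block_norm i u \<noteq> 0" using block_norm_eq_0_iff[OF u(1)] u by metis
  then have e: "e \<in> Z" "part {i} e = e" "block_norm i e = 1"
    using u by (auto simp: e_def Z_vscale part_vscale block_norm_vscale norm_divide)
  have eY: "e \<in> Y" using uY scale by (simp add: e_def)
  show ?thesis
  proof (rule that)
    fix w assume w: "w \<in> Z" "part (cluster i) w = w"
    obtain h s where "h \<in> isoZ nu" "h (vscale (of_real s) e) = w" using cluster_transitive[OF w e] by blast
    then show "w \<in> Y" using inv scale eY by metis
  qed
qed

end

section \<open>Distinct dimensions: preserved clusters and their merging\<close>

locale sym_norm_distinct = sym_norm +
  fixes e :: "nat \<Rightarrow> nat"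
  assumes n_eq: "n k = 2 ^ e k" and inj_e: "inj e"
begin

text \<open>The exponents are the binary digits of the dimension, which therefore determines the
  finite set of blocks.\<close>

lemma sum_n: "finite A \<Longrightarrow> sum n A = set_encode (e ` A)"
  unfolding set_encode_def using inj_e
  by (simp add: sum.reindex inj_on_subset n_eq)

lemma sum_n_eq_iff: "finite A \<Longrightarrow> finite B \<Longrightarrow> sum n A = sum n B \<longleftrightarrow> A = B"
  using inj_e by (simp add: sum_n set_encode_eq inj_image_eq_iff)

lemma isoZ_sum_le:
  assumes h: "h \<in> isoZ nu" and im: "\<And>w. w \<in> Z \<Longrightarrow> part (cluster i) w = w \<Longrightarrow> part (cluster j) (h w) = h w"
  shows "sum n (cluster i) \<le> sum n (cluster j)"
proof (rule dimension_le[OF finite_cluster finite_cluster, where T = h])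
  note lin = linZD[OF isoZD(1)[OF h]]
  note fs = fin_space_iff[OF finite_cluster]
  obtain h' where h': "h' \<in> isoZ nu" "\<And>x. x \<in> Z \<Longrightarrow> h' (h x) = x" "\<And>x. x \<in> Z \<Longrightarrow> h (h' x) = x"
    using isoZ_inv[OF h] by blast
  show "h (x + y) = h x + h y" if "x \<in> fin_space n (cluster i)" "y \<in> fin_space n (cluster i)" for x y
    using that lin fs by auto
  show "h (vscale c x) = vscale c (h x)" if "x \<in> fin_space n (cluster i)" for c x
    using that lin fs by auto
  show "x = 0" if "x \<in> fin_space n (cluster i)" "h x = 0" for x
    using that h'(2) linZD(5)[OF isoZD(1)[OF h'(1)]] fs by metis
  show "h x \<in> fin_space n (cluster j)" if "x \<in> fin_space n (cluster i)" for x
    using that im lin fs by auto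
qed

text \<open>\<open>h\<close> maps the cluster injectively into some cluster \<open>j\<close>, and
  its inverse maps that one back into the cluster of \<open>i\<close>. So the two dimensions agree,
  and with them the clusters.\<close>

lemma isoZ_preserves_comp:
  assumes h: "h \<in> isoZ nu" and w: "w \<in> Z" "part (cluster i) w = w"
  shows "part (cluster i) (h w) = h w"
proof -
  obtain h' where h': "h' \<in> isoZ nu" "\<And>x. x \<in> Z \<Longrightarrow> h' (h x) = x" "\<And>x. x \<in> Z \<Longrightarrow> h (h' x) = x"
    using isoZ_inv[OF h] by blast
  obtain j where j: "\<And>w. w \<in> Z \<Longrightarrow> part (cluster i) w = w \<Longrightarrow> part (cluster j) (h w) = h w"
    using isoZ_comp_image[OF h] by blast
  obtain l where l: "\<And>w. w \<in> Z \<Longrightarrow> part (cluster j) w = w \<Longrightarrow> part (cluster l) (h' w) = h' w"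
    using isoZ_comp_image[OF h'(1)] by blast
  obtain u where u: "u \<in> Z" "part {i} u = u" "block_norm i u = 1" using ex_block_vector[of 1 i] by auto
  have uc: "part (cluster i) u = u"
    using part_subset_id[OF u(2)] linked_refl by (simp add: cluster_def)
  have "h u \<in> Z" using linZD(1)[OF isoZD(1)[OF h] u(1)] .
  from l[OF this j[OF u(1) uc]] have "part (cluster l) u = u" using h'(2)[OF u(1)] by simp
  then have "i \<in> cluster l" using part_single_disjoint[OF u(2), of "cluster l"] u(3) by (metis block_norm_0 zero_neq_one)
  then have "cluster l = cluster i" using cluster_eq by (simp add: cluster_def)
  moreover have "sum n (cluster i) \<le> sum n (cluster j)" by (rule isoZ_sum_le[OF h]) (rule j)
  moreover have "sum n (cluster j) \<le> sum n (cluster l)" by (rule isoZ_sum_le[OF h'(1)]) (rule l)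
  ultimately have "sum n (cluster i) = sum n (cluster j)" by simp
  then have "cluster i = cluster j" using sum_n_eq_iff finite_cluster by blast
  then show ?thesis using j[OF w] by simp
qed

text \<open>Beyond preservation, \<open>h\<close> must send nothing from outside into the cluster.
  For \<open>u\<close> in a block of the cluster, the preimage of \<open>u\<close> again lies over
  the cluster and carries a reflection whose functional is a multiple of the product of
  \<open>h x\<close> with \<open>u\<close>; \<open>refl_pair_off_support\<close> makes it vanish
  outside.\<close>

lemma isoZ_commutes_comp:
  assumes h: "h \<in> isoZ nu" and z: "z \<in> Z"
  shows "h (part (cluster i) z) = part (cluster i) (h z)"
proof -
  note lin = linZD[OF isoZD(1)[OF h]]
  obtain h' where h': "h' \<in> isoZ nu" "\<And>x. x \<in> Z \<Longrightarrow> h' (h x) = x" "\<And>x. x \<in> Z \<Longrightarrow> h (h' x) = x"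
    using isoZ_inv[OF h] by blast
  note lin' = linZD[OF isoZD(1)[OF h'(1)]]
  define y where "y = part (- cluster i) z"
  have y: "y \<in> Z" "part (cluster i) y = 0" "part (- cluster i) y = y" using z by (auto simp: y_def Z_part)
  have "part {k} (h y) = 0" if k: "k \<in> cluster i" for k
  proof (rule ccontr)
    define u where "u = part {k} (h y)"
    assume "part {k} (h y) \<noteq> 0"
    then have u: "u \<in> Z" "part {k} u = u" "u \<noteq> 0" using lin y by (auto simp: u_def Z_part)
    then have "block_norm k u \<noteq> 0" using block_norm_eq_0_iff by metis
    then have uu: "block_inner k u u \<noteq> 0" by (simp add: block_inner_self)
    have "part (cluster i) u = u" using part_subset_id[OF u(2)] k by simp
    then have "part (cluster i) (h' u) = h' u" using isoZ_preserves_comp[OF h'(1) u(1)] by blast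
    then have "part (- cluster i) (h' u) = 0" by (simp add: part_Compl)
    moreover have "refl_pair (h' u) (\<lambda>x. block_inner k (h x) u / block_inner k u u)"
      using refl_pair_conj[OF refl_pair_block[OF u] h'(1) h h'(3,2)] .
    ultimately have "block_inner k (h (part (- cluster i) y)) u / block_inner k u u = 0"
      using refl_pair_off_support y(1) by blast
    then have "block_inner k (h y) u = 0" using y uu by simp
    moreover have "block_inner k u u = block_inner k (h y) u" by (simp add: u_def block_inner_part_left block_inner_part_right)
    ultimately show False using uu by simp
  qed
  then have hy: "part (cluster i) (h y) = 0" using part_eq_0_iff by blast
  have zz: "z = part (cluster i) z + y" by (simp add: y_def part_Compl)
  have "h (part (cluster i) z + y) = h (part (cluster i) z) + h y" using lin z y by (simp add: Z_part)
  then have "part (cluster i) (h z) = part (cluster i) (h (part (cluster i) z)) + part (cluster i) (h y)"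
    using zz by (simp add: part_add)
  also have "\<dots> = h (part (cluster i) z)"
    using isoZ_preserves_comp[OF h, of "part (cluster i) z"] z hy by (simp add: Z_part)
  finally show ?thesis by simp
qed

text \<open>Two clusters are merged into one by taking the Hilbert sum of their norms.\<close>

lemma ex_larger_isoZ:
  obtains nu' lo' hi' where "\<And>c x. x \<in> Z \<Longrightarrow> nu' (vscale c x) = norm c * nu' x"
    "\<And>x y. x \<in> Z \<Longrightarrow> y \<in> Z \<Longrightarrow> nu' (x + y) \<le> nu' x + nu' y"
    "0 < lo'" "0 < hi'" "\<And>x. x \<in> Z \<Longrightarrow> lo' * lp_norm x \<le> nu' x" "\<And>x. x \<in> Z \<Longrightarrow> nu' x \<le> hi' * lp_norm x"
    "isoZ nu \<subset> isoZ nu'"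
proof -
  define i :: nat where "i = 0"
  \<comment> \<open>Possible because a cluster is finite while there are infinitely many
    blocks.\<close>
  obtain j where j: "j \<notin> cluster i" using ex_new_if_finite[OF _ finite_cluster] by auto
  define C D E where "C = cluster i" and "D = cluster j" and "E = - (C \<union> D)"
  have disj: "C \<inter> D = {}"
  proof (rule ccontr)
    assume "C \<inter> D \<noteq> {}"
    then obtain k where "linked i k" "linked j k" by (auto simp: C_def D_def cluster_def)
    then have "linked i j" using linked_trans linked_sym by blast
    then show False using j by (simp add: cluster_def)
  qed
  have iC: "i \<in> C" "j \<in> D" using linked_refl by (auto simp: C_def D_def cluster_def)
  then have ij: "i \<noteq> j" "i \<notin> D" "j \<notin> C" using disj by auto
  have blkE: "part E z = z - part C z - part D z" for z
    using disj by (intro ext) (auto simp: E_def part_apply)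
  \<comment> \<open>The old isometries commute with the projections to \<open>C\<close>,
    \<open>D\<close> and \<open>E\<close>, so they preserve each of the three terms.\<close>
  define nu' where "nu' z = sqrt ((nu (part C z))\<^sup>2 + (nu (part D z))\<^sup>2) + nu (part E z)" for z
  have nn: "0 \<le> nu (part A z)" if "z \<in> Z" for A z using nu_nonneg that by (simp add: Z_part)
  have 1: "nu' (vscale c x) = norm c * nu' x" if "x \<in> Z" for c x
  proof -
    have "sqrt ((norm c * a)\<^sup>2 + (norm c * b)\<^sup>2) = norm c * sqrt (a\<^sup>2 + b\<^sup>2)" for a b
      by (simp add: power_mult_distrib real_sqrt_mult flip: distrib_left)
    then show ?thesis using that by (simp add: nu'_def part_vscale nu_vscale Z_part distrib_left)
  qed
  have 2: "nu' (x + y) \<le> nu' x + nu' y" if "x \<in> Z" "y \<in> Z" for x y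
  proof -
    have le: "nu (part A (x + y)) \<le> nu (part A x) + nu (part A y)" for A
      using that nu_add by (simp add: part_add Z_part)
    have "sqrt ((nu (part C (x + y)))\<^sup>2 + (nu (part D (x + y)))\<^sup>2)
        \<le> sqrt ((nu (part C x) + nu (part C y))\<^sup>2 + (nu (part D x) + nu (part D y))\<^sup>2)"
      using le nn Z_add[OF that] by (intro real_sqrt_le_mono add_mono power_mono) auto
    also have "\<dots> \<le> sqrt ((nu (part C x))\<^sup>2 + (nu (part D x))\<^sup>2) + sqrt ((nu (part C y))\<^sup>2 + (nu (part D y))\<^sup>2)"
      by (rule real_sqrt_sum_squares_triangle_ineq)
    finally show ?thesis using le[of E] by (simp add: nu'_def)
  qed
  have 3: "lo / 2 * lp_norm x \<le> nu' x" if x: "x \<in> Z" for x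
  proof -
    have arith: "t \<le> 2 * (s + r)" if "t \<le> p + (q + r)" "p \<le> s" "q \<le> s" "0 \<le> r" for p q r s t :: real
      using that by auto
    have "x = part C x + (part D x + part E x)" by (simp add: blkE)
    then have "nu x \<le> nu (part C x) + (nu (part D x) + nu (part E x))"
      using nu_add x by (smt (verit, best) Z_add Z_part)
    then have "nu x \<le> 2 * nu' x"
      unfolding nu'_def
      by (rule arith[OF _ real_sqrt_sum_squares_ge1 real_sqrt_sum_squares_ge2 nn[OF x]])
    then show ?thesis using nu_lo[OF x] by simp
  qed
  have 4: "nu' x \<le> 3 * hi * lp_norm x" if x: "x \<in> Z" for x
  proof -
    have le: "nu (part A x) \<le> hi * lp_norm x" for A
    proof -
      have "nu (part A x) \<le> hi * lp_norm (part A x)" using nu_hi x by (simp add: Z_part)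
      also have "\<dots> \<le> hi * lp_norm x" using lp_norm_part[OF x] hi_pos by (intro mult_left_mono) auto
      finally show ?thesis .
    qed
    have "nu' x \<le> nu (part C x) + nu (part D x) + nu (part E x)"
      using nn[OF x] sqrt_sum_squares_le_sum[of "nu (part C x)" "nu (part D x)"] by (simp add: nu'_def)
    then show ?thesis using le[of C] le[of D] le[of E] by simp
  qed
  have sub: "isoZ nu \<subseteq> isoZ nu'"
  proof
    fix h assume h: "h \<in> isoZ nu"
    note lin = linZD[OF isoZD(1)[OF h]]
    have "nu' (h z) = nu' z" if z: "z \<in> Z" for z
    proof -
      have c: "part C (h z) = h (part C z)" "part D (h z) = h (part D z)"
        unfolding C_def D_def using isoZ_commutes_comp[OF h z] by simp_all
      then have "part E (h z) = h (part E z)"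
        using lin z by (simp add: blkE Z_diff Z_part)
      then show ?thesis using c isoZD(2)[OF h] z by (simp add: nu'_def Z_part)
    qed
    then show "h \<in> isoZ nu'" using h by (simp add: isoZ_def)
  qed

  obtain a where a: "a \<in> Z" "part {i} a = a" "block_norm i a = 1" using ex_block_vector[of 1 i] by auto
  obtain b where b: "b \<in> Z" "part {j} b = b" "block_norm j b = 1" using ex_block_vector[of 1 j] by auto
  define \<alpha> \<beta> where "\<alpha> = (nu a)\<^sup>2" and "\<beta> = (nu b)\<^sup>2"
  have "a \<noteq> 0" "b \<noteq> 0" using a b by auto
  then have pos: "0 < \<alpha>" "0 < \<beta>" using nu_pos[OF a(1)] nu_pos[OF b(1)] by (auto simp: \<alpha>_def \<beta>_def)
  have off: "part A a = 0" if "i \<notin> A" for A using part_single_disjoint[OF a(2) that] .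
  have off': "part A b = 0" if "j \<notin> A" for A using part_single_disjoint[OF b(2) that] .
  define x where "x = a + b"
  have x: "x \<in> Z" "part {i} x = a" "part {j} x = b"
    using a b off[of "{j}"] off'[of "{i}"] ij by (auto simp: x_def Z_add part_add)
  have ipx: "block_inner i z x = block_inner i z a" "block_inner j z x = block_inner j z b" "block_inner i x z = block_inner i a z" "block_inner j x z = block_inner j b z" for z
    using x block_inner_part_right[of i z "{i}" x] block_inner_part_right[of j z "{j}" x]
      block_inner_part_left[of i "{i}" x z] block_inner_part_left[of j "{j}" x z] by simp_all
  \<comment> \<open>\<open>\<alpha>\<close> and \<open>\<beta>\<close> are the squared norms of the
    unit vectors \<open>a\<close> and \<open>b\<close>, so \<open>F\<close> is the coefficient along
    \<open>a + b\<close> in the merged Hilbert norm. The reflection \<open>T\<close> will be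
    isometric for \<open>nu'\<close>, whereas for \<open>nu\<close> it would link \<open>i\<close>
    and \<open>j\<close>.\<close>
  define F where "F z = (of_real \<alpha> * block_inner i z a + of_real \<beta> * block_inner j z b) / of_real (\<alpha> + \<beta>)" for z
  have "of_real (\<alpha> + \<beta>) \<noteq> (0 :: 'a)" using pos by (simp only: of_real_eq_0_iff)
  then have FD: "of_real (\<alpha> + \<beta>) * F z = of_real \<alpha> * block_inner i z a + of_real \<beta> * block_inner j z b" for z
    unfolding F_def by simp
  have linF: "linear_functional F"
    by (auto simp: linear_functional_def F_def block_inner_simps add_divide_distrib algebra_simps)
  have Fx: "F x = 1"
  proof -
    have "of_real (\<alpha> + \<beta>) * F x = of_real (\<alpha> + \<beta>)"
      unfolding FD by (simp add: ipx block_inner_self a b)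
    then show ?thesis using \<open>of_real (\<alpha> + \<beta>) \<noteq> 0\<close> by simp
  qed
  define T where "T = (\<lambda>z. z - vscale (2 * F z) x)"
  have TT: "T (T z) = z" if "z \<in> Z" for z
  proof -
    have "F (T z) = - F z" using that linear_functionalD[OF linF] x Fx by (simp add: T_def Z_vscale)
    then have "T (T z) = T z - vscale (- 2 * F z) x" by (simp add: T_def)
    also have "\<dots> = z" by (intro ext) (simp add: T_def)
    finally show ?thesis .
  qed
  have linT: "linZ T"
    using x linear_functionalD[OF linF] by (auto simp: linZ_def T_def Z_diff Z_vscale vscale_diff vscale_left_add algebra_simps)
  have key: "\<alpha> * (block_norm i (T z))\<^sup>2 + \<beta> * (block_norm j (T z))\<^sup>2 = \<alpha> * (block_norm i z)\<^sup>2 + \<beta> * (block_norm j z)\<^sup>2" for z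
  proof -
    have i: "block_inner i (T z) (T z) = block_inner i z z - cj (2 * F z) * block_inner i z a - 2 * F z * cj (block_inner i z a)
        + 2 * F z * cj (2 * F z)"
    proof -
      have "block_inner i a a = 1" using a by (simp add: block_inner_self)
      then show ?thesis by (simp add: T_def block_inner_simps ipx cj_inner algebra_simps)
    qed
    have j: "block_inner j (T z) (T z) = block_inner j z z - cj (2 * F z) * block_inner j z b - 2 * F z * cj (block_inner j z b)
        + 2 * F z * cj (2 * F z)"
    proof -
      have "block_inner j b b = 1" using b by (simp add: block_inner_self)
      then show ?thesis by (simp add: T_def block_inner_simps ipx cj_inner algebra_simps)
    qed
    have cFD: "of_real (\<alpha> + \<beta>) * cj (F z) = of_real \<alpha> * cj (block_inner i z a) + of_real \<beta> * cj (block_inner j z b)"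
      using arg_cong[OF FD[of z], of cj] by (simp add: cj_mult cj_add)
    have "of_real \<alpha> * block_inner i (T z) (T z) + of_real \<beta> * block_inner j (T z) (T z)
      = of_real \<alpha> * block_inner i z z + of_real \<beta> * block_inner j z z
        - 2 * cj (F z) * (of_real \<alpha> * block_inner i z a + of_real \<beta> * block_inner j z b)
        - 2 * F z * (of_real \<alpha> * cj (block_inner i z a) + of_real \<beta> * cj (block_inner j z b))
        + 4 * F z * cj (F z) * of_real (\<alpha> + \<beta>)"
      unfolding i j by (simp add: cj_mult algebra_simps)
    also have "\<dots> = of_real \<alpha> * block_inner i z z + of_real \<beta> * block_inner j z z"
      unfolding FD[symmetric] cFD[symmetric] by (simp add: algebra_simps)
    finally have "of_real (\<alpha> * (block_norm i (T z))\<^sup>2 + \<beta> * (block_norm j (T z))\<^sup>2)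
        = (of_real (\<alpha> * (block_norm i z)\<^sup>2 + \<beta> * (block_norm j z)\<^sup>2) :: 'a)"
      by (simp add: block_inner_self)
    then show ?thesis by (simp only: of_real_eq_iff)
  qed
  \<comment> \<open>Splitting off block \<open>i\<close> leaves a remainder that \<open>T\<close>
    does not touch; \<open>key\<close> accounts for the two blocks that change.\<close>
  have nuC: "(nu (part C z))\<^sup>2 = \<alpha> * (block_norm i z)\<^sup>2 + \<alpha> * (\<Sum>k\<in>C - {i}. weight i k * (block_norm k z)\<^sup>2)" if z: "z \<in> Z" for z
  proof -
    have C: "insert i (C - {i}) = C" using iC by auto
    have pw: "0 \<le> weight i k * (block_norm k (part C z))\<^sup>2" if "k \<in> C" for k
      using that weight(1)[of i k] by (simp add: C_def cluster_def)
    have "nu (part C z) = sqrt (\<Sum>k\<in>C. weight i k * (block_norm k (part C z))\<^sup>2) * nu a"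
    proof (rule nu_component[of "C - {i}" i "part C z" a, unfolded C])
      show "finite (C - {i})" "\<forall>k\<in>C - {i}. linked i k" using finite_cluster by (auto simp: C_def cluster_def)
    qed (use z a in \<open>simp_all add: Z_part\<close>)
    then have "(nu (part C z))\<^sup>2 = (\<Sum>k\<in>C. weight i k * (block_norm k (part C z))\<^sup>2) * \<alpha>"
      using pw by (simp add: power_mult_distrib \<alpha>_def sum_nonneg)
    also have "(\<Sum>k\<in>C. weight i k * (block_norm k (part C z))\<^sup>2) = (\<Sum>k\<in>C. weight i k * (block_norm k z)\<^sup>2)"
      by (intro sum.cong) (auto simp: block_norm_part)
    also have "\<dots> = weight i i * (block_norm i z)\<^sup>2 + (\<Sum>k\<in>C - {i}. weight i k * (block_norm k z)\<^sup>2)"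
      using iC finite_cluster[of i] by (intro sum.remove) (auto simp: C_def)
    finally show ?thesis by (simp add: weight_def algebra_simps)
  qed
  have nuD: "(nu (part D z))\<^sup>2 = \<beta> * (block_norm j z)\<^sup>2 + \<beta> * (\<Sum>k\<in>D - {j}. weight j k * (block_norm k z)\<^sup>2)" if z: "z \<in> Z" for z
  proof -
    have D: "insert j (D - {j}) = D" using iC by auto
    have pw: "0 \<le> weight j k * (block_norm k (part D z))\<^sup>2" if "k \<in> D" for k
      using that weight(1)[of j k] by (simp add: D_def cluster_def)
    have "nu (part D z) = sqrt (\<Sum>k\<in>D. weight j k * (block_norm k (part D z))\<^sup>2) * nu b"
    proof (rule nu_component[of "D - {j}" j "part D z" b, unfolded D])
      show "finite (D - {j})" "\<forall>k\<in>D - {j}. linked j k" using finite_cluster by (auto simp: D_def cluster_def)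
    qed (use z b in \<open>simp_all add: Z_part\<close>)
    then have "(nu (part D z))\<^sup>2 = (\<Sum>k\<in>D. weight j k * (block_norm k (part D z))\<^sup>2) * \<beta>"
      using pw by (simp add: power_mult_distrib \<beta>_def sum_nonneg)
    also have "(\<Sum>k\<in>D. weight j k * (block_norm k (part D z))\<^sup>2) = (\<Sum>k\<in>D. weight j k * (block_norm k z)\<^sup>2)"
      by (intro sum.cong) (auto simp: block_norm_part)
    also have "\<dots> = weight j j * (block_norm j z)\<^sup>2 + (\<Sum>k\<in>D - {j}. weight j k * (block_norm k z)\<^sup>2)"
      using iC finite_cluster[of j] by (intro sum.remove) (auto simp: D_def)
    finally show ?thesis by (simp add: weight_def algebra_simps)
  qed
  have "T \<in> isoZ nu'"
  proof (rule isoZ_involI[OF linT, where T' = T])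
    fix z assume z: "z \<in> Z"
    show Tz: "T z \<in> Z" using linZD(1)[OF linT z] .
    show "T (T z) = z" using TT[OF z] .
    have bk: "block_norm k (T z) = block_norm k z" if "k \<noteq> i" "k \<noteq> j" for k
    proof -
      have "part {k} x = 0" using off[of "{k}"] off'[of "{k}"] that by (simp add: x_def part_add)
      then have "part {k} (T z) = part {k} z" by (simp add: T_def part_diff part_vscale)
      then show ?thesis using block_norm_part[of k "{k}" "T z"] block_norm_part[of k "{k}" z] by simp
    qed
    have "(\<Sum>k\<in>C - {i}. weight i k * (block_norm k (T z))\<^sup>2) = (\<Sum>k\<in>C - {i}. weight i k * (block_norm k z)\<^sup>2)"
      using bk ij by (intro sum.cong refl) (metis DiffE singletonI)
    moreover have "(\<Sum>k\<in>D - {j}. weight j k * (block_norm k (T z))\<^sup>2) = (\<Sum>k\<in>D - {j}. weight j k * (block_norm k z)\<^sup>2)"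
      using bk ij by (intro sum.cong refl) (metis DiffE singletonI)
    ultimately have "(nu (part C (T z)))\<^sup>2 + (nu (part D (T z)))\<^sup>2 = (nu (part C z))\<^sup>2 + (nu (part D z))\<^sup>2"
      using key[of z] unfolding nuC[OF z] nuD[OF z] nuC[OF Tz] nuD[OF Tz] by simp
    moreover have "part E x = 0" using off[of E] off'[of E] iC by (simp add: x_def part_add E_def)
    then have "part E (T z) = part E z" by (simp add: T_def part_diff part_vscale)
    ultimately show "nu' (T z) = nu' z" by (simp add: nu'_def)
  qed
  moreover have "T \<notin> isoZ nu"
  proof
    assume "T \<in> isoZ nu"
    then have "refl_pair x F" using x linF Fx isoZD(2)[of T nu] by (simp add: refl_pair_def T_def)
    then have "linked i j" using x \<open>a \<noteq> 0\<close> \<open>b \<noteq> 0\<close> unfolding linked_def by metis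
    then show False using j by (simp add: cluster_def)
  qed
  ultimately have strict: "isoZ nu \<subset> isoZ nu'" using sub by blast
  have "0 < lo / 2" "0 < 3 * hi" using lo_pos hi_pos by auto
  from that[OF 1 2 this 3 4 strict] show ?thesis .
qed

end

section \<open>Khinchine's inequality and complemented Hilbert spaces\<close>

lemma sum_Pow_insert:
  assumes "finite A" "a \<notin> A"
  shows "(\<Sum>w\<in>Pow (insert a A). F w) = (\<Sum>w\<in>Pow A. F w + F (insert a w))"
proof -
  have "(\<Sum>w\<in>Pow (insert a A). F w) = (\<Sum>w\<in>Pow A. F w) + (\<Sum>w\<in>insert a ` Pow A. F w)"
    unfolding Pow_insert using assms by (intro sum.union_disjoint) auto
  also have "(\<Sum>w\<in>insert a ` Pow A. F w) = (\<Sum>w\<in>Pow A. F (insert a w))"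
    using assms by (subst sum.reindex) (auto simp: inj_on_def)
  finally show ?thesis by (simp add: sum.distrib)
qed

text \<open>A Gaussian bound for \<open>cosh\<close>, by quadratic estimates up to \<open>1\<close>
  and by \<open>u \<le> u\<^sup>2\<close> beyond. It controls the average over one random
  sign.\<close>

lemma exp_add_exp_minus_le: "exp u + exp (- u) \<le> 2 * exp (u\<^sup>2)" for u :: real
proof -
  have pos: "exp u + exp (- u) \<le> 2 * exp (u\<^sup>2)" if u: "0 \<le> u" for u :: real
  proof (cases "u \<le> 1")
    case True
    have "exp u \<le> 1 + u + u\<^sup>2" using exp_bound[OF u True] .
    moreover have "exp (- u) \<le> 1 - u + u\<^sup>2"
    proof -
      have "exp (- u) \<le> 1 / (1 + u)"
        using exp_ge_add_one_self[of u] u by (simp add: exp_minus divide_simps)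
      also have "\<dots> \<le> 1 - u + u\<^sup>2"
      proof -
        have "(1 - u + u\<^sup>2) * (1 + u) = 1 + u ^ 3" by (simp add: algebra_simps power2_eq_square power3_eq_cube)
        then show ?thesis using u by (simp add: pos_divide_le_eq)
      qed
      finally show ?thesis .
    qed
    moreover have "1 + u\<^sup>2 \<le> exp (u\<^sup>2)" using exp_ge_add_one_self[of "u\<^sup>2"] by simp
    ultimately show ?thesis by linarith
  next
    case False
    then have "u * 1 \<le> u * u" by (intro mult_left_mono) auto
    then have "exp u \<le> exp (u\<^sup>2)" by (simp add: power2_eq_square)
    moreover have "exp (- u) \<le> exp u" using u by simp
    ultimately show ?thesis by linarith
  qed
  show ?thesis using pos[of u] pos[of "- u"] by (cases "0 \<le> u") auto
qed

text \<open>The sign enters only through the cross term \<open>2 * t * inner x y\<close>, which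
  \<open>exp_add_exp_minus_le\<close> and Cauchy-Schwarz bound.\<close>

lemma exp_norm_average_le:
  fixes x y :: "'a::real_inner"
  assumes "0 \<le> t"
  shows "exp (t * (norm (x + y))\<^sup>2) + exp (t * (norm (x - y))\<^sup>2)
    \<le> 2 * exp (t * (norm x)\<^sup>2 + t * (norm y)\<^sup>2 + 4 * t\<^sup>2 * (norm x)\<^sup>2 * (norm y)\<^sup>2)"
proof -
  define r A where "r = inner x y" and "A = (norm x)\<^sup>2 + (norm y)\<^sup>2"
  have p: "(norm (x + y))\<^sup>2 = A + 2 * r" "(norm (x - y))\<^sup>2 = A - 2 * r"
    by (simp_all add: A_def r_def power2_norm_eq_inner inner_add_left inner_add_right
        inner_diff_left inner_diff_right inner_commute)
  have "r\<^sup>2 \<le> (norm x)\<^sup>2 * (norm y)\<^sup>2"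
    using Cauchy_Schwarz_ineq2[of x y] by (metis abs_ge_zero power2_abs power_mono power_mult_distrib r_def)
  then have "(2 * t * r)\<^sup>2 \<le> 4 * t\<^sup>2 * (norm x)\<^sup>2 * (norm y)\<^sup>2"
    by (simp add: power_mult_distrib mult_left_mono mult.assoc)
  then have "exp (t * A) * (2 * exp ((2 * t * r)\<^sup>2))
      \<le> exp (t * A) * (2 * exp (4 * t\<^sup>2 * (norm x)\<^sup>2 * (norm y)\<^sup>2))"
    by (intro mult_left_mono) auto
  moreover have "exp (t * A) * (exp (2 * t * r) + exp (- (2 * t * r)))
      \<le> exp (t * A) * (2 * exp ((2 * t * r)\<^sup>2))"
    by (intro mult_left_mono exp_add_exp_minus_le) auto
  moreover have "exp (t * (norm (x + y))\<^sup>2) + exp (t * (norm (x - y))\<^sup>2)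
      = exp (t * A) * (exp (2 * t * r) + exp (- (2 * t * r)))"
    unfolding p by (simp add: algebra_simps flip: exp_add)
  moreover have "exp (t * A) * (2 * exp (4 * t\<^sup>2 * (norm x)\<^sup>2 * (norm y)\<^sup>2))
     = 2 * exp (t * (norm x)\<^sup>2 + t * (norm y)\<^sup>2 + 4 * t\<^sup>2 * (norm x)\<^sup>2 * (norm y)\<^sup>2)"
    by (simp add: A_def algebra_simps exp_add)
  ultimately show ?thesis by linarith
qed

text \<open>A choice of signs is encoded by the set \<open>w\<close> of the indices with sign
  \<open>- 1\<close>; averages over signs become sums over a power set.\<close>

definition sg :: "nat \<Rightarrow> nat set \<Rightarrow> 'a::real_normed_field"
  where "sg i w = (if i \<in> w then - 1 else 1)"

definition rad :: "nat \<Rightarrow> (nat \<Rightarrow> 'a::real_normed_field) \<Rightarrow> nat set \<Rightarrow> 'a"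
  where "rad m y w = (\<Sum>i<m. sg i w * y i)"

lemma sum_sign_sets: "(\<Sum>w\<in>Pow {..<Suc m}. F w) = (\<Sum>w\<in>Pow {..<m}. F w + F (insert m w))"
  by (simp only: lessThan_Suc) (rule sum_Pow_insert; simp)

lemma rad_Suc:
  assumes "w \<subseteq> {..<m}"
  shows "rad (Suc m) y w = rad m y w + y m" "rad (Suc m) y (insert m w) = rad m y w - y m"
proof -
  have "m \<notin> w" using assms by auto
  then show "rad (Suc m) y w = rad m y w + y m" by (simp add: rad_def sg_def)
  have "(\<Sum>i<m. sg i (insert m w) * y i) = (\<Sum>i<m. sg i w * y i)"
    by (intro sum.cong) (auto simp: sg_def)
  then show "rad (Suc m) y (insert m w) = rad m y w - y m" by (simp add: rad_def sg_def)
qed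

text \<open>One sign is averaged at a time, for which \<open>x\<close> has to be arbitrary. The
  denominator drops by \<open>4 * t * (norm (y m))\<^sup>2\<close> at each step, and this pays for
  the cross term.\<close>

lemma rademacher_exp_moment:
  fixes y :: "nat \<Rightarrow> 'a::{real_normed_field,real_inner}"
  assumes "0 \<le> t" "4 * t * (\<Sum>i<m. (norm (y i))\<^sup>2) < 1"
  shows "(\<Sum>w\<in>Pow {..<m}. exp (t * (norm (x + rad m y w))\<^sup>2))
    \<le> 2 ^ m * exp (t * ((norm x)\<^sup>2 + (\<Sum>i<m. (norm (y i))\<^sup>2)) / (1 - 4 * t * (\<Sum>i<m. (norm (y i))\<^sup>2)))"
  using assms
proof (induction m arbitrary: x)
  case 0
  then show ?case by (simp add: rad_def)
next
  case (Suc m)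
  define s r where "s = (\<Sum>i<m. (norm (y i))\<^sup>2)" and "r = (norm (y m))\<^sup>2"
  have nn: "0 \<le> s" "0 \<le> r" by (auto simp: s_def r_def sum_nonneg)
  have sr: "(\<Sum>i<Suc m. (norm (y i))\<^sup>2) = s + r" by (simp add: s_def r_def)
  define d where "d = 1 - 4 * t * s"
  have d': "0 < d - 4 * t * r" using Suc.prems unfolding sr d_def by (simp add: algebra_simps)
  have tr: "0 \<le> 4 * t * r" using Suc.prems nn by simp
  have d: "0 < d" using d' tr by linarith
  define T where "T = t / d"
  have T: "0 \<le> T" using Suc.prems d by (simp add: T_def)
  have IH: "(\<Sum>w\<in>Pow {..<m}. exp (t * (norm (z + rad m y w))\<^sup>2))
    \<le> 2 ^ m * exp (T * ((norm z)\<^sup>2 + s))" for z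
    using Suc.IH[of z] Suc.prems d by (simp add: s_def d_def T_def)
  have "(\<Sum>w\<in>Pow {..<Suc m}. exp (t * (norm (x + rad (Suc m) y w))\<^sup>2))
      = (\<Sum>w\<in>Pow {..<m}. exp (t * (norm ((x + y m) + rad m y w))\<^sup>2))
      + (\<Sum>w\<in>Pow {..<m}. exp (t * (norm ((x - y m) + rad m y w))\<^sup>2))"
    unfolding sum_sign_sets sum.distrib[symmetric]
    by (intro sum.cong refl) (simp add: rad_Suc algebra_simps)
  also have "\<dots> \<le> 2 ^ m * exp (T * ((norm (x + y m))\<^sup>2 + s)) + 2 ^ m * exp (T * ((norm (x - y m))\<^sup>2 + s))"
    by (intro add_mono IH)
  also have "\<dots> = 2 ^ m * exp (T * s) * (exp (T * (norm (x + y m))\<^sup>2) + exp (T * (norm (x - y m))\<^sup>2))"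
    by (simp add: algebra_simps exp_add)
  also have "\<dots> \<le> 2 ^ m * exp (T * s) * (2 * exp (T * (norm x)\<^sup>2 + T * r + 4 * T\<^sup>2 * (norm x)\<^sup>2 * r))"
    unfolding r_def by (intro mult_left_mono exp_norm_average_le T) auto
  also have "\<dots> = 2 ^ Suc m * exp (T * s + T * r + T * (1 + 4 * T * r) * (norm x)\<^sup>2)"
    by (simp add: algebra_simps exp_add power2_eq_square)
  also have "\<dots> \<le> 2 ^ Suc m * exp (t * ((norm x)\<^sup>2 + (s + r)) / (1 - 4 * t * (s + r)))"
  proof -
    define T' where "T' = t / (d - 4 * t * r)"
    have le1: "T \<le> T'" unfolding T_def T'_def 
      by (rule divide_left_mono[OF _ _ mult_pos_pos[OF d d']]) (use tr Suc.prems in auto)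
    have le2: "T * (1 + 4 * T * r) \<le> T'"
    proof -
      have "1 + 4 * T * r = (d + 4 * t * r) / d" using d by (simp add: T_def field_simps)
      moreover have "(d + 4 * t * r) / d \<le> d / (d - 4 * t * r)"
      proof -
        have "(d + 4 * t * r) * (d - 4 * t * r) = d * d - (4 * t * r) * (4 * t * r)"
          by (simp add: algebra_simps)
        also have "\<dots> \<le> d * d" using zero_le_square[of "4 * t * r"] by linarith
        finally show ?thesis using d d' by (simp add: divide_simps)
      qed
      ultimately have "1 + 4 * T * r \<le> d / (d - 4 * t * r)" by linarith
      then have "T * (1 + 4 * T * r) \<le> T * (d / (d - 4 * t * r))"
        using T by (rule mult_left_mono)
      also have "\<dots> = T'" using d by (simp add: T_def T'_def)
      finally show ?thesis .
    qed
    have "T * s + T * r + T * (1 + 4 * T * r) * (norm x)\<^sup>2 \<le> T' * s + T' * r + T' * (norm x)\<^sup>2"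
      using le1 le2 nn by (intro add_mono mult_right_mono) auto
    also have "\<dots> = t * ((norm x)\<^sup>2 + (s + r)) / (1 - 4 * t * (s + r))"
      by (simp add: T'_def d_def algebra_simps add_divide_distrib)
    finally show ?thesis by simp
  qed
  finally show ?case unfolding sr .
qed

text \<open>In \<open>khintchine_upper\<close> the power arises from \<open>x \<le> exp x\<close>
  with \<open>t = 1 / (8 * s)\<close>, and the factor \<open>2\<close> bounds
  \<open>exp (1 / 4)\<close>.\<close>

definition khin :: "real \<Rightarrow> real"
  where "khin q = 2 * (4 * q) powr (q / 2)"

text \<open>The \<open>q\<close>-th power is dominated by a multiple of an exponential of the
  square, whose average is under control. Applied at \<open>p\<close> to the embedding and, by
  duality, at the conjugate exponent to the projection.\<close>

lemma khintchine_upper: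
  fixes y :: "nat \<Rightarrow> 'a::{real_normed_field,real_inner}"
  assumes q: "0 < q"
  shows "(\<Sum>w\<in>Pow {..<m}. norm (rad m y w) powr q)
    \<le> 2 ^ m * khin q * (L2_set (\<lambda>i. norm (y i)) {..<m}) powr q"
proof -
  define s where "s = (\<Sum>i<m. (norm (y i))\<^sup>2)"
  have s0: "0 \<le> s" by (simp add: s_def sum_nonneg)
  show ?thesis
  proof (cases "s = 0")
    case True
    then have "y i = 0" if "i < m" for i
      using that by (simp add: s_def sum_nonneg_eq_0_iff)
    then have "rad m y w = 0" for w by (simp add: rad_def)
    then show ?thesis by (simp add: khin_def)
  next
    case False
    then have s: "0 < s" using s0 by simp
    \<comment> \<open>Makes the denominator \<open>1 - 4 * t * s\<close> of the moment bound equal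
      to \<open>1 / 2\<close>.\<close>
    define t where "t = 1 / (8 * s)"
    have t: "0 < t" "4 * t * s = 1 / 2" using s by (auto simp: t_def)
    have "(\<Sum>w\<in>Pow {..<m}. exp (t * (norm (rad m y w))\<^sup>2)) \<le> 2 ^ m * exp (t * s * 2)"
      using rademacher_exp_moment[where t = t and m = m and y = y and x = 0] t by (simp add: s_def[symmetric])
    also have "t * s * 2 = 1 / 4" using t by simp
    also have "exp (1 / 4 :: real) \<le> 2"
    proof -
      have "exp (1 / 4 :: real) \<le> 1 + 1 / 4 + (1 / 4)\<^sup>2" by (rule exp_bound) auto
      then show ?thesis by (simp add: power2_eq_square)
    qed
    finally have sum: "(\<Sum>w\<in>Pow {..<m}. exp (t * (norm (rad m y w))\<^sup>2)) \<le> 2 ^ m * 2" by simp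
    have le: "norm (rad m y w) powr q \<le> (4 * q * s) powr (q / 2) * exp (t * (norm (rad m y w))\<^sup>2)" for w
    proof (cases "rad m y w = 0")
      case False
      define u where "u = t * (norm (rad m y w))\<^sup>2"
      have u: "0 < u" using False t by (simp add: u_def)
      have "u / (q / 2) \<le> exp (u / (q / 2))" using exp_ge_add_one_self[of "u / (q / 2)"] by linarith
      then have "(u / (q / 2)) powr (q / 2) \<le> exp (u / (q / 2)) powr (q / 2)"
        using u q by (intro powr_mono2) auto
      also have "\<dots> = exp u" using q by (simp add: powr_def)
      finally have le0: "(u / (q / 2)) powr (q / 2) \<le> exp u" .
      have "u powr (q / 2) = ((q / 2) * (u / (q / 2))) powr (q / 2)" using q by simp
      also have "\<dots> = (q / 2) powr (q / 2) * (u / (q / 2)) powr (q / 2)"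
        using u q by (intro powr_mult)
      finally have le: "u powr (q / 2) \<le> (q / 2) powr (q / 2) * exp u"
        using le0 by (simp add: mult_left_mono)
      have "(norm (rad m y w))\<^sup>2 = 8 * s * u" using s by (simp add: u_def t_def)
      then have "norm (rad m y w) powr 2 = 8 * s * u" using False by simp
      moreover have "norm (rad m y w) powr q = (norm (rad m y w) powr 2) powr (q / 2)"
        unfolding powr_powr by simp
      ultimately have "norm (rad m y w) powr q = (8 * s * u) powr (q / 2)" by simp
      also have "\<dots> = (8 * s) powr (q / 2) * u powr (q / 2)" using s u by (simp add: powr_mult)
      also have "\<dots> \<le> (8 * s) powr (q / 2) * ((q / 2) powr (q / 2) * exp u)"
        by (intro mult_left_mono le) auto
      also have "\<dots> = (8 * s * (q / 2)) powr (q / 2) * exp u"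
        unfolding powr_mult[of "8 * s" "q / 2"] by (simp only: mult.assoc)
      also have "8 * s * (q / 2) = 4 * q * s" by simp
      finally show ?thesis unfolding u_def .
    qed simp
    have "(\<Sum>w\<in>Pow {..<m}. norm (rad m y w) powr q)
        \<le> (\<Sum>w\<in>Pow {..<m}. (4 * q * s) powr (q / 2) * exp (t * (norm (rad m y w))\<^sup>2))"
      by (intro sum_mono le)
    also have "\<dots> = (4 * q * s) powr (q / 2) * (\<Sum>w\<in>Pow {..<m}. exp (t * (norm (rad m y w))\<^sup>2))"
      by (simp add: sum_distrib_left)
    also have "\<dots> \<le> (4 * q * s) powr (q / 2) * (2 ^ m * 2)"
      by (intro mult_left_mono sum) auto
    also have "\<dots> = 2 ^ m * khin q * s powr (q / 2)" using s q by (simp add: khin_def powr_mult)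
    also have "s powr (q / 2) = (L2_set (\<lambda>i. norm (y i)) {..<m}) powr q"
      using s by (simp add: L2_set_def s_def[symmetric] powr_half_sqrt[symmetric] powr_powr)
    finally show ?thesis .
  qed
qed

lemma holder_finite:
  fixes a b :: "'b \<Rightarrow> real"
  assumes pq: "1 < p" "1 < q" "1 / p + 1 / q = 1" and A: "finite A"
    and nn: "\<And>x. x \<in> A \<Longrightarrow> 0 \<le> a x" "\<And>x. x \<in> A \<Longrightarrow> 0 \<le> b x"
  shows "(\<Sum>x\<in>A. a x * b x) \<le> (\<Sum>x\<in>A. a x powr p) powr (1 / p) * (\<Sum>x\<in>A. b x powr q) powr (1 / q)"
proof -
  define X Y where "X = (\<Sum>x\<in>A. a x powr p)" and "Y = (\<Sum>x\<in>A. b x powr q)"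
  have XY: "0 \<le> X" "0 \<le> Y" by (auto simp: X_def Y_def sum_nonneg)
  show ?thesis
  proof (cases "X = 0 \<or> Y = 0")
    case True
    then have "a x * b x = 0" if "x \<in> A" for x
      using that A by (auto simp: X_def Y_def sum_nonneg_eq_0_iff)
    then have "(\<Sum>x\<in>A. a x * b x) = 0" by (intro sum.neutral) blast
    then show ?thesis by simp
  next
    case False
    then have pos: "0 < X" "0 < Y" using XY by auto
    define c d where "c = X powr (1 / p)" and "d = Y powr (1 / q)"
    have cd: "0 < c" "0 < d" "c powr p = X" "d powr q = Y"
      using pos pq by (auto simp: c_def d_def powr_powr)
    have "(\<Sum>x\<in>A. a x / c * (b x / d)) \<le> (\<Sum>x\<in>A. (a x / c) powr p / p + (b x / d) powr q / q)"
      using cd nn pq by (intro sum_mono Youngs_inequality) auto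
    also have "\<dots> = (\<Sum>x\<in>A. a x powr p / X / p) + (\<Sum>x\<in>A. b x powr q / Y / q)"
      using cd nn by (simp add: sum.distrib powr_divide)
    also have "\<dots> = 1 / p + 1 / q"
      using pos by (simp add: X_def Y_def flip: sum_divide_distrib)
    finally have "(\<Sum>x\<in>A. a x * b x) / (c * d) \<le> 1"
      using pq by (simp add: sum_divide_distrib)
    then show ?thesis using cd by (simp add: c_def d_def X_def Y_def divide_le_eq)
  qed
qed

section \<open>Rademacher copies of Hilbert spaces on cubes and the projections onto them\<close>

lemma sum_sg_sg:
  assumes "i < m" "j < m"
  shows "(\<Sum>w\<in>Pow {..<m}. sg i w * sg j w) = (if i = j then 2 ^ m else 0 :: 'a::real_normed_field)"
proof (cases "i = j")
  case True
  then have "sg i w * sg j w = (1 :: 'a)" for w by (simp add: sg_def)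
  then show ?thesis using True by (simp add: card_Pow)
next
  case False
  define A where "A = {..<m} - {i}"
  have A: "{..<m} = insert i A" "i \<notin> A" "finite A" using assms by (auto simp: A_def)
  have "(\<Sum>w\<in>Pow (insert i A). sg i w * sg j w) = (0 :: 'a)"
    unfolding sum_Pow_insert[OF A(3,2)] using A False
    by (intro sum.neutral) (auto simp: sg_def)
  then show ?thesis using False A by simp
qed

text \<open>The factor turns the sum of \<open>p\<close>-th powers over the \<open>2 ^ m\<close>
  sign choices into an average, so that the bounds do not depend on \<open>m\<close>.\<close>

definition emb :: "real \<Rightarrow> nat \<Rightarrow> (nat \<Rightarrow> 'a::real_normed_field) \<Rightarrow> nat set \<Rightarrow> 'a"
  where "emb p m z w = of_real (2 powr (- real m / p)) * rad m z w"

text \<open>Rademacher coefficients: the average of \<open>x\<close> against each sign, with the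
  factor of \<open>emb\<close> undone.\<close>

definition prj :: "real \<Rightarrow> nat \<Rightarrow> (nat set \<Rightarrow> 'a::real_normed_field) \<Rightarrow> nat \<Rightarrow> 'a"
  where "prj p m x i = of_real (2 powr (real m / p - real m)) * (\<Sum>w\<in>Pow {..<m}. sg i w * x w)"

lemma rad_linear: "rad m (\<lambda>i. x i + y i) w = rad m x w + rad m y w"
    "rad m (\<lambda>i. x i - y i) w = rad m x w - rad m y w"
    "rad m (\<lambda>i. c * y i) w = c * rad m y w"
  by (simp_all add: rad_def distrib_left right_diff_distrib sum.distrib sum_subtractf
      mult.left_commute[of _ c] flip: sum_distrib_left)

lemma emb_linear: "emb p m (\<lambda>i. x i + y i) w = emb p m x w + emb p m y w"
    "emb p m (\<lambda>i. x i - y i) w = emb p m x w - emb p m y w"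
    "emb p m (\<lambda>i. c * y i) w = c * emb p m y w"
  by (simp_all add: emb_def rad_linear algebra_simps)

lemma prj_linear: "prj p m (\<lambda>w. x w + y w) i = prj p m x i + prj p m y i"
    "prj p m (\<lambda>w. x w - y w) i = prj p m x i - prj p m y i"
    "prj p m (\<lambda>w. c * y w) i = c * prj p m y i"
  by (simp_all add: prj_def distrib_left right_diff_distrib sum.distrib sum_subtractf
      mult.left_commute[of _ c] flip: sum_distrib_left)

lemma emb_cong: "(\<And>i. i < m \<Longrightarrow> x i = y i) \<Longrightarrow> emb p m x w = emb p m y w"
  by (simp add: emb_def rad_def)

lemma prj_cong: "(\<And>w. w \<subseteq> {..<m} \<Longrightarrow> x w = y w) \<Longrightarrow> prj p m x i = prj p m y i"
  by (simp add: prj_def)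

lemma prj_emb:
  assumes "i < m"
  shows "prj p m (emb p m z) i = z i"
proof -
  have "(\<Sum>w\<in>Pow {..<m}. sg i w * rad m z w) = (\<Sum>j<m. (\<Sum>w\<in>Pow {..<m}. sg i w * sg j w) * z j)"
    unfolding rad_def sum_distrib_left sum_distrib_right by (subst sum.swap) (simp add: mult.assoc)
  also have "\<dots> = (\<Sum>j<m. if i = j then 2 ^ m * z j else 0)"
    using assms by (intro sum.cong refl) (simp add: sum_sg_sg)
  also have "\<dots> = 2 ^ m * z i" using assms by (simp add: sum.delta)
  finally have *: "(\<Sum>w\<in>Pow {..<m}. sg i w * rad m z w) = 2 ^ m * z i" .
  have "(2::real) powr (real m / p - real m) * 2 powr (- real m / p) * 2 ^ m
      = 2 powr (real m / p - real m) * 2 powr (- real m / p) * 2 powr real m"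
    by (simp add: powr_realpow)
  also have "\<dots> = 1" by (simp flip: powr_add)
  finally have one: "(2::real) powr (real m / p - real m) * 2 powr (- real m / p) * 2 ^ m = 1" .
  have "prj p m (emb p m z) i = of_real (2 powr (real m / p - real m)) * of_real (2 powr (- real m / p)) * (2 ^ m * z i)"
    unfolding prj_def emb_def *[symmetric] by (simp add: sum_distrib_left mult_ac)
  also have "\<dots> = of_real ((2::real) powr (real m / p - real m) * 2 powr (- real m / p) * 2 ^ m) * z i"
    by simp
  finally show ?thesis unfolding one by simp
qed

lemma emb_bound:
  fixes z :: "nat \<Rightarrow> 'a::{real_normed_field,real_inner}"
  assumes "0 < p"
  shows "(\<Sum>w\<in>Pow {..<m}. norm (emb p m z w) powr p) \<le> khin p * (L2_set (\<lambda>i. norm (z i)) {..<m}) powr p"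
proof -
  have c: "(2 powr (- real m / p)) powr p * 2 ^ m = 1"
  proof -
    have "(2 powr (- real m / p)) powr p = 2 powr (- real m)"
      using assms by (simp only: powr_powr) simp
    then show ?thesis by (simp add: powr_minus powr_realpow)
  qed
  have "(\<Sum>w\<in>Pow {..<m}. norm (emb p m z w) powr p)
      = (2 powr (- real m / p)) powr p * (\<Sum>w\<in>Pow {..<m}. norm (rad m z w) powr p)"
    by (simp add: emb_def norm_mult powr_mult sum_distrib_left)
  also have "\<dots> \<le> (2 powr (- real m / p)) powr p * (2 ^ m * khin p * (L2_set (\<lambda>i. norm (z i)) {..<m}) powr p)"
    using khintchine_upper[OF assms] by (intro mult_left_mono) auto
  also have "\<dots> = ((2 powr (- real m / p)) powr p * 2 ^ m) * (khin p * (L2_set (\<lambda>i. norm (z i)) {..<m}) powr p)"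
    by (simp only: mult_ac)
  finally show ?thesis unfolding c by simp
qed

text \<open>Duality: the squared length of the coefficient vector is a pairing of \<open>x\<close>
  with the Rademacher sum of the conjugated coefficients. Hoelder and Khinchine at the conjugate
  exponent bound it by the norm of \<open>x\<close> times one factor \<open>L\<close>, which
  cancels.\<close>

lemma (in conj_field) prj_bound:
  fixes x :: "nat set \<Rightarrow> 'a"
  assumes p: "1 < p"
  shows "L2_set (\<lambda>i. norm (prj p m x i)) {..<m} powr p
    \<le> khin (p / (p - 1)) powr (p - 1) * (\<Sum>w\<in>Pow {..<m}. norm (x w) powr p)"
proof -
  define q where "q = p / (p - 1)"
  have q: "1 < q" "1 / p + 1 / q = 1" using p by (auto simp: q_def field_simps)
  define b where "b = prj p m x"
  define L where "L = L2_set (\<lambda>i. norm (b i)) {..<m}"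
  define X where "X = (\<Sum>w\<in>Pow {..<m}. norm (x w) powr p)"
  have X: "0 \<le> X" by (simp add: X_def sum_nonneg)
  have L0: "0 \<le> L" by (simp add: L_def)
  define c :: real where "c = 2 powr (real m / p - real m)"
  have "of_real (L\<^sup>2) = (\<Sum>i<m. b i * cj (b i))"
    by (simp add: L_def L2_set_def sum_nonneg mult_cj)
  also have "\<dots> = (\<Sum>i<m. of_real c * (\<Sum>w\<in>Pow {..<m}. sg i w * x w) * cj (b i))"
    by (simp add: b_def prj_def c_def)
  also have "\<dots> = of_real c * (\<Sum>w\<in>Pow {..<m}. x w * rad m (\<lambda>i. cj (b i)) w)"
    unfolding rad_def sum_distrib_left sum_distrib_right by (subst sum.swap) (simp add: mult_ac)
  finally have "L\<^sup>2 = norm (of_real c * (\<Sum>w\<in>Pow {..<m}. x w * rad m (\<lambda>i. cj (b i)) w))"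
    by (metis abs_of_nonneg norm_of_real zero_le_power2)
  also have "\<dots> \<le> c * (\<Sum>w\<in>Pow {..<m}. norm (x w) * norm (rad m (\<lambda>i. cj (b i)) w))"
    unfolding norm_mult by (intro mult_mono sum_norm_le) (auto simp: c_def norm_mult sum_nonneg)
  also have "\<dots> \<le> c * (X powr (1 / p) * (\<Sum>w\<in>Pow {..<m}. norm (rad m (\<lambda>i. cj (b i)) w) powr q) powr (1 / q))"
    unfolding X_def using p q by (intro mult_left_mono holder_finite) (auto simp: c_def)
  also have "\<dots> \<le> c * (X powr (1 / p) * (2 ^ m * khin q * L powr q) powr (1 / q))"
  proof -
    have "(\<Sum>w\<in>Pow {..<m}. norm (rad m (\<lambda>i. cj (b i)) w) powr q) \<le> 2 ^ m * khin q * L powr q"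
      using khintchine_upper[of q m "\<lambda>i. cj (b i)"] q by (simp add: L_def)
    then show ?thesis using q by (intro mult_left_mono powr_mono2) (auto simp: c_def sum_nonneg)
  qed
  also have "\<dots> = (c * 2 powr (real m / q)) * (khin q powr (1 / q) * X powr (1 / p)) * L"
    using q L0 by (simp add: powr_mult powr_powr khin_def flip: powr_realpow)
  also have "c * 2 powr (real m / q) = 1"
  proof -
    have "real m / p - real m + real m / q = real m * (1 / p + 1 / q) - real m" by (simp add: algebra_simps)
    then have "real m / p - real m + real m / q = 0" unfolding q by simp
    then show ?thesis unfolding c_def powr_add[symmetric] by simp
  qed
  finally have "L * L \<le> (khin q powr (1 / q) * X powr (1 / p)) * L" by (simp add: power2_eq_square)
  then have "L \<le> khin q powr (1 / q) * X powr (1 / p)"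
    using L0 by (cases "L = 0") (auto simp: mult_le_cancel_right)
  then have "L powr p \<le> (khin q powr (1 / q) * X powr (1 / p)) powr p"
    using L0 p by (intro powr_mono2) auto
  also have "\<dots> = khin q powr (p - 1) * X"
  proof -
    have "1 / q * p = p - 1" using p by (simp add: q_def)
    then show ?thesis using p X by (simp add: powr_mult powr_powr)
  qed
  finally show ?thesis by (simp add: L_def b_def X_def q_def)
qed

section \<open>The sequence space as a sum of Hilbert blocks\<close>

text \<open>Sums in \<open>ennreal\<close> are integrals over counting measures, so an enumeration
  of the triples and Tonelli's theorem rearrange them without any question of summability.\<close>

lemma suminf_triple_bij:
  fixes h :: "nat \<times> nat \<times> nat set \<Rightarrow> real" and m :: "nat \<Rightarrow> nat"
  defines "indices \<equiv> SIGMA k:UNIV. SIGMA l:UNIV. Pow {..<m k}"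
  assumes h: "\<And>d. 0 \<le> h d"
  shows "(\<Sum>j. ennreal (h (from_nat_into indices j))) = (\<Sum>k. \<Sum>l. ennreal (\<Sum>w\<in>Pow {..<m k}. h (k, l, w)))"
proof -
  have cD: "countable indices" unfolding indices_def by (intro countable_SIGMA) (auto intro: countable_finite)
  have "range (\<lambda>k. (k, 0, {})) \<subseteq> indices" by (auto simp: indices_def)
  moreover have "infinite (range (\<lambda>k::nat. (k, 0::nat, {} :: nat set)))"
    by (intro range_inj_infinite) (auto simp: inj_on_def)
  ultimately have iD: "infinite indices" using finite_subset by blast
  have "(\<Sum>j. ennreal (h (from_nat_into indices j))) = (\<integral>\<^sup>+j. ennreal (h (from_nat_into indices j)) \<partial>count_space UNIV)"
    by (rule nn_integral_count_space_nat[symmetric])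
  also have "\<dots> = (\<integral>\<^sup>+d. ennreal (h d) \<partial>count_space indices)"
    by (rule nn_integral_bij_count_space[OF bij_betw_from_nat_into[OF cD iD]])
  also have "\<dots> = (\<integral>\<^sup>+d. ennreal (h d) * indicator indices d \<partial>count_space UNIV)"
    by (rule nn_integral_count_space_indicator) simp
  also have "\<dots> = (\<integral>\<^sup>+k. \<integral>\<^sup>+lw. ennreal (h (k, lw)) * indicator indices (k, lw) \<partial>count_space UNIV \<partial>count_space UNIV)"
    by (rule nn_integral_fst_count_space[symmetric])
  also have "\<dots> = (\<integral>\<^sup>+k. \<integral>\<^sup>+l. \<integral>\<^sup>+w. ennreal (h (k, l, w)) * indicator indices (k, l, w)
      \<partial>count_space UNIV \<partial>count_space UNIV \<partial>count_space UNIV)"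
    by (subst nn_integral_fst_count_space[symmetric]) simp
  also have "\<dots> = (\<integral>\<^sup>+k. \<integral>\<^sup>+l. ennreal (\<Sum>w\<in>Pow {..<m k}. h (k, l, w)) \<partial>count_space UNIV \<partial>count_space UNIV)"
  proof (intro nn_integral_cong)
    fix k l :: nat
    have "(\<integral>\<^sup>+w. ennreal (h (k, l, w)) * indicator indices (k, l, w) \<partial>count_space UNIV)
        = (\<Sum>w\<in>Pow {..<m k}. ennreal (h (k, l, w)) * indicator indices (k, l, w))"
      by (intro nn_integral_count_space') (auto simp: indices_def)
    also have "\<dots> = (\<Sum>w\<in>Pow {..<m k}. ennreal (h (k, l, w)))"
      by (intro sum.cong) (auto simp: indices_def)
    finally show "(\<integral>\<^sup>+w. ennreal (h (k, l, w)) * indicator indices (k, l, w) \<partial>count_space UNIV)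
        = ennreal (\<Sum>w\<in>Pow {..<m k}. h (k, l, w))" using h by (simp add: sum_ennreal)
  qed
  finally show ?thesis by (simp add: nn_integral_count_space_nat)
qed

lemma suminf_ennreal_Suc_le: "(\<Sum>l. f (Suc l)) \<le> (\<Sum>l. f l :: ennreal)"
  using suminf_offset[of f 1] by (simp add: summableI)

lemma suminf_ennreal_head: "(\<Sum>l. f l :: ennreal) = f 0 + (\<Sum>l. f (Suc l))"
  using suminf_offset[of f 1] by (simp add: summableI add.commute)

locale block_embedding = blocks +
  assumes n_pos: "0 < n k"
begin

definition tail_dim :: "nat \<Rightarrow> nat"
  where "tail_dim k = n k - 1"

text \<open>For each block \<open>k\<close> infinitely many copies, numbered by \<open>l\<close>, of
  the cube of sign choices; the shift in \<open>l\<close> needs this room.\<close>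

definition indices :: "(nat \<times> nat \<times> nat set) set"
  where "indices = (SIGMA k:UNIV. SIGMA l:UNIV. Pow {..<tail_dim k})"

definition cube_sum :: "nat \<Rightarrow> (nat set \<Rightarrow> 'a) \<Rightarrow> real"
  where "cube_sum k f = (\<Sum>w\<in>Pow {..<tail_dim k}. norm (f w) powr p)"

definition cube_proj :: "nat \<Rightarrow> (nat set \<Rightarrow> 'a) \<Rightarrow> nat set \<Rightarrow> 'a"
  where "cube_proj k f = emb p (tail_dim k) (prj p (tail_dim k) f)"

definition heads :: "(nat \<Rightarrow> nat \<Rightarrow> 'a) \<Rightarrow> nat \<Rightarrow> nat \<Rightarrow> nat set \<Rightarrow> 'a"
  where "heads z k l w = z (to_nat_on indices (k, l, w)) 0"

definition tail :: "(nat \<Rightarrow> nat \<Rightarrow> 'a) \<Rightarrow> nat \<Rightarrow> nat \<Rightarrow> 'a"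
  where "tail z k i = z k (Suc i)"

definition slices :: "(nat \<Rightarrow> 'a) \<Rightarrow> nat \<Rightarrow> nat \<Rightarrow> nat set \<Rightarrow> 'a"
  where "slices x k l w = x (to_nat_on indices (k, l, w))"

text \<open>
  The coordinates \<open>0\<close> of all blocks form one sequence in \<open>l\<^sub>p\<close>, re-indexed by \<open>indices\<close> as \<open>heads\<close>. With the
  projection \<open>cube_proj k\<close> onto a Rademacher copy of the tails of block \<open>k\<close>, the map \<open>Phi\<close> is
  Pelczynski's decomposition made explicit: the tail enters at \<open>l = 0\<close>, and the projected part of
  \<open>heads z k l\<close> is shifted from \<open>l\<close> to \<open>Suc l\<close>.
\<close>

definition Phi_coord :: "(nat \<Rightarrow> nat \<Rightarrow> 'a) \<Rightarrow> nat \<Rightarrow> nat \<Rightarrow> nat set \<Rightarrow> 'a"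
  where "Phi_coord z k l w = (case l of 0 \<Rightarrow> emb p (tail_dim k) (tail z k) w | Suc l' \<Rightarrow> cube_proj k (heads z k l') w)
    + (heads z k l w - cube_proj k (heads z k l) w)"

definition Phi :: "(nat \<Rightarrow> nat \<Rightarrow> 'a) \<Rightarrow> nat \<Rightarrow> 'a"
  where "Phi z j = (case from_nat_into indices j of (k, l, w) \<Rightarrow> Phi_coord z k l w)"

text \<open>The inverse shift: projected parts move from \<open>Suc l\<close> back to
  \<open>l\<close>, and the one at \<open>l = 0\<close> is left over for the tails in
  \<open>Psi\<close>.\<close>

definition Psi_coord :: "(nat \<Rightarrow> 'a) \<Rightarrow> nat \<Rightarrow> nat \<Rightarrow> nat set \<Rightarrow> 'a"
  where "Psi_coord x k l w = (slices x k l w - cube_proj k (slices x k l) w) + cube_proj k (slices x k (Suc l)) w"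

definition Psi :: "(nat \<Rightarrow> 'a) \<Rightarrow> nat \<Rightarrow> nat \<Rightarrow> 'a"
  where "Psi x k i = (case i of 0 \<Rightarrow> (case from_nat_into indices k of (k', l, w) \<Rightarrow> Psi_coord x k' l w)
    | Suc i' \<Rightarrow> if i' < tail_dim k then prj p (tail_dim k) (slices x k 0) i' else 0)"

lemma countable_indices: "countable indices"
  unfolding indices_def by (intro countable_SIGMA) (auto intro: countable_finite)

lemma infinite_indices: "infinite indices"
proof -
  have "range (\<lambda>k. (k, 0, {})) \<subseteq> indices" by (auto simp: indices_def)
  moreover have "infinite (range (\<lambda>k::nat. (k, 0::nat, {} :: nat set)))"
    by (intro range_inj_infinite) (auto simp: inj_on_def)
  ultimately show ?thesis using finite_subset by blast
qed

lemma to_nat_indices: "to_nat_on indices (from_nat_into indices j) = j"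
  using countable_indices infinite_indices by simp

lemma from_nat_indices: "w \<subseteq> {..<tail_dim k} \<Longrightarrow> from_nat_into indices (to_nat_on indices (k, l, w)) = (k, l, w)"
  using countable_indices by (intro from_nat_into_to_nat_on) (auto simp: indices_def)

lemma from_nat_cases:
  obtains k l w where "from_nat_into indices j = (k, l, w)" "w \<subseteq> {..<tail_dim k}" "to_nat_on indices (k, l, w) = j"
proof -
  obtain k l w where d: "from_nat_into indices j = (k, l, w)" by (metis prod_cases3)
  moreover have "from_nat_into indices j \<in> indices" using infinite_indices by (intro from_nat_into) auto
  ultimately show ?thesis using that to_nat_indices[of j] by (auto simp: indices_def)
qed

lemma suminf_indices:
  assumes "\<And>d. 0 \<le> h d"
  shows "(\<Sum>j. ennreal (h (from_nat_into indices j))) = (\<Sum>k. \<Sum>l. ennreal (\<Sum>w\<in>Pow {..<tail_dim k}. h (k, l, w)))"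
  unfolding indices_def by (rule suminf_triple_bij) (rule assms)

lemma cube_proj_linear: "cube_proj k (\<lambda>w. x w + y w) w = cube_proj k x w + cube_proj k y w"
    "cube_proj k (\<lambda>w. x w - y w) w = cube_proj k x w - cube_proj k y w"
    "cube_proj k (\<lambda>w. c * y w) w = c * cube_proj k y w"
proof -
  have "prj p (tail_dim k) (\<lambda>w. x w + y w) = (\<lambda>i. prj p (tail_dim k) x i + prj p (tail_dim k) y i)"
    "prj p (tail_dim k) (\<lambda>w. x w - y w) = (\<lambda>i. prj p (tail_dim k) x i - prj p (tail_dim k) y i)"
    "prj p (tail_dim k) (\<lambda>w. c * y w) = (\<lambda>i. c * prj p (tail_dim k) y i)"
    by (rule ext, rule prj_linear)+
  then show "cube_proj k (\<lambda>w. x w + y w) w = cube_proj k x w + cube_proj k y w"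
    "cube_proj k (\<lambda>w. x w - y w) w = cube_proj k x w - cube_proj k y w"
    "cube_proj k (\<lambda>w. c * y w) w = c * cube_proj k y w"
    by (simp_all only: cube_proj_def emb_linear)
qed

lemma cube_proj_cong: "(\<And>w. w \<subseteq> {..<tail_dim k} \<Longrightarrow> x w = y w) \<Longrightarrow> cube_proj k x w = cube_proj k y w"
  unfolding cube_proj_def by (intro emb_cong prj_cong)

lemma cube_proj_emb: "cube_proj k (emb p (tail_dim k) z) w = emb p (tail_dim k) z w"
  unfolding cube_proj_def by (intro emb_cong prj_emb)

lemma cube_proj_cube_proj: "cube_proj k (\<lambda>w. cube_proj k f w) w = cube_proj k f w"
  unfolding cube_proj_def[of k f] cube_proj_emb ..

lemma prj_cube_proj: "i < tail_dim k \<Longrightarrow> prj p (tail_dim k) (\<lambda>w. cube_proj k f w) i = prj p (tail_dim k) f i"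
  unfolding cube_proj_def by (rule prj_emb)

lemma Psi_Phi:
  assumes z: "z \<in> Z"
  shows "Psi (Phi z) = z"
proof (intro ext)
  fix k i
  have slices: "slices (Phi z) k l w = Phi_coord z k l w" if "w \<subseteq> {..<tail_dim k}" for k l w
    using from_nat_indices[OF that] by (simp add: slices_def Phi_def)
  have prya: "cube_proj k (slices (Phi z) k l) w = cube_proj k (Phi_coord z k l) w" for k l w
    using slices by (intro cube_proj_cong) auto
  \<comment> \<open>The projection kills the part that stayed in place and fixes the part that was
    moved in, so it recovers the latter.\<close>
  have pr0: "cube_proj k (Phi_coord z k 0) w = emb p (tail_dim k) (tail z k) w" for k w
    unfolding Phi_coord_def[abs_def] by (simp add: cube_proj_linear cube_proj_emb cube_proj_cube_proj)
  have prS: "cube_proj k (Phi_coord z k (Suc l)) w = cube_proj k (heads z k l) w" for k l w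
    unfolding Phi_coord_def[abs_def] by (simp add: cube_proj_linear cube_proj_cube_proj)
  show "Psi (Phi z) k i = z k i"
  proof (cases i)
    case 0
    obtain k' l w where d: "from_nat_into indices k = (k', l, w)" "w \<subseteq> {..<tail_dim k'}" "to_nat_on indices (k', l, w) = k"
      by (rule from_nat_cases)
    have "Psi_coord (Phi z) k' l w = Phi_coord z k' l w - cube_proj k' (Phi_coord z k' l) w + cube_proj k' (Phi_coord z k' (Suc l)) w"
      unfolding Psi_coord_def prya slices[OF d(2)] ..
    also have "\<dots> = heads z k' l w"
      by (cases l) (simp_all add: pr0 prS, simp_all add: Phi_coord_def)
    also have "\<dots> = z k 0" using d by (simp add: heads_def)
    finally show ?thesis using 0 d by (simp add: Psi_def)
  next
    case (Suc i')
    show ?thesis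
    proof (cases "i' < tail_dim k")
      case True
      have "prj p (tail_dim k) (slices (Phi z) k 0) i' = prj p (tail_dim k) (Phi_coord z k 0) i'"
        using slices by (intro prj_cong) auto
      also have "\<dots> = tail z k i'"
        unfolding Phi_coord_def[abs_def] using True by (simp add: prj_linear prj_emb prj_cube_proj)
      finally show ?thesis using Suc True by (simp add: Psi_def tail_def)
    next
      case False
      then have "n k \<le> i" using Suc by (simp add: tail_dim_def)
      then show ?thesis using Suc False ZD[OF z] by (simp add: Psi_def)
    qed
  qed
qed

lemma Phi_Psi: "Phi (Psi x) = x"
proof
  fix j
  obtain k l w where d: "from_nat_into indices j = (k, l, w)" "w \<subseteq> {..<tail_dim k}" "to_nat_on indices (k, l, w) = j"
    by (rule from_nat_cases)
  have heads: "heads (Psi x) k l w = Psi_coord x k l w" if "w \<subseteq> {..<tail_dim k}" for k l w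
    using from_nat_indices[OF that] by (simp add: heads_def Psi_def)
  have prxi: "cube_proj k (heads (Psi x) k l) w = cube_proj k (Psi_coord x k l) w" for k l w
    using heads by (intro cube_proj_cong) auto
  have prz: "cube_proj k (Psi_coord x k l) w = cube_proj k (slices x k (Suc l)) w" for k l w
    unfolding Psi_coord_def[abs_def] by (simp add: cube_proj_linear cube_proj_cube_proj)
  have "emb p (tail_dim k) (tail (Psi x) k) w = emb p (tail_dim k) (prj p (tail_dim k) (slices x k 0)) w"
    by (intro emb_cong) (simp add: tail_def Psi_def)
  then have t: "emb p (tail_dim k) (tail (Psi x) k) w = cube_proj k (slices x k 0) w" by (simp add: cube_proj_def)
  have "Phi_coord (Psi x) k l w = slices x k l w"
    by (cases l) (simp_all add: Phi_coord_def t prxi prz heads[OF d(2)], simp_all add: Psi_coord_def)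
  then show "Phi (Psi x) j = x j" using d by (simp add: Phi_def slices_def)
qed

lemma Phi_linear: "Phi (x + y) = (\<lambda>j. Phi x j + Phi y j)" "Phi (vscale c x) = (\<lambda>j. c * Phi x j)"
proof -
  have "heads (x + y) k l = (\<lambda>w. heads x k l w + heads y k l w)" "tail (x + y) k = (\<lambda>i. tail x k i + tail y k i)"
    "heads (vscale c x) k l = (\<lambda>w. c * heads x k l w)" "tail (vscale c x) k = (\<lambda>i. c * tail x k i)" for k l
    by (simp_all add: fun_eq_iff heads_def tail_def)
  then have "Phi_coord (x + y) k l w = Phi_coord x k l w + Phi_coord y k l w" "Phi_coord (vscale c x) k l w = c * Phi_coord x k l w" for k l w
    by (auto simp: Phi_coord_def cube_proj_linear emb_linear algebra_simps split: nat.splits)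
  then show "Phi (x + y) = (\<lambda>j. Phi x j + Phi y j)" "Phi (vscale c x) = (\<lambda>j. c * Phi x j)"
    by (auto simp: Phi_def fun_eq_iff split: prod.splits)
qed

lemma cube_sum_nonneg [simp]: "0 \<le> cube_sum k f"
  by (simp add: cube_sum_def sum_nonneg)

lemma cube_sum_add: "cube_sum k (\<lambda>w. f w + g w) \<le> 2 powr p * (cube_sum k f + cube_sum k g)"
proof -
  have "norm (f w + g w) powr p \<le> 2 powr p * (norm (f w) powr p + norm (g w) powr p)" for w
  proof -
    have "norm (f w + g w) powr p \<le> (norm (f w) + norm (g w)) powr p"
      using p_gt_1 by (intro powr_mono2) (auto intro: norm_triangle_ineq)
    also have "\<dots> \<le> 2 powr p * (norm (f w) powr p + norm (g w) powr p)"
      using p_gt_1 by (intro powr_add_le) auto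
    finally show ?thesis .
  qed
  then show ?thesis
    by (simp add: cube_sum_def sum_distrib_left sum_mono flip: sum.distrib distrib_left)
qed

text \<open>The maximum with \<open>1\<close> lets \<open>khin_bound * khin_bound\<close> dominate
  \<open>khin_bound\<close>, so one constant serves the embedded tails and the projected
  heads.\<close>

definition khin_bound :: real
  where "khin_bound = max 1 (max (khin p) (khin (p / (p - 1)) powr (p - 1)))"

lemma khin_bound: "1 \<le> khin_bound" "khin p \<le> khin_bound" "khin (p / (p - 1)) powr (p - 1) \<le> khin_bound"
  by (auto simp: khin_bound_def)

lemma cube_sum_emb: "cube_sum k (emb p (tail_dim k) z) \<le> khin_bound * L2_set (\<lambda>i. norm (z i)) {..<tail_dim k} powr p"
proof -
  have "cube_sum k (emb p (tail_dim k) z) \<le> khin p * L2_set (\<lambda>i. norm (z i)) {..<tail_dim k} powr p"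
    unfolding cube_sum_def using p_gt_1 by (intro emb_bound) auto
  also have "\<dots> \<le> khin_bound * L2_set (\<lambda>i. norm (z i)) {..<tail_dim k} powr p"
    by (intro mult_right_mono khin_bound) auto
  finally show ?thesis .
qed

lemma L2_set_prj: "L2_set (\<lambda>i. norm (prj p (tail_dim k) f i)) {..<tail_dim k} powr p \<le> khin_bound * cube_sum k f"
proof -
  have "L2_set (\<lambda>i. norm (prj p (tail_dim k) f i)) {..<tail_dim k} powr p
      \<le> khin (p / (p - 1)) powr (p - 1) * cube_sum k f"
    unfolding cube_sum_def by (rule prj_bound[OF p_gt_1])
  also have "\<dots> \<le> khin_bound * cube_sum k f" by (intro mult_right_mono khin_bound) auto
  finally show ?thesis .
qed

lemma cube_sum_cube_proj: "cube_sum k (cube_proj k f) \<le> khin_bound * khin_bound * cube_sum k f"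
proof -
  have "cube_sum k (cube_proj k f) \<le> khin_bound * L2_set (\<lambda>i. norm (prj p (tail_dim k) f i)) {..<tail_dim k} powr p"
    unfolding cube_proj_def by (rule cube_sum_emb)
  also have "\<dots> \<le> khin_bound * (khin_bound * cube_sum k f)" using khin_bound by (intro mult_left_mono L2_set_prj) auto
  finally show ?thesis by (simp add: mult.assoc)
qed

text \<open>One factor \<open>2 powr p\<close> for adding two pieces, a second one for the
  complement of the projection; \<open>khin_bound * khin_bound\<close> bounds the projection
  itself.\<close>

definition shift_bound :: real
  where "shift_bound = 2 powr p * (2 powr p * (1 + khin_bound * khin_bound))"

lemma cube_sum_diff_cube_proj: "cube_sum k (\<lambda>w. f w - cube_proj k f w) \<le> 2 powr p * (1 + khin_bound * khin_bound) * cube_sum k f"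
proof -
  have "cube_sum k (\<lambda>w. f w - cube_proj k f w) = cube_sum k (\<lambda>w. f w + - cube_proj k f w)" by simp
  also have "\<dots> \<le> 2 powr p * (cube_sum k f + cube_sum k (\<lambda>w. - cube_proj k f w))" by (rule cube_sum_add)
  also have "cube_sum k (\<lambda>w. - cube_proj k f w) = cube_sum k (cube_proj k f)" by (simp add: cube_sum_def)
  also have "2 powr p * (cube_sum k f + cube_sum k (cube_proj k f)) \<le> 2 powr p * (cube_sum k f + khin_bound * khin_bound * cube_sum k f)"
    by (intro mult_left_mono add_left_mono cube_sum_cube_proj) auto
  finally show ?thesis by (simp add: algebra_simps)
qed

text \<open>One estimate for both directions of the isomorphism: \<open>g\<close> is the piece moved
  in, controlled by the mass \<open>G\<close> it comes from, and the rest stays in place.\<close>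

lemma cube_sum_sum_cube_proj:
  assumes "cube_sum k g \<le> khin_bound * khin_bound * G" "0 \<le> G"
  shows "cube_sum k (\<lambda>w. g w + (f w - cube_proj k f w)) \<le> shift_bound * (G + cube_sum k f)"
proof -
  have "1 \<le> (2::real) powr p" using p_gt_1 by (simp add: ge_one_powr_ge_zero)
  have "khin_bound * khin_bound \<le> 1 + khin_bound * khin_bound" by simp
  also have "\<dots> \<le> 2 powr p * (1 + khin_bound * khin_bound)"
    using mult_right_mono[OF \<open>1 \<le> 2 powr p\<close>, of "1 + khin_bound * khin_bound"] khin_bound(1) by simp
  finally have "khin_bound * khin_bound * G \<le> 2 powr p * (1 + khin_bound * khin_bound) * G"
    using assms(2) by (rule mult_right_mono)
  then have "cube_sum k g + cube_sum k (\<lambda>w. f w - cube_proj k f w) \<le> 2 powr p * (1 + khin_bound * khin_bound) * (G + cube_sum k f)"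
    using cube_sum_diff_cube_proj[of k f] assms(1) by (simp add: distrib_left)
  then have "2 powr p * (cube_sum k g + cube_sum k (\<lambda>w. f w - cube_proj k f w)) \<le> shift_bound * (G + cube_sum k f)"
    unfolding shift_bound_def by (simp add: mult.assoc)
  then show ?thesis using cube_sum_add[of k g "\<lambda>w. f w - cube_proj k f w"] by linarith
qed

lemma shift_bound_pos: "0 < shift_bound"
  using khin_bound(1) by (simp add: shift_bound_def add_pos_nonneg)

definition tail_pow :: "(nat \<Rightarrow> nat \<Rightarrow> 'a) \<Rightarrow> nat \<Rightarrow> real"
  where "tail_pow z k = L2_set (\<lambda>i. norm (tail z k i)) {..<tail_dim k} powr p"

lemma block_norm_tail: "block_norm k z = sqrt ((norm (z k 0))\<^sup>2 + (L2_set (\<lambda>i. norm (tail z k i)) {..<tail_dim k})\<^sup>2)"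
proof -
  have n: "n k = Suc (tail_dim k)" using n_pos[of k] by (simp add: tail_dim_def)
  show ?thesis
    unfolding block_norm_def L2_set_def n sum.lessThan_Suc_shift by (simp add: tail_def sum_nonneg)
qed

lemma tail_pow_le: "tail_pow z k \<le> block_norm k z powr p" "norm (z k 0) powr p \<le> block_norm k z powr p"
  unfolding tail_pow_def block_norm_tail using p_gt_1
  by (auto intro!: powr_mono2 real_sqrt_sum_squares_ge1 real_sqrt_sum_squares_ge2)

lemma block_norm_le: "block_norm k z powr p \<le> 2 powr p * (norm (z k 0) powr p + tail_pow z k)"
proof -
  have "block_norm k z powr p \<le> (norm (z k 0) + L2_set (\<lambda>i. norm (tail z k i)) {..<tail_dim k}) powr p"
    unfolding block_norm_tail using p_gt_1 by (intro powr_mono2 sqrt_sum_squares_le_sum) auto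
  also have "\<dots> \<le> 2 powr p * (norm (z k 0) powr p + tail_pow z k)"
    unfolding tail_pow_def using p_gt_1 by (intro powr_add_le) auto
  finally show ?thesis .
qed

lemma suminf_heads: "(\<Sum>k. \<Sum>l. ennreal (cube_sum k (heads z k l))) = (\<Sum>j. ennreal (norm (z j 0) powr p))"
proof -
  have "(\<Sum>j. ennreal (norm (z j 0) powr p))
      = (\<Sum>j. ennreal ((\<lambda>d. norm (z (to_nat_on indices d) 0) powr p) (from_nat_into indices j)))"
    by (simp add: to_nat_indices)
  also have "\<dots> = (\<Sum>k. \<Sum>l. ennreal (cube_sum k (heads z k l)))"
    unfolding cube_sum_def heads_def by (rule suminf_indices) simp
  finally show ?thesis by simp
qed

lemma suminf_slices: "(\<Sum>k. \<Sum>l. ennreal (cube_sum k (slices x k l))) = (\<Sum>j. ennreal (norm (x j) powr p))"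
proof -
  have "(\<Sum>j. ennreal (norm (x j) powr p))
      = (\<Sum>j. ennreal ((\<lambda>d. norm (x (to_nat_on indices d)) powr p) (from_nat_into indices j)))"
    by (simp add: to_nat_indices)
  also have "\<dots> = (\<Sum>k. \<Sum>l. ennreal (cube_sum k (slices x k l)))"
    unfolding cube_sum_def slices_def by (rule suminf_indices) simp
  finally show ?thesis by simp
qed

lemma suminf_Phi: "(\<Sum>j. ennreal (norm (Phi z j) powr p)) = (\<Sum>k. \<Sum>l. ennreal (cube_sum k (Phi_coord z k l)))"
proof -
  have "(\<Sum>j. ennreal (norm (Phi z j) powr p))
      = (\<Sum>j. ennreal ((\<lambda>d. norm (case d of (k, l, w) \<Rightarrow> Phi_coord z k l w) powr p) (from_nat_into indices j)))"
    by (simp add: Phi_def)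
  also have "\<dots> = (\<Sum>k. \<Sum>l. ennreal (\<Sum>w\<in>Pow {..<tail_dim k}. norm (case (k, l, w) of (k, l, w) \<Rightarrow> Phi_coord z k l w) powr p))"
    by (rule suminf_indices) simp
  finally show ?thesis by (simp add: cube_sum_def)
qed

lemma suminf_Psi: "(\<Sum>j. ennreal (norm (Psi x j 0) powr p)) = (\<Sum>k. \<Sum>l. ennreal (cube_sum k (Psi_coord x k l)))"
proof -
  have "(\<Sum>j. ennreal (norm (Psi x j 0) powr p))
      = (\<Sum>j. ennreal ((\<lambda>d. norm (case d of (k, l, w) \<Rightarrow> Psi_coord x k l w) powr p) (from_nat_into indices j)))"
    by (simp add: Psi_def)
  also have "\<dots> = (\<Sum>k. \<Sum>l. ennreal (\<Sum>w\<in>Pow {..<tail_dim k}. norm (case (k, l, w) of (k, l, w) \<Rightarrow> Psi_coord x k l w) powr p))"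
    by (rule suminf_indices) simp
  finally show ?thesis by (simp add: cube_sum_def)
qed

lemma khin_bound_sq:
  assumes "0 \<le> G"
  shows "khin_bound * G \<le> khin_bound * khin_bound * G"
  using mult_right_mono[OF khin_bound(1), of "khin_bound * G"] assms khin_bound(1) by (simp add: mult.assoc)

lemma suminf_ennreal_mono: "(\<And>k. f k \<le> g k) \<Longrightarrow> (\<Sum>k. f k :: ennreal) \<le> (\<Sum>k. g k)"
  by (intro suminf_le summableI)

lemma suminf_ennreal_add: "(\<Sum>k. f k + g k :: ennreal) = (\<Sum>k. f k) + (\<Sum>k. g k)"
  by (intro suminf_add[symmetric] summableI)

text \<open>Each slice of the heads occurs in place and shifted, which is bounded crudely by a
  factor \<open>3\<close>; the tails account for the remaining \<open>1\<close> of the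
  \<open>4\<close>.\<close>

lemma Phi_bound:
  "(\<Sum>j. ennreal (norm (Phi z j) powr p)) \<le> ennreal (4 * shift_bound) * (\<Sum>k. ennreal (block_norm k z powr p))"
proof -
  define a where "a k l = ennreal (cube_sum k (heads z k l))" for k l
  define t where "t k = ennreal (tail_pow z k)" for k
  have y0: "ennreal (cube_sum k (Phi_coord z k 0)) \<le> ennreal shift_bound * (t k + a k 0)" for k
  proof -
    have "0 \<le> tail_pow z k" by (simp add: tail_pow_def)
    moreover have "cube_sum k (emb p (tail_dim k) (tail z k)) \<le> khin_bound * khin_bound * tail_pow z k"
      using cube_sum_emb[of k "tail z k"] khin_bound_sq[OF \<open>0 \<le> tail_pow z k\<close>] by (simp add: tail_pow_def)
    ultimately have "cube_sum k (Phi_coord z k 0) \<le> shift_bound * (tail_pow z k + cube_sum k (heads z k 0))"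
      unfolding Phi_coord_def[abs_def] using cube_sum_sum_cube_proj by simp
    then show ?thesis
      using shift_bound_pos \<open>0 \<le> tail_pow z k\<close> by (simp add: a_def t_def ennreal_leI flip: ennreal_mult ennreal_plus)
  qed
  have yS: "ennreal (cube_sum k (Phi_coord z k (Suc l))) \<le> ennreal shift_bound * (a k l + a k (Suc l))" for k l
  proof -
    have "cube_sum k (Phi_coord z k (Suc l)) \<le> shift_bound * (cube_sum k (heads z k l) + cube_sum k (heads z k (Suc l)))"
      unfolding Phi_coord_def[abs_def] using cube_sum_sum_cube_proj[OF cube_sum_cube_proj] by simp
    then show ?thesis
      using shift_bound_pos by (simp add: a_def ennreal_leI flip: ennreal_mult ennreal_plus)
  qed
  have inner: "(\<Sum>l. ennreal (cube_sum k (Phi_coord z k l))) \<le> ennreal shift_bound * (t k + 3 * (\<Sum>l. a k l))" for k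
  proof -
    have "(\<Sum>l. ennreal (cube_sum k (Phi_coord z k l))) \<le> ennreal shift_bound * (t k + a k 0) + (\<Sum>l. ennreal shift_bound * (a k l + a k (Suc l)))"
      unfolding suminf_ennreal_head[of "\<lambda>l. ennreal (cube_sum k (Phi_coord z k l))"]
      by (intro add_mono y0 suminf_ennreal_mono yS)
    also have "\<dots> = ennreal shift_bound * (t k + a k 0 + ((\<Sum>l. a k l) + (\<Sum>l. a k (Suc l))))"
      by (simp add: suminf_ennreal_add distrib_left)
    also have "\<dots> \<le> ennreal shift_bound * (t k + (\<Sum>l. a k l) + ((\<Sum>l. a k l) + (\<Sum>l. a k l)))"
      by (intro mult_left_mono add_mono order_refl suminf_ennreal_Suc_le)
        (auto simp: suminf_ennreal_head[of "a k"])
    also have "\<dots> = ennreal shift_bound * (t k + 3 * (\<Sum>l. a k l))"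
    proof -
      have "s + (s + s) = 3 * s" for s :: ennreal
        by (simp add: mult_2[symmetric] numeral_3_eq_3 distrib_right[symmetric])
          (metis add.commute distrib_right mult_1 numeral_Bit1 numeral_One one_add_one)
      then show ?thesis by (simp add: add.assoc)
    qed
    finally show ?thesis .
  qed
  have "(\<Sum>j. ennreal (norm (Phi z j) powr p)) \<le> (\<Sum>k. ennreal shift_bound * (t k + 3 * (\<Sum>l. a k l)))"
    unfolding suminf_Phi by (intro suminf_ennreal_mono inner)
  also have "\<dots> = ennreal shift_bound * ((\<Sum>k. t k) + 3 * (\<Sum>k. \<Sum>l. a k l))"
    by (simp add: suminf_ennreal_add)
  also have "(\<Sum>k. \<Sum>l. a k l) = (\<Sum>j. ennreal (norm (z j 0) powr p))"
    unfolding a_def by (rule suminf_heads)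
  also have "ennreal shift_bound * ((\<Sum>k. t k) + 3 * (\<Sum>j. ennreal (norm (z j 0) powr p)))
      \<le> ennreal shift_bound * ((\<Sum>k. ennreal (block_norm k z powr p)) + 3 * (\<Sum>k. ennreal (block_norm k z powr p)))"
    unfolding t_def by (intro mult_left_mono add_mono suminf_ennreal_mono ennreal_leI tail_pow_le) auto
  also have "\<dots> = ennreal (4 * shift_bound) * (\<Sum>k. ennreal (block_norm k z powr p))"
  proof -
    have four: "s + 3 * s = 4 * s" for s :: ennreal
      using distrib_right[of 1 3 s] by simp
    have "ennreal (4 * shift_bound) = 4 * ennreal shift_bound" using shift_bound_pos by (simp add: ennreal_mult)
    then show ?thesis by (simp only: four mult_ac)
  qed
  finally show ?thesis .
qed

text \<open>\<open>2 powr p\<close> splits a block into head and tail. The heads cost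
  \<open>2 * shift_bound\<close>, since each slice is used in place and shifted, and the tails cost
  \<open>khin_bound\<close>.\<close>

lemma Psi_bound:
  "(\<Sum>k. ennreal (block_norm k (Psi x) powr p))
    \<le> ennreal (2 powr p * (2 * shift_bound + khin_bound)) * (\<Sum>j. ennreal (norm (x j) powr p))"
proof -
  define a where "a k l = ennreal (cube_sum k (slices x k l))" for k l
  have aS: "(\<Sum>k. \<Sum>l. a k l) = (\<Sum>j. ennreal (norm (x j) powr p))" unfolding a_def by (rule suminf_slices)
  have z: "ennreal (cube_sum k (Psi_coord x k l)) \<le> ennreal shift_bound * (a k (Suc l) + a k l)" for k l
  proof -
    have "Psi_coord x k l = (\<lambda>w. cube_proj k (slices x k (Suc l)) w + (slices x k l w - cube_proj k (slices x k l) w))"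
      by (simp add: fun_eq_iff Psi_coord_def)
    then have "cube_sum k (Psi_coord x k l) \<le> shift_bound * (cube_sum k (slices x k (Suc l)) + cube_sum k (slices x k l))"
      using cube_sum_sum_cube_proj[OF cube_sum_cube_proj] by simp
    then show ?thesis
      using shift_bound_pos by (simp add: a_def ennreal_leI flip: ennreal_mult ennreal_plus)
  qed
  have head: "(\<Sum>j. ennreal (norm (Psi x j 0) powr p)) \<le> ennreal (2 * shift_bound) * (\<Sum>j. ennreal (norm (x j) powr p))"
  proof -
    have "(\<Sum>j. ennreal (norm (Psi x j 0) powr p)) \<le> (\<Sum>k. \<Sum>l. ennreal shift_bound * (a k (Suc l) + a k l))"
      unfolding suminf_Psi by (intro suminf_ennreal_mono z)
    also have "\<dots> = ennreal shift_bound * ((\<Sum>k. \<Sum>l. a k (Suc l)) + (\<Sum>k. \<Sum>l. a k l))"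
      by (simp add: suminf_ennreal_add)
    also have "\<dots> \<le> ennreal shift_bound * ((\<Sum>k. \<Sum>l. a k l) + (\<Sum>k. \<Sum>l. a k l))"
      by (intro mult_left_mono add_mono suminf_ennreal_mono suminf_ennreal_Suc_le order_refl) auto
    also have "\<dots> = ennreal (2 * shift_bound) * (\<Sum>k. \<Sum>l. a k l)"
      using shift_bound_pos by (simp add: ennreal_mult mult_2[symmetric] mult_ac)
    finally show ?thesis unfolding aS .
  qed
  have T: "ennreal (tail_pow (Psi x) k) \<le> ennreal khin_bound * (\<Sum>l. a k l)" for k
  proof -
    have "L2_set (\<lambda>i. norm (tail (Psi x) k i)) {..<tail_dim k} = L2_set (\<lambda>i. norm (prj p (tail_dim k) (slices x k 0) i)) {..<tail_dim k}"
      by (intro L2_set_cong) (auto simp: tail_def Psi_def)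
    then have "tail_pow (Psi x) k \<le> khin_bound * cube_sum k (slices x k 0)" using L2_set_prj[of k "slices x k 0"] by (simp add: tail_pow_def)
    then have "ennreal (tail_pow (Psi x) k) \<le> ennreal khin_bound * a k 0"
      using khin_bound(1) by (simp add: a_def ennreal_leI flip: ennreal_mult)
    also have "\<dots> \<le> ennreal khin_bound * (\<Sum>l. a k l)"
      by (intro mult_left_mono) (auto simp: suminf_ennreal_head[of "a k"])
    finally show ?thesis .
  qed
  have "(\<Sum>k. ennreal (block_norm k (Psi x) powr p))
      \<le> (\<Sum>k. ennreal (2 powr p) * (ennreal (norm (Psi x k 0) powr p) + ennreal (tail_pow (Psi x) k)))"
  proof (intro suminf_ennreal_mono)
    fix k
    have "0 \<le> tail_pow (Psi x) k" by (simp add: tail_pow_def)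
    then show "ennreal (block_norm k (Psi x) powr p)
        \<le> ennreal (2 powr p) * (ennreal (norm (Psi x k 0) powr p) + ennreal (tail_pow (Psi x) k))"
      using block_norm_le[of k "Psi x"] by (simp add: ennreal_leI flip: ennreal_mult ennreal_plus)
  qed
  also have "\<dots> = ennreal (2 powr p) * ((\<Sum>k. ennreal (norm (Psi x k 0) powr p)) + (\<Sum>k. ennreal (tail_pow (Psi x) k)))"
    by (simp add: suminf_ennreal_add)
  also have "\<dots> \<le> ennreal (2 powr p) * (ennreal (2 * shift_bound) * (\<Sum>j. ennreal (norm (x j) powr p))
      + (\<Sum>k. ennreal khin_bound * (\<Sum>l. a k l)))"
    by (intro mult_left_mono add_mono head suminf_ennreal_mono T) auto
  also have "\<dots> = ennreal (2 powr p * (2 * shift_bound + khin_bound)) * (\<Sum>j. ennreal (norm (x j) powr p))"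
  proof -
    have "ennreal (2 powr p * (2 * shift_bound + khin_bound)) = ennreal (2 powr p) * (ennreal (2 * shift_bound) + ennreal khin_bound)"
      using shift_bound_pos khin_bound(1) by (simp add: ennreal_mult ennreal_plus)
    then show ?thesis by (simp add: aS distrib_right mult.assoc)
  qed
  finally show ?thesis .
qed

text \<open>The passage from \<open>ennreal\<close> back to the reals: finiteness of the left sum
  yields summability.\<close>

lemma powr_suminf_le:
  fixes f g :: "nat \<Rightarrow> real"
  assumes "\<And>k. 0 \<le> f k" "\<And>k. 0 \<le> g k" "summable g" "0 \<le> c"
    "(\<Sum>k. ennreal (f k)) \<le> ennreal c * (\<Sum>k. ennreal (g k))"
  shows "summable f" "(\<Sum>k. f k) powr (1 / p) \<le> c powr (1 / p) * (\<Sum>k. g k) powr (1 / p)"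
proof -
  have g: "(\<Sum>k. ennreal (g k)) = ennreal (\<Sum>k. g k)" using assms by (intro suminf_ennreal2) auto
  have g0: "0 \<le> (\<Sum>k. g k)" using assms by (intro suminf_nonneg) auto
  have le: "(\<Sum>k. ennreal (f k)) \<le> ennreal (c * (\<Sum>k. g k))"
    using assms(4,5) g0 unfolding g by (simp add: ennreal_mult)
  then have "(\<Sum>k. ennreal (f k)) \<noteq> top_class.top" by (rule neq_top_trans[rotated]) simp
  then show sf: "summable f" using assms by (intro summable_suminf_not_top) auto
  then have "(\<Sum>k. ennreal (f k)) = ennreal (\<Sum>k. f k)" using assms by (intro suminf_ennreal2) auto
  then have "(\<Sum>k. f k) \<le> c * (\<Sum>k. g k)" using le assms g0 by simp
  moreover have "0 \<le> (\<Sum>k. f k)" using assms sf by (intro suminf_nonneg) auto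
  ultimately have "(\<Sum>k. f k) powr (1 / p) \<le> (c * (\<Sum>k. g k)) powr (1 / p)"
    using p_gt_1 by (intro powr_mono2) auto
  then show "(\<Sum>k. f k) powr (1 / p) \<le> c powr (1 / p) * (\<Sum>k. g k) powr (1 / p)"
    using assms g0 by (simp add: powr_mult)
qed

lemma Phi_ell:
  assumes "z \<in> Z"
  shows "Phi z \<in> ell p" "ell_norm p (Phi z) \<le> (4 * shift_bound) powr (1 / p) * lp_norm z"
  using powr_suminf_le[OF _ _ Z_summable[OF assms] _ Phi_bound] shift_bound_pos
  by (auto simp: ell_def ell_norm_def lp_norm_def)

lemma Psi_Z:
  assumes "x \<in> ell p"
  shows "Psi x \<in> Z" "lp_norm (Psi x) \<le> (2 powr p * (2 * shift_bound + khin_bound)) powr (1 / p) * ell_norm p x"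
proof -
  have x: "summable (\<lambda>n. norm (x n) powr p)" using assms by (simp add: ell_def)
  have c: "0 \<le> 2 powr p * (2 * shift_bound + khin_bound)" using shift_bound_pos khin_bound(1) by simp
  note b = powr_suminf_le[OF _ _ x c Psi_bound]
  show "lp_norm (Psi x) \<le> (2 powr p * (2 * shift_bound + khin_bound)) powr (1 / p) * ell_norm p x"
    using b by (simp add: lp_norm_def ell_norm_def)
  have "Psi x k i = 0" if "n k \<le> i" for k i
    using that n_pos[of k] by (cases i) (auto simp: Psi_def tail_dim_def)
  then show "Psi x \<in> Z" using b by (auto simp: Z_def)
qed

end

section \<open>Bounded groups of operators\<close>

lemma ell_add:
  fixes x y :: "nat \<Rightarrow> 'a::real_normed_field"
  assumes "1 < p" "x \<in> ell p" "y \<in> ell p"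
  shows "(\<lambda>n. x n + y n) \<in> ell p"
proof -
  have "summable (\<lambda>n. (norm (x n) + norm (y n)) powr p)"
    using assms by (intro summable_powr_add) (auto simp: ell_def)
  then have "summable (\<lambda>n. norm (x n + y n) powr p)"
    using assms(1) by (elim summable_comparison_test'[where N = 0])
      (auto intro!: powr_mono2 norm_triangle_ineq)
  then show ?thesis by (simp add: ell_def)
qed

lemma ell_scale: "x \<in> ell p \<Longrightarrow> (\<lambda>n. c * x n) \<in> ell p"
  by (auto simp: ell_def norm_mult powr_mult intro!: summable_mult)

lemma ell_zero: "(\<lambda>n. 0) \<in> ell p"
  by (simp add: ell_def)

lemma ell_norm_nonneg [simp]: "0 \<le> ell_norm p x"
  by (simp add: ell_norm_def)

lemma ell_norm_scale:
  "1 < p \<Longrightarrow> x \<in> ell p \<Longrightarrow> ell_norm p (\<lambda>n. c * x n) = norm c * ell_norm p x"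
  by (simp add: ell_def ell_norm_def norm_mult powr_mult suminf_mult powr_powr suminf_nonneg)

lemma ell_norm_zero [simp]: "ell_norm p (\<lambda>n. 0) = 0"
  by (simp add: ell_norm_def)

lemma ell_norm_eq_0_iff:
  assumes "x \<in> ell p"
  shows "ell_norm p x = 0 \<longleftrightarrow> x = (\<lambda>n. 0)"
proof
  assume "ell_norm p x = 0"
  then have "(\<Sum>n. norm (x n) powr p) = 0" by (simp add: ell_norm_def)
  then have "norm (x n) powr p = 0" for n
    using suminf_eq_zero_iff[of "\<lambda>n. norm (x n) powr p"] assms by (simp add: ell_def)
  then show "x = (\<lambda>n. 0)" by (simp add: fun_eq_iff)
qed simp

lemma linear_map_ellD:
  assumes "linear_map_ell p T"
  shows "x \<in> ell p \<Longrightarrow> T x \<in> ell p"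
    "x \<in> ell p \<Longrightarrow> y \<in> ell p \<Longrightarrow> T (\<lambda>n. x n + y n) = (\<lambda>n. T x n + T y n)"
    "x \<in> ell p \<Longrightarrow> T (\<lambda>n. c * x n) = (\<lambda>n. c * T x n)"
    "T (\<lambda>n. 0) = (\<lambda>n. 0)"
proof -
  show *: "x \<in> ell p \<Longrightarrow> T x \<in> ell p"
    "x \<in> ell p \<Longrightarrow> y \<in> ell p \<Longrightarrow> T (\<lambda>n. x n + y n) = (\<lambda>n. T x n + T y n)"
    "x \<in> ell p \<Longrightarrow> T (\<lambda>n. c * x n) = (\<lambda>n. c * T x n)" for x y c
    using assms by (auto simp: linear_map_ell_def)
  show "T (\<lambda>n. 0) = (\<lambda>n. 0)" using *(3)[OF ell_zero, of 0] by simp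
qed

lemma linear_map_ell_cong:
  assumes "1 < p" "linear_map_ell p T" "\<And>x. x \<in> ell p \<Longrightarrow> T' x = T x"
  shows "linear_map_ell p T'"
  using assms by (auto simp: linear_map_ell_def ell_add ell_scale)

lemma linear_map_ell_comp:
  "linear_map_ell p T \<Longrightarrow> linear_map_ell p S \<Longrightarrow> linear_map_ell p (\<lambda>x. T (S x))"
  by (auto simp: linear_map_ell_def Pi_iff)

lemma linear_map_ell_inverse:
  assumes p: "1 < p" and T: "linear_map_ell p T"
    and T': "\<And>x. x \<in> ell p \<Longrightarrow> T' x \<in> ell p" "\<And>x. x \<in> ell p \<Longrightarrow> T' (T x) = x" "\<And>x. x \<in> ell p \<Longrightarrow> T (T' x) = x"
  shows "linear_map_ell p T'"
proof -
  note lin = linear_map_ellD[OF T]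
  have "T' (\<lambda>n. x n + y n) = (\<lambda>n. T' x n + T' y n)" if "x \<in> ell p" "y \<in> ell p" for x y
    using T'(2)[OF ell_add[OF p T'(1)[OF that(1)] T'(1)[OF that(2)]]]
      lin(2)[OF T'(1)[OF that(1)] T'(1)[OF that(2)]] T'(3) that by simp
  moreover have "T' (\<lambda>n. c * x n) = (\<lambda>n. c * T' x n)" if "x \<in> ell p" for x c
    using T'(2)[OF ell_scale[OF T'(1)[OF that]], of c] lin(3)[OF T'(1)[OF that], of c] T'(3) that by simp
  ultimately show ?thesis using T'(1) by (simp add: linear_map_ell_def)
qed

lemma bounded_linear_map_ell_comp:
  assumes "bounded_linear_map_ell p T" "bounded_linear_map_ell p S"
  shows "bounded_linear_map_ell p (\<lambda>x. T (S x))"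
proof -
  obtain C D where C: "\<And>x. x \<in> ell p \<Longrightarrow> ell_norm p (T x) \<le> C * ell_norm p x"
    and D: "\<And>x. x \<in> ell p \<Longrightarrow> ell_norm p (S x) \<le> D * ell_norm p x"
    using assms unfolding bounded_linear_map_ell_def by metis
  have S: "S x \<in> ell p" if "x \<in> ell p" for x
    using assms that linear_map_ellD(1) by (auto simp: bounded_linear_map_ell_def)
  have "ell_norm p (T (S x)) \<le> \<bar>C\<bar> * D * ell_norm p x" if "x \<in> ell p" for x
  proof -
    have "ell_norm p (T (S x)) \<le> C * ell_norm p (S x)" using C S that by blast
    also have "\<dots> \<le> \<bar>C\<bar> * ell_norm p (S x)" by (intro mult_right_mono) auto
    also have "\<dots> \<le> \<bar>C\<bar> * (D * ell_norm p x)" using D that by (intro mult_left_mono) auto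
    finally show ?thesis by (simp add: mult.assoc)
  qed
  then show ?thesis using assms linear_map_ell_comp by (auto simp: bounded_linear_map_ell_def)
qed

lemma bounded_linear_map_ell_cong:
  assumes "1 < p" "bounded_linear_map_ell p T" "\<And>x. x \<in> ell p \<Longrightarrow> T' x = T x"
  shows "bounded_linear_map_ell p T'"
proof -
  have "linear_map_ell p T'"
    using assms linear_map_ell_cong by (auto simp: bounded_linear_map_ell_def)
  then show ?thesis using assms by (auto simp: bounded_linear_map_ell_def)
qed

lemma GL_ellD:
  assumes "T \<in> carrier (GL_ell p)"
  shows "T \<in> extensional (ell p)" "bij_betw T (ell p) (ell p)" "linear_map_ell p T"
    "bounded_linear_map_ell p T" "bounded_linear_map_ell p (inv_into (ell p) T)" "T \<in> Bij (ell p)"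
  using assms by (auto simp: GL_ell_def Bij_def bounded_linear_map_ell_def)

lemma GL_ellI:
  assumes "1 < p" "T \<in> extensional (ell p)" "bounded_linear_map_ell p T" "bounded_linear_map_ell p T'"
    "\<And>x. x \<in> ell p \<Longrightarrow> T' (T x) = x" "\<And>x. x \<in> ell p \<Longrightarrow> T (T' x) = x"
  shows "T \<in> carrier (GL_ell p)"
proof -
  have mem: "T x \<in> ell p" "T' x \<in> ell p" if "x \<in> ell p" for x
    using assms that linear_map_ellD(1) by (auto simp: bounded_linear_map_ell_def)
  have bij: "bij_betw T (ell p) (ell p)"
    using assms mem by (intro bij_betw_byWitness[where f' = T']) auto
  then have "inv_into (ell p) T x = T' x" if "x \<in> ell p" for x
    using that assms mem by (intro inv_into_f_eq) (auto simp: bij_betw_def)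
  then have "bounded_linear_map_ell p (inv_into (ell p) T)"
    using bounded_linear_map_ell_cong[OF assms(1,4)] by blast
  then show ?thesis using assms bij by (simp add: GL_ell_def Bij_def)
qed

lemma subgroup_GL_ell:
  assumes p: "1 < p"
  shows "subgroup (carrier (GL_ell p)) (BijGroup (ell p :: (nat \<Rightarrow> 'a::real_normed_field) set))"
proof -
  have sub: "carrier (GL_ell p) \<subseteq> carrier (BijGroup (ell p :: (nat \<Rightarrow> 'a) set))" by (auto simp: GL_ell_def BijGroup_def)
  show ?thesis
  proof (rule group.subgroupI[OF group_BijGroup sub])
    have id: "bounded_linear_map_ell p (\<lambda>x :: nat \<Rightarrow> 'a. x)"
      by (auto simp: bounded_linear_map_ell_def linear_map_ell_def intro!: exI[of _ 1])
    then have "(\<lambda>x\<in>ell p. x :: nat \<Rightarrow> 'a) \<in> carrier (GL_ell p)"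
      by (intro GL_ellI[OF p _ bounded_linear_map_ell_cong[OF p id] id]) auto
    then show "carrier (GL_ell p :: ((nat \<Rightarrow> 'a) \<Rightarrow> nat \<Rightarrow> 'a) monoid) \<noteq> {}" by auto
    fix T :: "(nat \<Rightarrow> 'a) \<Rightarrow> nat \<Rightarrow> 'a" assume T: "T \<in> carrier (GL_ell p)"
    note D = GL_ellD[OF T]
    have "(\<lambda>x\<in>ell p. inv_into (ell p) T x) \<in> carrier (GL_ell p)"
      using D by (intro GL_ellI[OF p _ bounded_linear_map_ell_cong[OF p D(5)] D(4)])
        (auto simp: bij_betw_inv_into_left bij_betw_inv_into_right linear_map_ellD(1))
    then show "inv\<^bsub>BijGroup (ell p)\<^esub> T \<in> carrier (GL_ell p)" by (simp add: inv_BijGroup D)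
    fix S :: "(nat \<Rightarrow> 'a) \<Rightarrow> nat \<Rightarrow> 'a" assume S: "S \<in> carrier (GL_ell p)"
    note E = GL_ellD[OF S]
    have "compose (ell p) T S \<in> carrier (GL_ell p)"
    proof (rule GL_ellI[OF p _ _ bounded_linear_map_ell_comp[OF E(5) D(5)]])
      show "bounded_linear_map_ell p (compose (ell p) T S)"
        by (rule bounded_linear_map_ell_cong[OF p bounded_linear_map_ell_comp[OF D(4) E(4)]])
          (simp add: compose_def)
      have inv: "inv_into (ell p) T x \<in> ell p" if "x \<in> ell p" for x
        using that D(5) by (auto simp: bounded_linear_map_ell_def linear_map_ellD(1))
      show "inv_into (ell p) S (inv_into (ell p) T (compose (ell p) T S x)) = x" if "x \<in> ell p" for x
        using that D E by (simp add: compose_def bij_betw_inv_into_left linear_map_ellD(1))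
      have inv': "inv_into (ell p) S x \<in> ell p" if "x \<in> ell p" for x
        using that E(5) by (auto simp: bounded_linear_map_ell_def linear_map_ellD(1))
      show "compose (ell p) T S (inv_into (ell p) S (inv_into (ell p) T x)) = x" if "x \<in> ell p" for x
        using that D E inv inv' by (simp add: compose_def bij_betw_inv_into_right)
    qed (simp add: compose_def)
    then show "T \<otimes>\<^bsub>BijGroup (ell p)\<^esub> S \<in> carrier (GL_ell p)" using D E by (simp add: BijGroup_def)
  qed
qed

text \<open>Folds the carrier, so that general facts about subgroups of \<open>BijGroup\<close>
  apply to \<open>GL_ell\<close>.\<close>

lemma GL_ell_eq: "GL_ell p = (BijGroup (ell p)) \<lparr>carrier := carrier (GL_ell p)\<rparr>"
  by (simp add: GL_ell_def)

lemma group_GL_ell: "1 < p \<Longrightarrow> group (GL_ell p)"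
  using subgroup.subgroup_is_group[OF subgroup_GL_ell group_BijGroup] GL_ell_eq by metis

lemma GL_ell_mult:
  "T \<in> carrier (GL_ell p) \<Longrightarrow> S \<in> carrier (GL_ell p) \<Longrightarrow> T \<otimes>\<^bsub>GL_ell p\<^esub> S = compose (ell p) T S"
  by (simp add: GL_ell_def BijGroup_def)

lemma GL_ell_one: "\<one>\<^bsub>GL_ell p\<^esub> = (\<lambda>x\<in>ell p. x)"
  by (simp add: GL_ell_def BijGroup_def)

lemma GL_ell_inv:
  assumes "1 < p" "T \<in> carrier (GL_ell p)"
  shows "inv\<^bsub>GL_ell p\<^esub> T = (\<lambda>x\<in>ell p. inv_into (ell p) T x)"
proof -
  have "inv\<^bsub>(BijGroup (ell p)) \<lparr>carrier := carrier (GL_ell p)\<rparr>\<^esub> T = inv\<^bsub>BijGroup (ell p)\<^esub> T"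
    by (rule group.m_inv_consistent[OF group_BijGroup subgroup_GL_ell[OF assms(1)] assms(2)])
  then show ?thesis using GL_ellD(6)[OF assms(2)] by (simp add: inv_BijGroup flip: GL_ell_eq)
qed

section \<open>Isometry groups of equivalent norms and bounded subgroups\<close>

lemma equivalent_normD:
  assumes "equivalent_norm_ell p N"
  shows "x \<in> ell p \<Longrightarrow> 0 \<le> N x" "x \<in> ell p \<Longrightarrow> N x = 0 \<longleftrightarrow> x = (\<lambda>n. 0)"
    "x \<in> ell p \<Longrightarrow> N (\<lambda>n. c * x n) = norm c * N x"
    "x \<in> ell p \<Longrightarrow> y \<in> ell p \<Longrightarrow> N (\<lambda>n. x n + y n) \<le> N x + N y"
    "\<exists>a>0. \<exists>b>0. \<forall>x\<in>ell p. a * ell_norm p x \<le> N x \<and> N x \<le> b * ell_norm p x"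
  using assms unfolding equivalent_norm_ell_def by blast+

lemma isometry_groupD:
  assumes "T \<in> isometry_group_ell p N"
  shows "T \<in> extensional (ell p)" "linear_map_ell p T" "T ` ell p = ell p" "x \<in> ell p \<Longrightarrow> N (T x) = N x"
  using assms by (auto simp: isometry_group_ell_def)

lemma isometry_group_inverse:
  assumes p: "1 < p" and N: "equivalent_norm_ell p N" and T: "T \<in> isometry_group_ell p N"
  defines "T' \<equiv> (\<lambda>x\<in>ell p. inv_into (ell p) T x)"
  shows "T' \<in> isometry_group_ell p N" "x \<in> ell p \<Longrightarrow> T' (T x) = x" "x \<in> ell p \<Longrightarrow> T (T' x) = x"
proof -
  note D = isometry_groupD[OF T] and lin = linear_map_ellD[OF isometry_groupD(2)[OF T]]
  have inj: "inj_on T (ell p)"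
  proof (rule inj_onI)
    fix x y assume xy: "x \<in> ell p" "y \<in> ell p" "T x = T y"
    have my: "(\<lambda>n. - 1 * y n) \<in> ell p" using ell_scale xy by blast
    have mem: "(\<lambda>n. x n + - 1 * y n) \<in> ell p" by (rule ell_add[OF p xy(1) my])
    have "T (\<lambda>n. x n + - 1 * y n) = (\<lambda>n. T x n + T (\<lambda>n. - 1 * y n) n)" by (rule lin(2)[OF xy(1) my])
    also have "\<dots> = (\<lambda>n. 0)" unfolding lin(3)[OF xy(2)] using xy(3) by simp
    finally have "N (\<lambda>n. x n + - 1 * y n) = 0"
      using D(4)[OF mem] equivalent_normD(2)[OF N ell_zero] by simp
    then have "(\<lambda>n. x n + - 1 * y n) = (\<lambda>n. 0)" using equivalent_normD(2)[OF N mem] by blast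
    then show "x = y" by (simp add: fun_eq_iff)
  qed
  have mem: "T' x \<in> ell p" if "x \<in> ell p" for x
    using that D(3) by (simp add: T'_def inv_into_into)
  show 1: "T' (T x) = x" if "x \<in> ell p" for x
    using that inj lin by (simp add: T'_def)
  show 2: "T (T' x) = x" if "x \<in> ell p" for x
    using that D(3) by (simp add: T'_def f_inv_into_f)
  have "linear_map_ell p T'"
    by (rule linear_map_ell_inverse[OF p D(2) mem 1 2])
  moreover have "N (T' x) = N x" if "x \<in> ell p" for x
    using D(4)[OF mem[OF that]] 2[OF that] by simp
  moreover have "T' ` ell p = ell p"
  proof -
    have "x \<in> T' ` ell p" if "x \<in> ell p" for x using 1[OF that] lin(1)[OF that] by (metis imageI)
    then show ?thesis using mem by auto
  qed
  ultimately show "T' \<in> isometry_group_ell p N" by (auto simp: isometry_group_ell_def T'_def)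
qed

lemma isometry_bound:
  assumes N: "equivalent_norm_ell p N"
  obtains C where "\<And>T x. T \<in> isometry_group_ell p N \<Longrightarrow> x \<in> ell p \<Longrightarrow> ell_norm p (T x) \<le> C * ell_norm p x"
    "0 \<le> C"
proof -
  obtain a b where ab: "0 < a" "0 < b" "\<And>x. x \<in> ell p \<Longrightarrow> a * ell_norm p x \<le> N x"
    "\<And>x. x \<in> ell p \<Longrightarrow> N x \<le> b * ell_norm p x"
    using equivalent_normD(5)[OF N] by blast
  have "ell_norm p (T x) \<le> b / a * ell_norm p x" if T: "T \<in> isometry_group_ell p N" and x: "x \<in> ell p" for T x
  proof -
    have "T x \<in> ell p" using isometry_groupD(2)[OF T] x by (rule linear_map_ellD(1))
    then have "a * ell_norm p (T x) \<le> N (T x)" using ab by blast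
    also have "\<dots> = N x" using isometry_groupD(4)[OF T x] .
    also have "\<dots> \<le> b * ell_norm p x" using ab x by blast
    finally show ?thesis using ab by (simp add: pos_le_divide_eq mult.commute)
  qed
  then show ?thesis using that[of "b / a"] ab by simp
qed

lemma bounded_subgroup_isometry_group:
  assumes p: "1 < p" and N: "equivalent_norm_ell p N"
  shows "bounded_subgroup_ell p (isometry_group_ell p N)"
proof -
  let ?G = "isometry_group_ell p N"
  obtain C where C: "\<And>T x. T \<in> ?G \<Longrightarrow> x \<in> ell p \<Longrightarrow> ell_norm p (T x) \<le> C * ell_norm p x" "0 \<le> C"
    using isometry_bound[OF N] by blast
  have bl: "bounded_linear_map_ell p T" if "T \<in> ?G" for T
    using isometry_groupD(2)[OF that] C(1)[OF that] by (auto simp: bounded_linear_map_ell_def)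
  have GL: "T \<in> carrier (GL_ell p)" if T: "T \<in> ?G" for T
    using GL_ellI[OF p isometry_groupD(1)[OF T] bl[OF T] bl[OF isometry_group_inverse(1)[OF p N T]]
       isometry_group_inverse(2,3)[OF p N T]] .
  have "subgroup ?G (GL_ell p)"
  proof (rule group.subgroupI[OF group_GL_ell[OF p]])
    show "?G \<subseteq> carrier (GL_ell p)" using GL by blast
    have "linear_map_ell p (\<lambda>x\<in>ell p. x)"
      by (rule linear_map_ell_cong[OF p, where T = "\<lambda>x. x"]) (auto simp: linear_map_ell_def)
    then have "(\<lambda>x\<in>ell p. x) \<in> ?G" by (auto simp: isometry_group_ell_def)
    then show "?G \<noteq> {}" by blast
    fix T assume T: "T \<in> ?G"
    show "inv\<^bsub>GL_ell p\<^esub> T \<in> ?G"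
      using isometry_group_inverse(1)[OF p N T] GL_ell_inv[OF p GL[OF T]] by simp
    fix S assume S: "S \<in> ?G"
    have "compose (ell p) T S ` ell p = T ` (S ` ell p)" by (auto simp: compose_def)
    then have "compose (ell p) T S ` ell p = ell p" using isometry_groupD(3) T S by metis
    moreover have "linear_map_ell p (compose (ell p) T S)"
      by (rule linear_map_ell_cong[OF p linear_map_ell_comp[OF isometry_groupD(2)[OF T] isometry_groupD(2)[OF S]]])
        (simp add: compose_def)
    moreover have "N (compose (ell p) T S x) = N x" if "x \<in> ell p" for x
      using isometry_groupD(4)[OF T linear_map_ellD(1)[OF isometry_groupD(2)[OF S] that]]
        isometry_groupD(4)[OF S that] that by (simp add: compose_def)
    ultimately have "compose (ell p) T S \<in> ?G" by (simp add: isometry_group_ell_def compose_def)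
    then show "T \<otimes>\<^bsub>GL_ell p\<^esub> S \<in> ?G" using GL T S by (simp add: GL_ell_mult)
  qed
  moreover have "op_norm_ell p T \<le> C" if T: "T \<in> ?G" for T
    unfolding op_norm_ell_def
  proof (rule cSup_least)
    show "{ell_norm p (T x) |x. x \<in> ell p \<and> ell_norm p x \<le> 1} \<noteq> {}"
      using ell_zero ell_norm_zero by (metis (mono_tags, lifting) empty_iff mem_Collect_eq zero_le_one)
    fix r assume "r \<in> {ell_norm p (T x) |x. x \<in> ell p \<and> ell_norm p x \<le> 1}"
    then obtain x where x: "r = ell_norm p (T x)" "x \<in> ell p" "ell_norm p x \<le> 1" by blast
    have "C * ell_norm p x \<le> C * 1" using x(3) C(2) by (intro mult_left_mono)
    then show "r \<le> C" using C(1)[OF T x(2)] x(1) by simp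
  qed
  ultimately show ?thesis unfolding bounded_subgroup_ell_def by (auto intro!: bdd_aboveI)
qed

lemma bounded_subgroup_bound:
  fixes H :: "((nat \<Rightarrow> 'a::real_normed_field) \<Rightarrow> (nat \<Rightarrow> 'a)) set"
  assumes p: "1 < p" and H: "bounded_subgroup_ell p H"
  obtains M where "0 \<le> M" "\<And>h x. h \<in> H \<Longrightarrow> x \<in> ell p \<Longrightarrow> ell_norm p (h x) \<le> M * ell_norm p x"
proof -
  obtain M where M: "\<And>h. h \<in> H \<Longrightarrow> op_norm_ell p h \<le> M"
    using H unfolding bounded_subgroup_ell_def bdd_above_def by blast
  have GL: "h \<in> carrier (GL_ell p)" if "h \<in> H" for h
    using H that subgroup.subset unfolding bounded_subgroup_ell_def by blast
  have le1: "ell_norm p (h x) \<le> M" if h: "h \<in> H" and x: "x \<in> ell p" "ell_norm p x \<le> 1" for h x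
  proof -
    obtain C where C: "\<And>x. x \<in> ell p \<Longrightarrow> ell_norm p (h x) \<le> C * ell_norm p x"
      using GL_ellD(4)[OF GL[OF h]] unfolding bounded_linear_map_ell_def by blast
    \<comment> \<open>A supremum of reals bounds its elements only once the set is known to be
      bounded; here this comes from the boundedness of the single operator \<open>h\<close>.\<close>
    have "bdd_above {ell_norm p (h x) |x. x \<in> ell p \<and> ell_norm p x \<le> 1}"
    proof (rule bdd_aboveI)
      fix r assume "r \<in> {ell_norm p (h x) |x. x \<in> ell p \<and> ell_norm p x \<le> 1}"
      then obtain x where x: "r = ell_norm p (h x)" "x \<in> ell p" "ell_norm p x \<le> 1" by blast
      have "C * ell_norm p x \<le> \<bar>C\<bar> * ell_norm p x" by (intro mult_right_mono) auto
      also have "\<dots> \<le> \<bar>C\<bar> * 1" using x by (intro mult_left_mono) auto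
      finally show "r \<le> \<bar>C\<bar>" using C[OF x(2)] x(1) by simp
    qed
    then have "ell_norm p (h x) \<le> op_norm_ell p h"
      unfolding op_norm_ell_def using x by (intro cSup_upper) auto
    then show ?thesis using M[OF h] by simp
  qed
  have "ell_norm p (h x) \<le> max M 0 * ell_norm p x" if h: "h \<in> H" and x: "x \<in> ell p" for h x
  proof (cases "x = (\<lambda>n. 0)")
    case True
    then show ?thesis using linear_map_ellD(4)[OF GL_ellD(3)[OF GL[OF h]]] by simp
  next
    case False
    define s where "s = ell_norm p x"
    have s: "0 < s" using False ell_norm_eq_0_iff[OF x] by (simp add: s_def order_less_le)
    define c :: 'a where "c = of_real (1 / s)"
    have c: "norm c = 1 / s" using s by (simp add: c_def norm_divide)
    have "ell_norm p (\<lambda>n. c * x n) = 1" using ell_norm_scale[OF p x, of c] s c by (simp add: s_def)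
    then have "ell_norm p (h (\<lambda>n. c * x n)) \<le> M" using le1[OF h ell_scale[OF x]] by simp
    moreover have hx: "h x \<in> ell p" using linear_map_ellD(1)[OF GL_ellD(3)[OF GL[OF h]] x] .
    ultimately have "1 / s * ell_norm p (h x) \<le> M"
      unfolding linear_map_ellD(3)[OF GL_ellD(3)[OF GL[OF h]] x] ell_norm_scale[OF p hx] c by simp
    then have "ell_norm p (h x) \<le> M * s" using s by (simp add: pos_divide_le_eq)
    also have "\<dots> \<le> max M 0 * s" using s by (intro mult_right_mono) auto
    finally show ?thesis by (simp add: s_def)
  qed
  then show ?thesis using that[of "max M 0"] by simp
qed

text \<open>\<open>N'\<close> is the supremum of \<open>N\<close> over the orbit: finite because
  \<open>H\<close> is uniformly bounded, at least \<open>N\<close> because the identity belongs to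
  \<open>H\<close>, and invariant because \<open>H\<close> is a group.\<close>

lemma invariant_norm:
  fixes H :: "((nat \<Rightarrow> 'a::real_normed_field) \<Rightarrow> (nat \<Rightarrow> 'a)) set" and N :: "(nat \<Rightarrow> 'a) \<Rightarrow> real"
  assumes p: "1 < p" and H: "bounded_subgroup_ell p H" and N: "equivalent_norm_ell p N"
  obtains N' where "equivalent_norm_ell p N'" "H \<subseteq> isometry_group_ell p N'"
proof -
  obtain M where M: "0 \<le> M" "\<And>h x. h \<in> H \<Longrightarrow> x \<in> ell p \<Longrightarrow> ell_norm p (h x) \<le> M * ell_norm p x"
    using bounded_subgroup_bound[OF p H] by blast
  have sub: "subgroup H (GL_ell p)" using H by (simp add: bounded_subgroup_ell_def)
  have GL: "h \<in> carrier (GL_ell p)" if "h \<in> H" for h using sub that subgroup.subset by blast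
  have lin: "linear_map_ell p h" if "h \<in> H" for h using GL_ellD(3)[OF GL[OF that]] .
  note linD = linear_map_ellD[OF lin]
  obtain a b where ab: "0 < a" "0 < b" "\<And>x. x \<in> ell p \<Longrightarrow> a * ell_norm p x \<le> N x"
    "\<And>x. x \<in> ell p \<Longrightarrow> N x \<le> b * ell_norm p x"
    using equivalent_normD(5)[OF N] by blast
  have one: "(\<lambda>x\<in>ell p. x) \<in> H" using subgroup.one_closed[OF sub] by (simp add: GL_ell_one)
  have Nh: "N (h x) \<le> b * M * ell_norm p x" if "h \<in> H" "x \<in> ell p" for h x
  proof -
    have "N (h x) \<le> b * ell_norm p (h x)" using ab linD(1) that by blast
    also have "\<dots> \<le> b * (M * ell_norm p x)" using M that ab by (intro mult_left_mono) auto
    finally show ?thesis by (simp add: mult.assoc)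
  qed
  have bdd: "bdd_above ((\<lambda>h. N (h x)) ` H)" if "x \<in> ell p" for x
    using Nh[OF _ that] by (intro bdd_aboveI[of _ "b * M * ell_norm p x"]) auto
  define N' where "N' = (\<lambda>x\<in>ell p. SUP h\<in>H. N (h x))"
  have up: "N (h x) \<le> N' x" if "h \<in> H" "x \<in> ell p" for h x
    using cSUP_upper[OF that(1) bdd[OF that(2)]] that by (simp add: N'_def)
  have least: "N' x \<le> B" if "x \<in> ell p" "\<And>h. h \<in> H \<Longrightarrow> N (h x) \<le> B" for x B
    using cSUP_least[of H "\<lambda>h. N (h x)" B] that one by (auto simp: N'_def)
  have ge: "N x \<le> N' x" if "x \<in> ell p" for x using up[OF one that] that by simp
  have lower: "a * ell_norm p x \<le> N' x" if "x \<in> ell p" for x using ab(3)[OF that] ge[OF that] by simp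
  have scale_le: "N' (\<lambda>n. c * x n) \<le> norm c * N' x" if x: "x \<in> ell p" for c x
  proof (rule least)
    show "(\<lambda>n. c * x n) \<in> ell p" using ell_scale x by blast
    fix h assume h: "h \<in> H"
    have "N (h (\<lambda>n. c * x n)) = norm c * N (h x)"
      using linD(3)[OF h x] equivalent_normD(3)[OF N linD(1)[OF h x]] by simp
    also have "\<dots> \<le> norm c * N' x" using up[OF h x] by (intro mult_left_mono) auto
    finally show "N (h (\<lambda>n. c * x n)) \<le> norm c * N' x" .
  qed
  \<comment> \<open>The reverse inequality is \<open>scale_le\<close> for the inverse
    scalar.\<close>
  have scale: "N' (\<lambda>n. c * x n) = norm c * N' x" if x: "x \<in> ell p" for c x
  proof (cases "c = 0")
    case True
    have "N' (\<lambda>n. 0) \<le> 0" using scale_le[OF ell_zero, of 0] by simp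
    moreover have "0 \<le> N' (\<lambda>n. 0)" using lower[OF ell_zero] by simp
    ultimately show ?thesis using True by simp
  next
    case False
    have "N' (\<lambda>n. inverse c * (c * x n)) \<le> norm (inverse c) * N' (\<lambda>n. c * x n)"
      by (rule scale_le[OF ell_scale[OF x]])
    then have "N' x \<le> N' (\<lambda>n. c * x n) / norm c"
      using False by (simp add: norm_inverse divide_inverse mult.commute flip: mult.assoc)
    then have "norm c * N' x \<le> N' (\<lambda>n. c * x n)"
      using False by (simp add: pos_le_divide_eq mult.commute)
    then show ?thesis using scale_le[OF x, of c] by simp
  qed
  have "equivalent_norm_ell p N'"
    unfolding equivalent_norm_ell_def
  proof (intro conjI ballI allI)
    show "N' \<in> extensional (ell p)" by (simp add: N'_def)
    show "0 \<le> N' x" if "x \<in> ell p" for x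
      using equivalent_normD(1)[OF N that] ge[OF that] by simp
    show "N' x = 0 \<longleftrightarrow> x = (\<lambda>n. 0)" if x: "x \<in> ell p" for x
    proof
      assume "N' x = 0"
      then show "x = (\<lambda>n. 0)"
        using equivalent_normD(1,2)[OF N x] ge[OF x] by simp
    qed (use scale[OF ell_zero, of 0] in simp)
    show "N' (\<lambda>n. c * x n) = norm c * N' x" if "x \<in> ell p" for c x using scale[OF that] .
    show "N' (\<lambda>n. x n + y n) \<le> N' x + N' y" if x: "x \<in> ell p" and y: "y \<in> ell p" for x y
    proof (rule least[OF ell_add[OF p x y]])
      fix h assume h: "h \<in> H"
      have "N (h (\<lambda>n. x n + y n)) \<le> N (h x) + N (h y)"
        unfolding linD(2)[OF h x y] by (rule equivalent_normD(4)[OF N linD(1)[OF h x] linD(1)[OF h y]])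
      then show "N (h (\<lambda>n. x n + y n)) \<le> N' x + N' y" using up[OF h x] up[OF h y] by simp
    qed
    \<comment> \<open>The added \<open>1\<close> keeps the constant positive, as only
      \<open>0 \<le> M\<close> is known.\<close>
    have "N' x \<le> (b * M + 1) * ell_norm p x" if "x \<in> ell p" for x
    proof (rule least[OF that])
      fix h assume "h \<in> H"
      then have "N (h x) \<le> b * M * ell_norm p x" using Nh that by blast
      also have "\<dots> \<le> (b * M + 1) * ell_norm p x" by (intro mult_right_mono) auto
      finally show "N (h x) \<le> (b * M + 1) * ell_norm p x" .
    qed
    moreover have "0 < b * M + 1" using ab M by (simp add: add_nonneg_pos)
    ultimately show "\<exists>a>0. \<exists>b>0. \<forall>x\<in>ell p. a * ell_norm p x \<le> N' x \<and> N' x \<le> b * ell_norm p x"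
      using ab(1) lower by blast
  qed
  moreover have "H \<subseteq> isometry_group_ell p N'"
  proof
    fix g assume g: "g \<in> H"
    have le: "N' (g x) \<le> N' x" if g: "g \<in> H" and x: "x \<in> ell p" for g x
    proof (rule least[OF linD(1)[OF g x]])
      fix h assume h: "h \<in> H"
      have "compose (ell p) h g \<in> H"
        using subgroup.m_closed[OF sub h g] GL_ell_mult[OF GL[OF h] GL[OF g]] by simp
      then show "N (h (g x)) \<le> N' x" using up[OF _ x] x by (force simp: compose_def)
    qed
    define g' where "g' = (\<lambda>x\<in>ell p. inv_into (ell p) g x)"
    have g': "g' \<in> H" using subgroup.m_inv_closed[OF sub g] GL_ell_inv[OF p GL[OF g]] by (simp add: g'_def)
    have bij: "bij_betw g (ell p) (ell p)" using GL_ellD(2)[OF GL[OF g]] .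
    have "N' (g x) = N' x" if x: "x \<in> ell p" for x
    proof -
      have "g' (g x) = x" using bij x linD(1)[OF g x] by (simp add: g'_def bij_betw_inv_into_left)
      then have "N' x \<le> N' (g x)" using le[OF g' linD(1)[OF g x]] by simp
      then show ?thesis using le[OF g x] by simp
    qed
    then show "g \<in> isometry_group_ell p N'"
      using GL_ellD(1)[OF GL[OF g]] lin[OF g] bij by (auto simp: isometry_group_ell_def bij_betw_def)
  qed
  ultimately show ?thesis using that by blast
qed

section \<open>The renormings\<close>

context block_embedding
begin

lemma isoZ_cong:
  assumes "T \<in> isoZ nu" and eq: "\<And>z. z \<in> Z \<Longrightarrow> T z = T' z"
  shows "T' \<in> isoZ nu"
proof -
  have "T' ` Z = T ` Z" using eq by (auto simp: image_iff)
  then show ?thesis using assms(1) by (simp add: isoZ_def linZ_def Z_add Z_vscale flip: eq)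
qed

text \<open>Inherited from the inverse map \<open>Phi\<close>, whose linearity is read off its
  formula.\<close>

lemma Psi_linear:
  "x \<in> ell p \<Longrightarrow> y \<in> ell p \<Longrightarrow> Psi (\<lambda>n. x n + y n) = Psi x + Psi y"
  "x \<in> ell p \<Longrightarrow> Psi (\<lambda>n. c * x n) = vscale c (Psi x)"
proof -
  have "Phi (Psi x + Psi y) = (\<lambda>n. x n + y n)" by (simp add: Phi_linear Phi_Psi)
  then show "Psi (\<lambda>n. x n + y n) = Psi x + Psi y" if "x \<in> ell p" "y \<in> ell p"
    using Psi_Phi[OF Z_add[OF Psi_Z(1)[OF that(1)] Psi_Z(1)[OF that(2)]]] by simp
  have "Phi (vscale c (Psi x)) = (\<lambda>n. c * x n)" by (simp add: Phi_linear Phi_Psi)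
  then show "Psi (\<lambda>n. c * x n) = vscale c (Psi x)" if "x \<in> ell p"
    using Psi_Phi[OF Z_vscale[OF Psi_Z(1)[OF that]], of c] by simp
qed

lemma isoZ_imp_isometry_group:
  fixes N :: "(nat \<Rightarrow> 'a) \<Rightarrow> real"
  assumes T: "T \<in> isoZ nu" and N: "\<And>x. x \<in> ell p \<Longrightarrow> N x = nu (Psi x)"
  shows "(\<lambda>x\<in>ell p. Phi (T (Psi x))) \<in> isometry_group_ell p N"
proof -
  note lin = linZD[OF isoZD(1)[OF T]]
  let ?T = "\<lambda>x\<in>ell p. Phi (T (Psi x))"
  have TP: "T (Psi x) \<in> Z" if "x \<in> ell p" for x using lin(1) Psi_Z(1) that by blast
  have mem: "Phi (T (Psi x)) \<in> ell p" if "x \<in> ell p" for x using Phi_ell(1) TP that by blast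
  have "linear_map_ell p ?T"
    using mem p_gt_1
    by (auto simp: linear_map_ell_def ell_add ell_scale Psi_linear lin Psi_Z(1) Phi_linear)
  moreover have "?T ` ell p = ell p"
  proof -
    have "y \<in> ?T ` ell p" if y: "y \<in> ell p" for y
    proof -
      obtain z where z: "z \<in> Z" "Psi y = T z" using isoZD(3)[OF T] Psi_Z(1)[OF y] by blast
      then have "?T (Phi z) = Phi (Psi y)" using Phi_ell(1) by (simp add: Psi_Phi)
      then have "?T (Phi z) = y" by (simp add: Phi_Psi)
      then show ?thesis using Phi_ell(1)[OF z(1)] by (metis imageI)
    qed
    then show ?thesis using mem by auto
  qed
  moreover have "N (?T x) = N x" if "x \<in> ell p" for x
    using that N mem TP isoZD(2)[OF T Psi_Z(1)[OF that]] by (simp add: Psi_Phi)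
  ultimately show ?thesis by (simp add: isometry_group_ell_def)
qed

lemma isometry_group_imp_isoZ:
  fixes N :: "(nat \<Rightarrow> 'a) \<Rightarrow> real"
  assumes h: "h \<in> isometry_group_ell p N" and N: "\<And>x. x \<in> ell p \<Longrightarrow> N x = nu (Psi x)"
  shows "(\<lambda>z. Psi (h (Phi z))) \<in> isoZ nu"
proof -
  note D = isometry_groupD[OF h] and lin = linear_map_ellD[OF isometry_groupD(2)[OF h]]
  have hP: "h (Phi z) \<in> ell p" if "z \<in> Z" for z using lin(1) Phi_ell(1) that by blast
  have "linZ (\<lambda>z. Psi (h (Phi z)))"
    using hP by (auto simp: linZ_def Psi_Z(1) Phi_linear lin Phi_ell(1) Psi_linear)
  moreover have "(\<lambda>z. Psi (h (Phi z))) ` Z = Z"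
  proof -
    have "w \<in> (\<lambda>z. Psi (h (Phi z))) ` Z" if w: "w \<in> Z" for w
    proof -
      obtain x where x: "x \<in> ell p" "Phi w = h x" using D(3) Phi_ell(1)[OF w] by blast
      then have "Psi (h (Phi (Psi x))) = w" using Psi_Phi[OF w] by (simp add: Phi_Psi)
      then show ?thesis using Psi_Z(1)[OF x(1)] by (metis (mono_tags, lifting) imageI)
    qed
    then show ?thesis using hP Psi_Z(1) by auto
  qed
  moreover have "nu (Psi (h (Phi z))) = nu z" if "z \<in> Z" for z
    using N[OF hP[OF that]] N[OF Phi_ell(1)[OF that]] D(4)[OF Phi_ell(1)[OF that]] Psi_Phi[OF that] by simp
  ultimately show ?thesis by (simp add: isoZ_def)
qed

lemma equivalent_norm_transfer:
  assumes nu_vscale: "\<And>c x. x \<in> Z \<Longrightarrow> nu (vscale c x) = norm c * nu x"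
    and nu_add: "\<And>x y. x \<in> Z \<Longrightarrow> y \<in> Z \<Longrightarrow> nu (x + y) \<le> nu x + nu y"
    and lo: "0 < lo" "\<And>x. x \<in> Z \<Longrightarrow> lo * lp_norm x \<le> nu x" and hi: "0 < hi" "\<And>x. x \<in> Z \<Longrightarrow> nu x \<le> hi * lp_norm x"
  shows "equivalent_norm_ell p (\<lambda>x\<in>ell p. nu (Psi x))"
proof -
  define A where "A = (4 * shift_bound) powr (1 / p)"
  define B where "B = (2 powr p * (2 * shift_bound + khin_bound)) powr (1 / p)"
  have A: "0 < A" and B: "0 < B" using shift_bound_pos khin_bound(1) by (auto simp: A_def B_def)
  have a: "lo / A * ell_norm p x \<le> nu (Psi x)" if x: "x \<in> ell p" for x
  proof -
    have "ell_norm p x \<le> A * lp_norm (Psi x)"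
      using Phi_ell(2)[OF Psi_Z(1)[OF x]] by (simp add: Phi_Psi A_def)
    then have "lo / A * ell_norm p x \<le> lo / A * (A * lp_norm (Psi x))"
      using lo A by (intro mult_left_mono) auto
    also have "\<dots> \<le> nu (Psi x)" using lo(2)[OF Psi_Z(1)[OF x]] A by simp
    finally show ?thesis .
  qed
  have b: "nu (Psi x) \<le> hi * B * ell_norm p x" if x: "x \<in> ell p" for x
  proof -
    have "nu (Psi x) \<le> hi * lp_norm (Psi x)" using hi(2) Psi_Z(1)[OF x] .
    also have "\<dots> \<le> hi * (B * ell_norm p x)"
      using Psi_Z(2)[OF x] hi(1) by (intro mult_left_mono) (auto simp: B_def)
    finally show ?thesis by (simp add: mult.assoc)
  qed
  have pos: "0 < lo / A" "0 < hi * B" using lo hi A B by auto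
  show ?thesis
    unfolding equivalent_norm_ell_def
  proof (intro conjI ballI allI)
    show "(\<lambda>x\<in>ell p. nu (Psi x)) \<in> extensional (ell p)" by simp
    fix x :: "nat \<Rightarrow> 'a" assume x: "x \<in> ell p"
    have nn: "0 \<le> lo / A * ell_norm p x"
      by (rule mult_nonneg_nonneg[OF less_imp_le[OF pos(1)] ell_norm_nonneg])
    show "0 \<le> (\<lambda>x\<in>ell p. nu (Psi x)) x" using a[OF x] nn x by simp
    have "x = (\<lambda>n. 0)" if "nu (Psi x) = 0"
    proof -
      have "lo / A * ell_norm p x = 0" using a[OF x] nn that by simp
      then show ?thesis using ell_norm_eq_0_iff[OF x] lo(1) A by simp
    qed
    moreover have "nu (Psi (\<lambda>n. 0)) = 0"
      using a[OF ell_zero] b[OF ell_zero] by simp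
    ultimately show "((\<lambda>x\<in>ell p. nu (Psi x)) x = 0) = (x = (\<lambda>n. 0))" using x by auto
    show "(\<lambda>x\<in>ell p. nu (Psi x)) (\<lambda>n. c * x n) = norm c * (\<lambda>x\<in>ell p. nu (Psi x)) x" for c
      using x by (simp add: ell_scale Psi_linear nu_vscale Psi_Z(1))
    show "(\<lambda>x\<in>ell p. nu (Psi x)) (\<lambda>n. x n + y n)
        \<le> (\<lambda>x\<in>ell p. nu (Psi x)) x + (\<lambda>x\<in>ell p. nu (Psi x)) y" if y: "y \<in> ell p" for y
      using x y nu_add[OF Psi_Z(1)[OF x] Psi_Z(1)[OF y]] ell_add[OF p_gt_1 x y] Psi_linear(1)[OF x y]
      by simp
  next
    show "\<exists>a>0. \<exists>b>0. \<forall>x\<in>ell p. a * ell_norm p x \<le> (\<lambda>x\<in>ell p. nu (Psi x)) x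
        \<and> (\<lambda>x\<in>ell p. nu (Psi x)) x \<le> b * ell_norm p x"
      using pos a b by (intro exI[of _ "lo / A"] exI[of _ "hi * B"] conjI) auto
  qed
qed

definition renorming :: "(nat \<Rightarrow> 'a) \<Rightarrow> real"
  where "renorming = (\<lambda>x\<in>ell p. lp_norm (Psi x))"

lemma equivalent_renorming: "equivalent_norm_ell p renorming"
  unfolding renorming_def
  by (rule equivalent_norm_transfer[of lp_norm 1 1]) (auto simp: lp_norm_vscale lp_norm_triangle)

text \<open>If \<open>N\<close> is invariant under \<open>M\<close>, the isometries of the sum
  preserve \<open>N\<close> too, so \<open>ex_larger_isoZ\<close> applies to it. The resulting
  \<open>N'\<close> has a bounded isometry group strictly above that of \<open>N\<close>, hence
  strictly above \<open>M\<close>.\<close>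

lemma isometry_group_not_in_maximal:
  assumes p2: "p \<noteq> 2" and n: "\<And>k. n k = 2 ^ e k" "\<And>k. 2 \<le> n k" and e: "inj e"
    and sub: "isometry_group_ell p renorming \<subseteq> M"
  shows "\<not> maximal_bounded_subgroup_ell p M"
proof
  assume max: "maximal_bounded_subgroup_ell p M"
  then have M: "bounded_subgroup_ell p M" by (simp add: maximal_bounded_subgroup_ell_def)
  obtain N where N: "equivalent_norm_ell p N" "M \<subseteq> isometry_group_ell p N"
    using invariant_norm[OF p_gt_1 M equivalent_renorming] by blast
  note ND = equivalent_normD[OF N(1)]
  define nu where "nu z = N (Phi z)" for z
  have Nnu: "N x = nu (Psi x)" for x by (simp add: nu_def Phi_Psi)
  obtain a b where ab: "0 < a" "0 < b" "\<And>x. x \<in> ell p \<Longrightarrow> a * ell_norm p x \<le> N x"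
    "\<And>x. x \<in> ell p \<Longrightarrow> N x \<le> b * ell_norm p x"
    using ND(5) by blast
  define A where "A = (4 * shift_bound) powr (1 / p)"
  define B where "B = (2 powr p * (2 * shift_bound + khin_bound)) powr (1 / p)"
  have A: "0 < A" and B: "0 < B" using shift_bound_pos khin_bound(1) by (auto simp: A_def B_def)
  \<comment> \<open>\<open>a\<close> and \<open>b\<close> compare \<open>N\<close> with the norm of
    the sequence space, while \<open>A\<close> and \<open>B\<close> bound \<open>Phi\<close> and
    \<open>Psi\<close>.\<close>
  interpret sym_norm_distinct cj p n nu "a / B" "b * A" e
  proof unfold_locales
    show "nu (vscale c x) = norm c * nu x" if "x \<in> Z" for c x
      using ND(3)[OF Phi_ell(1)[OF that]] by (simp add: nu_def Phi_linear)
    show "nu (x + y) \<le> nu x + nu y" if "x \<in> Z" "y \<in> Z" for x y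
      using ND(4)[OF Phi_ell(1)[OF that(1)] Phi_ell(1)[OF that(2)]] by (simp add: nu_def Phi_linear)
    show "0 < a / B" using ab B by simp
    show "a / B * lp_norm x \<le> nu x" if x: "x \<in> Z" for x
    proof -
      have "lp_norm x \<le> B * ell_norm p (Phi x)"
        using Psi_Z(2)[OF Phi_ell(1)[OF x]] Psi_Phi[OF x] by (simp add: B_def)
      then have "a / B * lp_norm x \<le> a / B * (B * ell_norm p (Phi x))"
        using ab B by (intro mult_left_mono) auto
      also have "\<dots> \<le> nu x" using ab(3)[OF Phi_ell(1)[OF x]] B by (simp add: nu_def)
      finally show ?thesis .
    qed
    show "nu x \<le> b * A * lp_norm x" if x: "x \<in> Z" for x
    proof -
      have "nu x \<le> b * ell_norm p (Phi x)" using ab(4)[OF Phi_ell(1)[OF x]] by (simp add: nu_def)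
      also have "\<dots> \<le> b * (A * lp_norm x)"
        using Phi_ell(2)[OF x] ab by (intro mult_left_mono) (auto simp: A_def)
      finally show ?thesis by (simp add: mult.assoc)
    qed
    show "isoZ lp_norm \<subseteq> isoZ nu"
    proof
      fix T assume T: "T \<in> isoZ lp_norm"
      have "(\<lambda>x\<in>ell p. Phi (T (Psi x))) \<in> isometry_group_ell p renorming"
        by (rule isoZ_imp_isometry_group[OF T]) (simp add: renorming_def)
      then have iso: "(\<lambda>x\<in>ell p. Phi (T (Psi x))) \<in> isometry_group_ell p N" using sub N(2) by blast
      have "nu (T z) = nu z" if z: "z \<in> Z" for z
        using isometry_groupD(4)[OF iso Phi_ell(1)[OF z]] Phi_ell(1)[OF z] by (simp add: Psi_Phi[OF z] nu_def)
      then show "T \<in> isoZ nu" using T by (simp add: isoZ_def)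
    qed
  qed (use n e p2 in auto)
  obtain nu' lo' hi' where nu': "\<And>c x. x \<in> Z \<Longrightarrow> nu' (vscale c x) = norm c * nu' x"
    "\<And>x y. x \<in> Z \<Longrightarrow> y \<in> Z \<Longrightarrow> nu' (x + y) \<le> nu' x + nu' y"
    "0 < lo'" "0 < hi'" "\<And>x. x \<in> Z \<Longrightarrow> lo' * lp_norm x \<le> nu' x" "\<And>x. x \<in> Z \<Longrightarrow> nu' x \<le> hi' * lp_norm x"
    "isoZ nu \<subset> isoZ nu'"
    using ex_larger_isoZ by blast
  define N' where "N' = (\<lambda>x\<in>ell p. nu' (Psi x))"
  have N': "equivalent_norm_ell p N'"
    unfolding N'_def by (rule equivalent_norm_transfer[OF nu'(1,2,3,5,4,6)])
  have N'nu: "N' x = nu' (Psi x)" if "x \<in> ell p" for x using that by (simp add: N'_def)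
  have "isometry_group_ell p N \<subseteq> isometry_group_ell p N'"
  proof
    fix h assume h: "h \<in> isometry_group_ell p N"
    have "(\<lambda>z. Psi (h (Phi z))) \<in> isoZ nu'"
      using isometry_group_imp_isoZ[OF h Nnu] nu'(7) by blast
    from isoZ_imp_isometry_group[OF this N'nu]
    have "(\<lambda>x\<in>ell p. h x) \<in> isometry_group_ell p N'" by (simp add: Phi_Psi)
    then show "h \<in> isometry_group_ell p N'"
      using isometry_groupD(1)[OF h] by (simp add: extensional_restrict)
  qed
  moreover obtain T where T: "T \<in> isoZ nu'" "T \<notin> isoZ nu" using nu'(7) by blast
  have "(\<lambda>x\<in>ell p. Phi (T (Psi x))) \<notin> isometry_group_ell p N"
  proof
    assume h: "(\<lambda>x\<in>ell p. Phi (T (Psi x))) \<in> isometry_group_ell p N"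
    have "nu (T z) = nu z" if z: "z \<in> Z" for z
      using isometry_groupD(4)[OF h Phi_ell(1)[OF z]] Phi_ell(1)[OF z] by (simp add: Psi_Phi[OF z] nu_def)
    then show False using T by (simp add: isoZ_def)
  qed
  ultimately have "M \<subset> isometry_group_ell p N'"
    using N(2) isoZ_imp_isometry_group[OF T(1) N'nu] by blast
  then show False
    using max bounded_subgroup_isometry_group[OF p_gt_1 N'] by (auto simp: maximal_bounded_subgroup_ell_def)
qed

end

text \<open>Makes clusters available for the norm of the sum itself, whose isometry groups have to
  be told apart for different exponents.\<close>

lemma (in block_embedding) sym_norm_distinct_lp_norm:
  assumes "p \<noteq> 2" "\<And>k. n k = 2 ^ e k" "\<And>k. 2 \<le> n k" "inj e"
  shows "sym_norm_distinct cj p n lp_norm 1 1 e"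
  using assms by unfold_locales (auto simp: lp_norm_vscale lp_norm_triangle)

text \<open>Clusters are the minimal nonzero invariant subspaces, so an intertwining map carries clusters to
  clusters; the dimension of a cluster determines the exponents \<open>e\<close> of its blocks by binary expansion.\<close>

lemma intertwined_range_subset:
  fixes cj :: "'a::{real_normed_field,real_inner} \<Rightarrow> 'a"
    and W W' :: "(nat \<Rightarrow> nat \<Rightarrow> 'a) \<Rightarrow> nat \<Rightarrow> nat \<Rightarrow> 'a"
  assumes "sym_norm_distinct cj p n (blocks.lp_norm p n) 1 1 e"
    and "sym_norm_distinct cj p n' (blocks.lp_norm p n') 1 1 e'"
    and W: "\<And>x. x \<in> blocks.Z p n \<Longrightarrow> W x \<in> blocks.Z p n'"
      "\<And>x y. x \<in> blocks.Z p n \<Longrightarrow> y \<in> blocks.Z p n \<Longrightarrow> W (x + y) = W x + W y"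
      "\<And>c x. x \<in> blocks.Z p n \<Longrightarrow> W (vscale c x) = vscale c (W x)"
    and W': "\<And>x. x \<in> blocks.Z p n' \<Longrightarrow> W' x \<in> blocks.Z p n"
      "\<And>x y. x \<in> blocks.Z p n' \<Longrightarrow> y \<in> blocks.Z p n' \<Longrightarrow> W' (x + y) = W' x + W' y"
      "\<And>c x. x \<in> blocks.Z p n' \<Longrightarrow> W' (vscale c x) = vscale c (W' x)"
    and inv: "\<And>x. x \<in> blocks.Z p n \<Longrightarrow> W' (W x) = x" "\<And>x. x \<in> blocks.Z p n' \<Longrightarrow> W (W' x) = x"
    and conj: "\<And>h. h \<in> blocks.isoZ p n' (blocks.lp_norm p n') \<Longrightarrow> (\<lambda>x. W' (h (W x))) \<in> blocks.isoZ p n (blocks.lp_norm p n)"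
      "\<And>h. h \<in> blocks.isoZ p n (blocks.lp_norm p n) \<Longrightarrow> (\<lambda>x. W (h (W' x))) \<in> blocks.isoZ p n' (blocks.lp_norm p n')"
  shows "range e \<subseteq> range e'"
proof
  interpret A: sym_norm_distinct cj p n "blocks.lp_norm p n" 1 1 e by fact
  interpret B: sym_norm_distinct cj p n' "blocks.lp_norm p n'" 1 1 e' by fact
  fix r assume "r \<in> range e"
  then obtain i where i: "r = e i" by blast
  define X where "X = {w \<in> A.Z. part (A.cluster i) w = w}"
  have diffA: "W (x - y) = W x - W y" if "x \<in> A.Z" "y \<in> A.Z" for x y
    using W(2)[OF that(1) A.Z_vscale[OF that(2), of "- 1"]] W(3)[OF that(2), of "- 1"] by (simp add: vscale_minus1)
  have diffB: "W' (x - y) = W' x - W' y" if "x \<in> B.Z" "y \<in> B.Z" for x y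
    using W'(2)[OF that(1) B.Z_vscale[OF that(2), of "- 1"]] W'(3)[OF that(2), of "- 1"] by (simp add: vscale_minus1)
  have W0: "W 0 = 0" using W(3)[OF A.Z_0, of 0] by simp
  have W'0: "W' 0 = 0" using W'(3)[OF B.Z_0, of 0] by simp
  obtain u where u: "u \<in> A.Z" "part {i} u = u" "A.block_norm i u = 1" using A.ex_block_vector[of 1 i] by auto
  have uX: "u \<in> X" "u \<noteq> 0"
    using u part_subset_id[OF u(2), of "A.cluster i"] A.linked_refl by (auto simp: X_def A.cluster_def)
  have X_Z: "w \<in> A.Z" if "w \<in> X" for w using that by (simp add: X_def)
  obtain i' where i': "\<And>w. w \<in> B.Z \<Longrightarrow> part (B.cluster i') w = w \<Longrightarrow> w \<in> W ` X"
  proof (rule B.invariant_subspace_contains_comp[of "W ` X" "W u"])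
    show "x - y \<in> W ` X" if xy: "x \<in> W ` X" "y \<in> W ` X" for x y
    proof -
      obtain v w where vw: "v \<in> X" "w \<in> X" "x = W v" "y = W w" using xy by blast
      then have "v - w \<in> X" by (auto simp: X_def A.Z_diff part_diff)
      then show ?thesis using vw diffA[OF X_Z X_Z] by (metis imageI)
    qed
    show "vscale c x \<in> W ` X" if x: "x \<in> W ` X" for c x
    proof -
      obtain v where v: "v \<in> X" "x = W v" using x by blast
      then have "vscale c v \<in> X" by (auto simp: X_def A.Z_vscale part_vscale)
      then show ?thesis using v W(3)[OF X_Z] by (metis imageI)
    qed
    show "h x \<in> W ` X" if h: "h \<in> B.isoZ (blocks.lp_norm p n')" and x: "x \<in> W ` X" for h x
    proof -
      obtain v where v: "v \<in> X" "x = W v" using x by blast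
      note hh = conj(1)[OF h]
      have "W' (h (W v)) \<in> X"
        using A.isoZ_preserves_comp[OF hh] A.linZD(1)[OF A.isoZD(1)[OF hh]] v by (auto simp: X_def)
      moreover have "h (W v) \<in> B.Z" using B.linZD(1)[OF B.isoZD(1)[OF h]] W(1) X_Z v by blast
      then have "W (W' (h (W v))) = h (W v)" by (rule inv(2))
      ultimately show ?thesis using v by (metis imageI)
    qed
    show "W u \<in> W ` X" "W u \<in> B.Z" using uX W(1) u by auto
    show "W u \<noteq> 0" using inv(1)[OF u(1)] W'0 uX by auto
  qed (rule that; blast)
  define X' where "X' = {w \<in> B.Z. part (B.cluster i') w = w}"
  have X'_Z: "w \<in> B.Z" if "w \<in> X'" for w using that by (simp add: X'_def)
  have W'X: "W' w \<in> X" if w: "w \<in> X'" for w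
  proof -
    obtain v where v: "v \<in> X" "w = W v" using i' w by (auto simp: X'_def)
    then show ?thesis using inv(1)[OF X_Z] by simp
  qed
  obtain u' where u': "u' \<in> B.Z" "part {i'} u' = u'" "B.block_norm i' u' = 1" using B.ex_block_vector[of 1 i'] by auto
  have u'X: "u' \<in> X'" "u' \<noteq> 0"
    using u' part_subset_id[OF u'(2), of "B.cluster i'"] B.linked_refl by (auto simp: X'_def B.cluster_def)
  obtain j where j: "\<And>w. w \<in> A.Z \<Longrightarrow> part (A.cluster j) w = w \<Longrightarrow> w \<in> W' ` X'"
  proof (rule A.invariant_subspace_contains_comp[of "W' ` X'" "W' u'"])
    show "x - y \<in> W' ` X'" if xy: "x \<in> W' ` X'" "y \<in> W' ` X'" for x y
    proof -
      obtain v w where vw: "v \<in> X'" "w \<in> X'" "x = W' v" "y = W' w" using xy by blast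
      then have "v - w \<in> X'" by (auto simp: X'_def B.Z_diff part_diff)
      then show ?thesis using vw diffB[OF X'_Z X'_Z] by (metis imageI)
    qed
    show "vscale c x \<in> W' ` X'" if x: "x \<in> W' ` X'" for c x
    proof -
      obtain v where v: "v \<in> X'" "x = W' v" using x by blast
      then have "vscale c v \<in> X'" by (auto simp: X'_def B.Z_vscale part_vscale)
      then show ?thesis using v W'(3)[OF X'_Z] by (metis imageI)
    qed
    show "h x \<in> W' ` X'" if h: "h \<in> A.isoZ (blocks.lp_norm p n)" and x: "x \<in> W' ` X'" for h x
    proof -
      obtain v where v: "v \<in> X'" "x = W' v" using x by blast
      note hh = conj(2)[OF h]
      have "W (h (W' v)) \<in> X'"
        using B.isoZ_preserves_comp[OF hh] B.linZD(1)[OF B.isoZD(1)[OF hh]] v by (auto simp: X'_def)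
      moreover have "h (W' v) \<in> A.Z" using A.linZD(1)[OF A.isoZD(1)[OF h]] W'(1) X'_Z v by blast
      then have "W' (W (h (W' v))) = h (W' v)" by (rule inv(1))
      ultimately show ?thesis using v by (metis imageI)
    qed
    show "W' u' \<in> W' ` X'" "W' u' \<in> A.Z" using u'X W'(1) u' by auto
    show "W' u' \<noteq> 0" using inv(2)[OF u'(1)] W0 u'X by auto
  qed (rule that; blast)
  \<comment> \<open>The cluster found on the way back through \<open>W'\<close> lies inside
    \<open>X\<close>, so it is the one of \<open>i\<close>. Hence \<open>W\<close> maps
    \<open>X\<close> onto \<open>X'\<close> and not onto something larger.\<close>
  have "A.cluster j = A.cluster i"
  proof -
    obtain v where v: "v \<in> A.Z" "part {j} v = v" "A.block_norm j v = 1" using A.ex_block_vector[of 1 j] by auto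
    have "part (A.cluster j) v = v"
      using part_subset_id[OF v(2), of "A.cluster j"] A.linked_refl by (simp add: A.cluster_def)
    then have "v \<in> X" using j[OF v(1)] W'X by blast
    then have "part (A.cluster i) v = v" by (simp add: X_def)
    then have "j \<in> A.cluster i" using A.part_single_disjoint[OF v(2), of "A.cluster i"] v(3) by (metis A.block_norm_0 zero_neq_one)
    then show ?thesis using A.cluster_eq by (simp add: A.cluster_def)
  qed
  then have WX: "W w \<in> X'" if "w \<in> X" for w
  proof -
    obtain v where v: "v \<in> X'" "w = W' v" using j \<open>A.cluster j = A.cluster i\<close> \<open>w \<in> X\<close> by (auto simp: X_def)
    then show ?thesis using inv(2)[OF X'_Z] by simp
  qed
  have fsA: "w \<in> fin_space n (A.cluster i) \<longleftrightarrow> w \<in> X" for w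
    using A.fin_space_iff[OF A.finite_cluster] by (simp add: X_def)
  have fsB: "w \<in> fin_space n' (B.cluster i') \<longleftrightarrow> w \<in> X'" for w
    using B.fin_space_iff[OF B.finite_cluster] by (simp add: X'_def)
  have "sum n (A.cluster i) \<le> sum n' (B.cluster i')"
  proof (rule dimension_le[OF A.finite_cluster B.finite_cluster, where T = W], unfold fsA fsB)
    show "x = 0" if "x \<in> X" "W x = 0" for x using inv(1)[OF X_Z[OF that(1)]] that(2) W'0 by simp
  qed (use W WX X_Z in auto)
  moreover have "sum n' (B.cluster i') \<le> sum n (A.cluster i)"
  proof (rule dimension_le[OF B.finite_cluster A.finite_cluster, where T = W'], unfold fsA fsB)
    show "x = 0" if "x \<in> X'" "W' x = 0" for x using inv(2)[OF X'_Z[OF that(1)]] that(2) W0 by simp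
  qed (use W' W'X X'_Z in auto)
  ultimately have "set_encode (e ` A.cluster i) = set_encode (e' ` B.cluster i')"
    using A.sum_n[OF A.finite_cluster] B.sum_n[OF B.finite_cluster] by simp
  then have "e ` A.cluster i = e' ` B.cluster i'"
    using A.finite_cluster B.finite_cluster by (simp add: set_encode_eq)
  moreover have "i \<in> A.cluster i" using A.linked_refl by (simp add: A.cluster_def)
  ultimately show "r \<in> range e'" unfolding i by blast
qed

text \<open>Each \<open>k\<close> chooses between \<open>2 * k + 1\<close> and
  \<open>2 * k + 2\<close>. Choices for different \<open>k\<close> never coincide, the even values
  reveal \<open>J\<close>, and positivity gives dimensions of at least \<open>2\<close>.\<close>

definition expo :: "nat set \<Rightarrow> nat \<Rightarrow> nat"
  where "expo J k = 2 * k + 1 + (if k \<in> J then 1 else 0)"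

lemma inj_expo: "inj (expo J)"
  by (rule injI) (auto simp: expo_def split: if_splits; presburger)

lemma range_expo_eq: "range (expo J) = range (expo J') \<Longrightarrow> J = J'"
proof -
  have *: "2 * k + 2 \<in> range (expo J) \<longleftrightarrow> k \<in> J" for k J
  proof
    assume "2 * k + 2 \<in> range (expo J)"
    then obtain l where l: "2 * k + 2 = 2 * l + 1 + (if l \<in> J then 1 else (0::nat))"
      by (auto simp: expo_def)
    have "l \<in> J"
    proof (rule ccontr)
      assume "l \<notin> J"
      then have "2 * k + 2 = 2 * l + 1" using l by simp
      then show False by presburger
    qed
    then show "k \<in> J" using l by simp
  next
    assume "k \<in> J"
    then have "expo J k = 2 * k + 2" by (simp add: expo_def)
    then show "2 * k + 2 \<in> range (expo J)" by (metis rangeI)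
  qed
  assume "range (expo J) = range (expo J')"
  then show ?thesis using *[of _ J] *[of _ J'] by blast
qed

definition dims :: "nat set \<Rightarrow> nat \<Rightarrow> nat"
  where "dims J k = 2 ^ expo J k"

lemma dims_ge_2: "2 \<le> dims J k"
  by (simp add: dims_def expo_def)

section \<open>Non-conjugate renormings, one for each set of natural numbers\<close>

context conj_field
begin

lemma block_embedding_dims: "1 < p \<Longrightarrow> block_embedding cj p (dims J)"
  by unfold_locales (use dims_ge_2[of J] in \<open>auto intro: less_le_trans[of 0 2]\<close>)

text \<open>Between the two block pictures \<open>T\<close> becomes a map \<open>W\<close> that
  intertwines the isometry groups. Conjugation is assumed pointwise and in both directions, so that
  the lemma serves \<open>T\<close> and its inverse alike.\<close>

lemma conjugate_range_subset:
  assumes p: "1 < p" "p \<noteq> 2"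
    and T: "T \<in> carrier (GL_ell p :: ((nat \<Rightarrow> 'a) \<Rightarrow> nat \<Rightarrow> 'a) monoid)"
    and imp1: "\<And>h. h \<in> isometry_group_ell p (block_embedding.renorming p (dims J') :: (nat \<Rightarrow> 'a) \<Rightarrow> real) \<Longrightarrow>
      (\<lambda>x\<in>ell p. inv_into (ell p) T (h (T x))) \<in> isometry_group_ell p (block_embedding.renorming p (dims J))"
    and imp2: "\<And>h. h \<in> isometry_group_ell p (block_embedding.renorming p (dims J) :: (nat \<Rightarrow> 'a) \<Rightarrow> real) \<Longrightarrow>
      (\<lambda>x\<in>ell p. T (h (inv_into (ell p) T x))) \<in> isometry_group_ell p (block_embedding.renorming p (dims J'))"
  shows "range (expo J) \<subseteq> range (expo J')"
proof -
  interpret A: block_embedding cj p "dims J" by (rule block_embedding_dims[OF p(1)])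
  interpret B: block_embedding cj p "dims J'" by (rule block_embedding_dims[OF p(1)])
  let ?T' = "inv_into (ell p) T"
  note lin = linear_map_ellD[OF GL_ellD(3)[OF T]]
  have "linear_map_ell p ?T'" using GL_ellD(5)[OF T] by (simp add: bounded_linear_map_ell_def)
  note lin' = linear_map_ellD[OF this]
  have TT: "?T' (T x) = x" "T (?T' x) = x" if "x \<in> ell p" for x
    using that GL_ellD(2)[OF T] by (simp_all add: bij_betw_inv_into_left bij_betw_inv_into_right)
  define W where "W z = B.Psi (T (A.Phi z))" for z
  define W' where "W' z = A.Psi (?T' (B.Phi z))" for z
  show ?thesis
  proof (rule intertwined_range_subset[where cj = cj and p = p and n = "dims J" and n' = "dims J'" and W = W and W' = W'])
    show "sym_norm_distinct cj p (dims J) A.lp_norm 1 1 (expo J)"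
      by (rule A.sym_norm_distinct_lp_norm[OF p(2) _ dims_ge_2 inj_expo]) (simp add: dims_def)
    show "sym_norm_distinct cj p (dims J') B.lp_norm 1 1 (expo J')"
      by (rule B.sym_norm_distinct_lp_norm[OF p(2) _ dims_ge_2 inj_expo]) (simp add: dims_def)
    have A: "T (A.Phi z) \<in> ell p" if "z \<in> A.Z" for z using lin(1) A.Phi_ell(1) that by blast
    have B: "?T' (B.Phi z) \<in> ell p" if "z \<in> B.Z" for z using lin'(1) B.Phi_ell(1) that by blast
    show "W z \<in> B.Z" if "z \<in> A.Z" for z using B.Psi_Z(1) A that by (simp add: W_def)
    show "W' z \<in> A.Z" if "z \<in> B.Z" for z using A.Psi_Z(1) B that by (simp add: W'_def)
    show "W (x + y) = W x + W y" if "x \<in> A.Z" "y \<in> A.Z" for x y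
      using that A by (simp add: W_def A.Phi_linear lin A.Phi_ell(1) B.Psi_linear)
    show "W (vscale c x) = vscale c (W x)" if "x \<in> A.Z" for c x
      using that A by (simp add: W_def A.Phi_linear lin A.Phi_ell(1) B.Psi_linear)
    show "W' (x + y) = W' x + W' y" if "x \<in> B.Z" "y \<in> B.Z" for x y
      using that B by (simp add: W'_def B.Phi_linear lin' B.Phi_ell(1) A.Psi_linear)
    show "W' (vscale c x) = vscale c (W' x)" if "x \<in> B.Z" for c x
      using that B by (simp add: W'_def B.Phi_linear lin' B.Phi_ell(1) A.Psi_linear)
    show "W' (W x) = x" if "x \<in> A.Z" for x
      using that by (simp add: W_def W'_def B.Phi_Psi TT A.Phi_ell(1) A.Psi_Phi)
    show "W (W' x) = x" if "x \<in> B.Z" for x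
      using that by (simp add: W_def W'_def A.Phi_Psi TT B.Phi_ell(1) B.Psi_Phi)
    show "(\<lambda>x. W' (h (W x))) \<in> A.isoZ A.lp_norm" if h: "h \<in> B.isoZ B.lp_norm" for h
    proof -
      have "(\<lambda>x\<in>ell p. B.Phi (h (B.Psi x))) \<in> isometry_group_ell p B.renorming"
        by (rule B.isoZ_imp_isometry_group[OF h]) (simp add: B.renorming_def)
      from A.isometry_group_imp_isoZ[OF imp1[OF this], of A.lp_norm]
      have iso: "(\<lambda>z. A.Psi ((\<lambda>x\<in>ell p. ?T' ((\<lambda>x\<in>ell p. B.Phi (h (B.Psi x))) (T x))) (A.Phi z))) \<in> A.isoZ A.lp_norm"
        by (simp add: A.renorming_def)
      have "A.Psi ((\<lambda>x\<in>ell p. ?T' ((\<lambda>x\<in>ell p. B.Phi (h (B.Psi x))) (T x))) (A.Phi z)) = W' (h (W z))"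
        if "z \<in> A.Z" for z
        using that A A.Phi_ell(1) by (simp add: W_def W'_def)
      then show ?thesis by (rule A.isoZ_cong[OF iso])
    qed
    show "(\<lambda>x. W (h (W' x))) \<in> B.isoZ B.lp_norm" if h: "h \<in> A.isoZ A.lp_norm" for h
    proof -
      have "(\<lambda>x\<in>ell p. A.Phi (h (A.Psi x))) \<in> isometry_group_ell p A.renorming"
        by (rule A.isoZ_imp_isometry_group[OF h]) (simp add: A.renorming_def)
      from B.isometry_group_imp_isoZ[OF imp2[OF this], of B.lp_norm]
      have iso: "(\<lambda>z. B.Psi ((\<lambda>x\<in>ell p. T ((\<lambda>x\<in>ell p. A.Phi (h (A.Psi x))) (?T' x))) (B.Phi z))) \<in> B.isoZ B.lp_norm"
        by (simp add: B.renorming_def)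
      have "B.Psi ((\<lambda>x\<in>ell p. T ((\<lambda>x\<in>ell p. A.Phi (h (A.Psi x))) (?T' x))) (B.Phi z)) = W (h (W' z))"
        if "z \<in> B.Z" for z
        using that B B.Phi_ell(1) by (simp add: W_def W'_def)
      then show ?thesis by (rule B.isoZ_cong[OF iso])
    qed
  qed
qed

lemma not_conjugate:
  assumes p: "1 < p" "p \<noteq> 2" and J: "J \<noteq> J'"
  shows "\<not> conjugate_ell p
    (isometry_group_ell p (block_embedding.renorming p (dims J) :: (nat \<Rightarrow> 'a) \<Rightarrow> real))
    (isometry_group_ell p (block_embedding.renorming p (dims J')))"
proof
  interpret A: block_embedding cj p "dims J" by (rule block_embedding_dims[OF p(1)])
  interpret B: block_embedding cj p "dims J'" by (rule block_embedding_dims[OF p(1)])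
  let ?G = "isometry_group_ell p A.renorming" and ?G' = "isometry_group_ell p B.renorming"
  assume "conjugate_ell p ?G ?G'"
  then obtain T where T: "T \<in> carrier (GL_ell p)" and
    eq: "?G = (\<lambda>g. inv\<^bsub>GL_ell p\<^esub> T \<otimes>\<^bsub>GL_ell p\<^esub> g \<otimes>\<^bsub>GL_ell p\<^esub> T) ` ?G'"
    unfolding conjugate_ell_def by blast
  interpret G: group "GL_ell p :: ((nat \<Rightarrow> 'a) \<Rightarrow> nat \<Rightarrow> 'a) monoid" by (rule group_GL_ell[OF p(1)])
  let ?T' = "\<lambda>x\<in>ell p. inv_into (ell p) T x"
  have T': "inv\<^bsub>GL_ell p\<^esub> T = ?T'" "?T' \<in> carrier (GL_ell p)"
    using GL_ell_inv[OF p(1) T] G.inv_closed[OF T] by simp_all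
  note lin = linear_map_ellD[OF GL_ellD(3)[OF T]]
  have "linear_map_ell p (inv_into (ell p) T)" using GL_ellD(5)[OF T] by (simp add: bounded_linear_map_ell_def)
  note lin' = linear_map_ellD[OF this]
  have TT: "inv_into (ell p) T (T x) = x" "T (inv_into (ell p) T x) = x" if "x \<in> ell p" for x
    using that GL_ellD(2)[OF T] by (simp_all add: bij_betw_inv_into_left bij_betw_inv_into_right)
  have GL': "g \<in> carrier (GL_ell p)" if "g \<in> ?G'" for g
    using that bounded_subgroup_isometry_group[OF p(1) B.equivalent_renorming] subgroup.subset
    unfolding bounded_subgroup_ell_def by blast
  have conj: "inv\<^bsub>GL_ell p\<^esub> T \<otimes>\<^bsub>GL_ell p\<^esub> g \<otimes>\<^bsub>GL_ell p\<^esub> T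
      = (\<lambda>x\<in>ell p. inv_into (ell p) T (g (T x)))" if g: "g \<in> ?G'" for g
  proof -
    have m: "?T' \<otimes>\<^bsub>GL_ell p\<^esub> g = compose (ell p) ?T' g" by (rule GL_ell_mult[OF T'(2) GL'[OF g]])
    have "compose (ell p) ?T' g \<in> carrier (GL_ell p)"
      using G.m_closed[OF T'(2) GL'[OF g]] unfolding m .
    from GL_ell_mult[OF this T] show ?thesis
      unfolding T'(1) m
      using lin(1) linear_map_ellD(1)[OF isometry_groupD(2)[OF g]]
      by (auto simp: compose_def fun_eq_iff)
  qed
  have 1: "(\<lambda>x\<in>ell p. inv_into (ell p) T (h (T x))) \<in> ?G" if "h \<in> ?G'" for h
    using eq conj[OF that] that by (metis (no_types, lifting) imageI)
  have 2: "(\<lambda>x\<in>ell p. T (h (inv_into (ell p) T x))) \<in> ?G'" if h: "h \<in> ?G" for h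
  proof -
    obtain g where g: "g \<in> ?G'" "h = (\<lambda>x\<in>ell p. inv_into (ell p) T (g (T x)))"
      using eq h conj by (metis (no_types, lifting) imageE)
    have "(\<lambda>x\<in>ell p. T (h (inv_into (ell p) T x))) x = g x" for x
    proof (cases "x \<in> ell p")
      case True
      then show ?thesis
        using g TT lin'(1) linear_map_ellD(1)[OF isometry_groupD(2)[OF g(1)]] by simp
    next
      case False
      then show ?thesis using isometry_groupD(1)[OF g(1)] by (simp add: extensional_def)
    qed
    then have "(\<lambda>x\<in>ell p. T (h (inv_into (ell p) T x))) = g" by (rule ext)
    then show ?thesis using g by simp
  qed
  have "range (expo J) \<subseteq> range (expo J')"
    by (rule conjugate_range_subset[OF p T 1 2])
  \<comment> \<open>Conjugacy is symmetric: the inverse of \<open>T\<close> exchanges the roles of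
    the two groups.\<close>
  moreover have "range (expo J') \<subseteq> range (expo J)"
  proof (rule conjugate_range_subset[OF p T'(2)])
    have inv: "inv_into (ell p) ?T' x = T x" if "x \<in> ell p" for x
      using GL_ellD(2)[OF T'(2)] that TT lin(1) lin'(1)
      by (intro inv_into_f_eq) (auto simp: bij_betw_def)
    show "(\<lambda>x\<in>ell p. inv_into (ell p) ?T' (h (?T' x))) \<in> ?G'" if h: "h \<in> ?G" for h
    proof -
      have "(\<lambda>x\<in>ell p. inv_into (ell p) ?T' (h (?T' x))) = (\<lambda>x\<in>ell p. T (h (inv_into (ell p) T x)))"
        using inv lin'(1) linear_map_ellD(1)[OF isometry_groupD(2)[OF h]] by (intro restrict_ext) simp
      then show ?thesis using 2[OF h] by simp
    qed
    show "(\<lambda>x\<in>ell p. ?T' (h (inv_into (ell p) ?T' x))) \<in> ?G" if h: "h \<in> ?G'" for h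
    proof -
      have "(\<lambda>x\<in>ell p. ?T' (h (inv_into (ell p) ?T' x))) = (\<lambda>x\<in>ell p. inv_into (ell p) T (h (T x)))"
        using inv lin(1) linear_map_ellD(1)[OF isometry_groupD(2)[OF h]] by (intro restrict_ext) simp
      then show ?thesis using 1[OF h] by simp
    qed
  qed
  ultimately show False using J range_expo_eq by blast
qed

text \<open>Equal norms would have conjugate groups. With this, non-conjugacy makes the renormings
  for different \<open>J\<close> distinct, so that they can be counted.\<close>

lemma conjugate_refl:
  fixes G :: "((nat \<Rightarrow> 'a) \<Rightarrow> nat \<Rightarrow> 'a) set"
  assumes "1 < p" "G \<subseteq> carrier (GL_ell p)"
  shows "conjugate_ell p G G"
proof -
  interpret group "GL_ell p :: ((nat \<Rightarrow> 'a) \<Rightarrow> nat \<Rightarrow> 'a) monoid" by (rule group_GL_ell[OF assms(1)])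
  have "inv\<^bsub>GL_ell p\<^esub> \<one>\<^bsub>GL_ell p\<^esub> \<otimes>\<^bsub>GL_ell p\<^esub> g \<otimes>\<^bsub>GL_ell p\<^esub> \<one>\<^bsub>GL_ell p\<^esub> = g" if "g \<in> G" for g
    using that assms by auto
  then have "G = (\<lambda>g. inv\<^bsub>GL_ell p\<^esub> \<one>\<^bsub>GL_ell p\<^esub> \<otimes>\<^bsub>GL_ell p\<^esub> g \<otimes>\<^bsub>GL_ell p\<^esub> \<one>\<^bsub>GL_ell p\<^esub>) ` G"
    by simp
  then show ?thesis unfolding conjugate_ell_def by blast
qed

lemma ex_continuum_renormings:
  assumes p: "1 < p" "p \<noteq> 2"
  shows "\<exists>\<N> :: ((nat \<Rightarrow> 'a) \<Rightarrow> real) set. \<N> \<approx> (UNIV :: real set) \<and>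
    (\<forall>N\<in>\<N>. equivalent_norm_ell p N) \<and>
    (\<forall>N\<in>\<N>. \<not> (\<exists>M. maximal_bounded_subgroup_ell p M \<and> isometry_group_ell p N \<subseteq> M)) \<and>
    (\<forall>N\<in>\<N>. \<forall>N'\<in>\<N>. N \<noteq> N' \<longrightarrow>
      \<not> conjugate_ell p (isometry_group_ell p N) (isometry_group_ell p N'))"
proof -
  define N where "N J = (block_embedding.renorming p (dims J) :: (nat \<Rightarrow> 'a) \<Rightarrow> real)" for J
  have eqv: "equivalent_norm_ell p (N J)" for J
    unfolding N_def by (rule block_embedding.equivalent_renorming[OF block_embedding_dims[OF p(1)]])
  have not_max: "\<not> maximal_bounded_subgroup_ell p M" if "isometry_group_ell p (N J) \<subseteq> M" for J M
    using block_embedding.isometry_group_not_in_maximal[OF block_embedding_dims[OF p(1)] p(2) _ dims_ge_2 inj_expo that[unfolded N_def]]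
    by (simp add: dims_def)
  have nc: "\<not> conjugate_ell p (isometry_group_ell p (N J)) (isometry_group_ell p (N J'))"
    if "J \<noteq> J'" for J J'
    unfolding N_def by (rule not_conjugate[OF p that])
  have "inj N"
  proof (rule injI, rule ccontr)
    fix J J' assume eq: "N J = N J'" and "J \<noteq> J'"
    have "isometry_group_ell p (N J') \<subseteq> carrier (GL_ell p)"
      using bounded_subgroup_isometry_group[OF p(1) eqv] subgroup.subset
      unfolding bounded_subgroup_ell_def by blast
    then show False using nc[OF \<open>J \<noteq> J'\<close>] conjugate_refl[OF p(1)] eq by simp
  qed
  then have "range N \<approx> (UNIV :: nat set set)"
    using inj_on_image_eqpoll_self by blast
  then have "range N \<approx> (UNIV :: real set)"
    using nat_sets_eqpoll_reals eqpoll_trans by blast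
  moreover have "\<forall>N1\<in>range N. \<forall>N2\<in>range N. N1 \<noteq> N2 \<longrightarrow>
      \<not> conjugate_ell p (isometry_group_ell p N1) (isometry_group_ell p N2)"
    using nc by (metis (no_types, lifting) rangeE)
  moreover have "\<forall>N1\<in>range N. \<not> (\<exists>M. maximal_bounded_subgroup_ell p M \<and> isometry_group_ell p N1 \<subseteq> M)"
    using not_max by blast
  moreover have "\<forall>N1\<in>range N. equivalent_norm_ell p N1" using eqv by blast
  ultimately show ?thesis by (intro exI[of _ "range N"] conjI)
qed

end

theorem theorem4p3:
  fixes p :: real
  assumes "1 < p" and "p \<noteq> 2"
  shows "(\<exists>\<N> :: ((nat \<Rightarrow> real) \<Rightarrow> real) set.
            \<N> \<approx> (UNIV :: real set) \<and>
            (\<forall>N\<in>\<N>. equivalent_norm_ell p N) \<and>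
            (\<forall>N\<in>\<N>. \<not> (\<exists>M. maximal_bounded_subgroup_ell p M \<and> isometry_group_ell p N \<subseteq> M)) \<and>
            (\<forall>N\<in>\<N>. \<forall>N'\<in>\<N>. N \<noteq> N' \<longrightarrow>
               \<not> conjugate_ell p (isometry_group_ell p N) (isometry_group_ell p N'))) \<and>
         (\<exists>\<N> :: ((nat \<Rightarrow> complex) \<Rightarrow> real) set.
            \<N> \<approx> (UNIV :: real set) \<and>
            (\<forall>N\<in>\<N>. equivalent_norm_ell p N) \<and>
            (\<forall>N\<in>\<N>. \<not> (\<exists>M. maximal_bounded_subgroup_ell p M \<and> isometry_group_ell p N \<subseteq> M)) \<and>
            (\<forall>N\<in>\<N>. \<forall>N'\<in>\<N>. N \<noteq> N' \<longrightarrow>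
               \<not> conjugate_ell p (isometry_group_ell p N) (isometry_group_ell p N')))"
  using conj_field.ex_continuum_renormings[OF conj_field_real assms]
    conj_field.ex_continuum_renormings[OF conj_field_complex assms] by (rule conjI)

end
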